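(* Negative arenas, with strategies on $A\vdash B$ as morphisms from $A$ to $B$, composition $\odot$ and identities $\mathrm{id}_A$ as described in the context, form a category $\mathsf{Strat}$.
   Context: $X+Y=(\{1\}\times X)\cup(\{2\}\times Y)$. A forest is a poset whose principal down-sets are finite and totally ordered; $a\lessdot b$ denotes immediate precedence. An arena $A=(|A|,\le_A,\mathrm{pol}_A)$ is a countable forest with polarity $\mathrm{pol}_A:|A|\to\{-,+\}$, alternating along $\lessdot_A$; it is negative if its minimal events are negative. $A\otimes B$ has events $|A|+|B|$, componentwise order and inherited polarity; $A^\perp$ reverses polarities; $A\vdash B=A^\perp\otimes B$. A configuration $x$ on $A$ is a finite forest $(|x|,\le_x)$ with $\partial_x:|x|\to|A|$ such that $e$ is minimal iff $\partial_x e$ is, and $e_1\lessdot_x e_2\Rightarrow\partial_xe_1\lessdot_A\partial_xe_2$. A symmetry $\varphi:x\cong_A y$ is an order-isomorphism with $\partial_y\circ\varphi=\partial_x$. Positions are symmetry classes; $\mathscr P(A)$ is their set; each $\mathsf x$ has a fixed representative $\bar{\mathsf x}$, and $\mathrm{Sym}(\mathsf x)$ is the group of symmetries $\bar{\mathsf x}\cong_A\bar{\mathsf x}$. An augmentation $q$ on $A$ is $(|q|,\le_{\langle q\rangle},\le_q,\partial_q)$ where $(|q|,\le_{\langle q\rangle},\partial_q)$ is a configuration and $(|q|,\le_q)$ a forest with, writing $\mathrm{pol}(e)=\mathrm{pol}_A(\partial_qe)$: $e_1\le_{\langle q\rangle}e_2\Rightarrow e_1\le_qe_2$; if $e_1\lessdot_qe_2$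 and ($\mathrm{pol}(e_1)=+$ or $\mathrm{pol}(e_2)=-$) then $e_1\lessdot_{\langle q\rangle}e_2$; if $e^-\lessdot_qe_1^+$, $e^-\lessdot_qe_2^+$ then $e_1=e_2$; $\le_q$-maximal events are positive; $\le_q$-minimal events are negative. Isomorphisms preserve and reflect both orders and the display; isogmentations are isomorphism classes, $\mathsf{Isog}(A)$ their set, each with a fixed representative. Composition. For negative $A,B,C$, $q$ on $A\vdash B$ and $p$ on $B\vdash C$, let $x^q_A$ (resp. $x^q_B$) be the configuration on $A$ (resp. $B$) formed by events of $q$ displayed to $\{1\}\times|A|$ (resp. $\{2\}\times|B|$), with order $\le_{\langle q\rangle}$ and display composed with the projection; likewise $x^p_B,x^p_C$. Given a symmetry $\varphi:x^q_B\cong_Bx^p_B$, the interaction has events $|q|+|p|$ ordered by the transitive closure of $\rhd=\{((1,m),(1,m'))\mid m<_qm'\}\cup\{((2,m),(2,m'))\mid m<_pm'\}\cup\{((1,m),(2,\varphi(m)))\mid m\in x^q_B,\mathrm{pol}_{A\vdash B}(\partial_qm)=+\}\cup\{((2,m),(1,\varphi^{-1}(m)))\mid m\in x^p_B,\mathrm{pol}_{B\vdash C}(\partial_pm)=+\}$. The composite $p\odot_\varphi q$ is the augmentation on $A\vdash C$ obtained by restricting the interaction to $x^q_A+x^p_C$, with desequentialization order the disjoint union of the orders of $x^q_A$ and $x^p_C$, and display $(1,m)\mapsto(1,a)$ if $\partial_qm=(1,a)$, $(2,m)\mapsto(2,c)$ if $\partial_pm=(2,c)$. For isogmentations $\mathsf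 q,\mathsf p$, $\mathsf p\odot_\varphi\mathsf q$ is the class of the composite of their representatives along $\varphi$ (a symmetry between the corresponding configurations of the representatives). A strategy $\sigma$ on $A$ is a function $\mathsf{Isog}(A)\to[0,+\infty]$. For $\sigma$ on $A\vdash B$ and $\tau$ on $B\vdash C$, $(\tau\odot\sigma)(\mathsf r)=\sum\sigma(\mathsf q)\tau(\mathsf p)$ over all triples $(\mathsf q,\mathsf p,\varphi)$, $\mathsf q\in\mathsf{Isog}(A\vdash B)$, $\mathsf p\in\mathsf{Isog}(B\vdash C)$, $\varphi$ a symmetry between the $B$-parts of their representatives, with $\mathsf p\odot_\varphi\mathsf q=\mathsf r$. Copycat: for $x$ on $A$, $cc_x$ on $A\vdash A$ has events $|x|+|x|$, desequentialization order $(i,m)\le(i,n)$ iff $m\le_xn$ (no cross relations), display $(i,m)\mapsto(i,\partial_xm)$, and $\le_{cc_x}$ the partial order generated by the desequentialization order together with $(1,m)\le(2,n)$ whenever $m\le_xn$ and $\mathrm{pol}_A(\partial_xm)=+$, and $(2,m)\le(1,n)$ whenever $m\le_xn$ and $\mathrm{pol}_A(\partial_xm)=-$. $\mathrm{id}_A$ maps the class of $cc_{\bar{\mathsf x}}$ to $1/|\mathrm{Sym}(\mathsf x)|$ for each $\mathsf x\in\mathscr P(A)$, and everything else to $0$. *)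

theory Defs
  imports "HOL-Analysis.Infinite_Sum"
    "HOL-Library.FuncSet"
    "HOL-Library.Countable_Set"
    "HOL-Library.Extended_Nonnegative_Real"
begin

section \<open>Forests\<close>

text \<open>A poset is a carrier set together with a reflexive order relation on it.\<close>

definition forest :: "'a set \<Rightarrow> 'a rel \<Rightarrow> bool" where
  "forest S r \<longleftrightarrow>
     partial_order_on S r \<and>
     (\<forall>a\<in>S. finite {b. (b, a) \<in> r} \<and> total_on {b. (b, a) \<in> r} r)"

definition immediate :: "'a rel \<Rightarrow> 'a rel" where
  "immediate r = {(a, b) \<in> r. a \<noteq> b \<and> \<not> (\<exists>c. c \<noteq> a \<and> c \<noteq> b \<and> (a, c) \<in> r \<and> (c, b) \<in> r)}"

definition minimal_in :: "'a set \<Rightarrow> 'a rel \<Rightarrow> 'a \<Rightarrow> bool" where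
  "minimal_in S r a \<longleftrightarrow> a \<in> S \<and> (\<forall>b\<in>S. (b, a) \<in> r \<longrightarrow> b = a)"

definition maximal_in :: "'a set \<Rightarrow> 'a rel \<Rightarrow> 'a \<Rightarrow> bool" where
  "maximal_in S r a \<longleftrightarrow> a \<in> S \<and> (\<forall>b\<in>S. (a, b) \<in> r \<longrightarrow> b = a)"

definition sum_rel :: "'a rel \<Rightarrow> 'b rel \<Rightarrow> ('a + 'b) rel" where
  "sum_rel r s = map_prod Inl Inl ` r \<union> map_prod Inr Inr ` s"


section \<open>Arenas\<close>

datatype polarity = Neg | Pos

fun opposite :: "polarity \<Rightarrow> polarity" where
  "opposite Neg = Pos"
| "opposite Pos = Neg"

record 'a arena =
  moves :: "'a set"
  arena_le :: "'a rel"
  pol :: "'a \<Rightarrow> polarity"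

text \<open>The polarity function has domain \<open>moves A\<close>; being extensional, it is determined by its
  values there, so that equality of records is equality of arenas.\<close>

definition arena :: "'a arena \<Rightarrow> bool" where
  "arena A \<longleftrightarrow>
     countable (moves A) \<and> forest (moves A) (arena_le A) \<and>
     pol A \<in> extensional (moves A) \<and>
     (\<forall>(a, b) \<in> immediate (arena_le A). pol A a \<noteq> pol A b)"

definition negative :: "'a arena \<Rightarrow> bool" where
  "negative A \<longleftrightarrow> (\<forall>a. minimal_in (moves A) (arena_le A) a \<longrightarrow> pol A a = Neg)"

definition dual :: "'a arena \<Rightarrow> 'a arena" where
  "dual A = \<lparr>moves = moves A, arena_le = arena_le A,
             pol = (\<lambda>a\<in>moves A. opposite (pol A a))\<rparr>"

definition tensor :: "'a arena \<Rightarrow> 'b arena \<Rightarrow> ('a + 'b) arena" where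
  "tensor A B = \<lparr>moves = moves A <+> moves B, arena_le = sum_rel (arena_le A) (arena_le B),
                 pol = restrict (case_sum (pol A) (pol B)) (moves A <+> moves B)\<rparr>"

definition hom_arena :: "'a arena \<Rightarrow> 'b arena \<Rightarrow> ('a + 'b) arena" (infix "\<turnstile>" 55) where
  "A \<turnstile> B = tensor (dual A) B"


section \<open>Configurations and positions\<close>

record ('e, 'a) configuration =
  events :: "'e set"
  deseq :: "'e rel"
  display :: "'e \<Rightarrow> 'a"

text \<open>Only the values of \<open>display x\<close> on \<open>events x\<close> matter. The predicates below apply to any
  extension of the record, in particular to augmentations, where they then concern the
  underlying desequentialization.\<close>

definition configuration :: "'a arena \<Rightarrow> ('e, 'a, 'z) configuration_scheme \<Rightarrow> bool" where
  "configuration A x \<longleftrightarrow>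
     finite (events x) \<and> forest (events x) (deseq x) \<and>
     display x ` events x \<subseteq> moves A \<and>
     (\<forall>e\<in>events x. minimal_in (events x) (deseq x) e
                    \<longleftrightarrow> minimal_in (moves A) (arena_le A) (display x e)) \<and>
     (\<forall>(e, e') \<in> immediate (deseq x). (display x e, display x e') \<in> immediate (arena_le A))"

text \<open>Extensionality makes a symmetry the same thing as a function with domain \<open>events x\<close>,
  so that symmetries are counted correctly in cardinalities and in sums.\<close>

definition symmetries ::
  "('e, 'a, 'y) configuration_scheme \<Rightarrow> ('f, 'a, 'z) configuration_scheme \<Rightarrow> ('e \<Rightarrow> 'f) set" where
  "symmetries x y = {\<phi> \<in> extensional (events x).
     bij_betw \<phi> (events x) (events y) \<and>
     (\<forall>e\<in>events x. \<forall>e'\<in>events x. (e, e') \<in> deseq x \<longleftrightarrow> (\<phi> e, \<phi> e') \<in> deseq y) \<and>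
     (\<forall>e\<in>events x. display y (\<phi> e) = display x e)}"

text \<open>Every finite set of events can be renamed into the natural numbers, so classes are taken
  among structures with events in \<^typ>\<open>nat\<close>; \<open>position_of A x\<close> is the class of a configuration
  with events in an arbitrary type, and likewise for \<open>isog_of\<close> below.\<close>

definition position_of ::
  "'a arena \<Rightarrow> ('e, 'a) configuration \<Rightarrow> (nat, 'a) configuration set" where
  "position_of A x = {y. configuration A y \<and> symmetries x y \<noteq> {}}"

definition Positions :: "'a arena \<Rightarrow> (nat, 'a) configuration set set" where
  "Positions A = {position_of A x | x :: (nat, 'a) configuration. configuration A x}"

definition representative :: "'x set \<Rightarrow> 'x" where
  "representative X = (SOME x. x \<in> X)"

definition Sym :: "(nat, 'a) configuration set \<Rightarrow> (nat \<Rightarrow> nat) set" where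
  "Sym X = symmetries (representative X) (representative X)"


section \<open>Augmentations and isogmentations\<close>

record ('e, 'a) augmentation = "('e, 'a) configuration" +
  seq :: "'e rel"

definition augmentation :: "'a arena \<Rightarrow> ('e, 'a) augmentation \<Rightarrow> bool" where
  "augmentation A q \<longleftrightarrow>
     configuration A q \<and> forest (events q) (seq q) \<and>
     deseq q \<subseteq> seq q \<and>
     (\<forall>(e, e') \<in> immediate (seq q).
        pol A (display q e) = Pos \<or> pol A (display q e') = Neg \<longrightarrow> (e, e') \<in> immediate (deseq q)) \<and>
     (\<forall>e e\<^sub>1 e\<^sub>2. (e, e\<^sub>1) \<in> immediate (seq q) \<and> (e, e\<^sub>2) \<in> immediate (seq q) \<and>
        pol A (display q e) = Neg \<and> pol A (display q e\<^sub>1) = Pos \<and> pol A (display q e\<^sub>2) = Pos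
        \<longrightarrow> e\<^sub>1 = e\<^sub>2) \<and>
     (\<forall>e. maximal_in (events q) (seq q) e \<longrightarrow> pol A (display q e) = Pos) \<and>
     (\<forall>e. minimal_in (events q) (seq q) e \<longrightarrow> pol A (display q e) = Neg)"

definition isomorphisms ::
  "('e, 'a) augmentation \<Rightarrow> ('f, 'a) augmentation \<Rightarrow> ('e \<Rightarrow> 'f) set" where
  "isomorphisms q p = {\<phi> \<in> symmetries q p.
     \<forall>e\<in>events q. \<forall>e'\<in>events q. (e, e') \<in> seq q \<longleftrightarrow> (\<phi> e, \<phi> e') \<in> seq p}"

definition isog_of ::
  "'a arena \<Rightarrow> ('e, 'a) augmentation \<Rightarrow> (nat, 'a) augmentation set" where
  "isog_of A q = {p. augmentation A p \<and> isomorphisms q p \<noteq> {}}"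

definition Isog :: "'a arena \<Rightarrow> (nat, 'a) augmentation set set" where
  "Isog A = {isog_of A q | q :: (nat, 'a) augmentation. augmentation A q}"


section \<open>Composition of augmentations\<close>

definition left_part :: "('e, 'a + 'b) augmentation \<Rightarrow> ('e, 'a) configuration" where
  "left_part q = (let E = {e \<in> events q. isl (display q e)} in
     \<lparr>events = E, deseq = Restr (deseq q) E, display = projl \<circ> display q\<rparr>)"

definition right_part :: "('e, 'a + 'b) augmentation \<Rightarrow> ('e, 'b) configuration" where
  "right_part q = (let E = {e \<in> events q. \<not> isl (display q e)} in
     \<lparr>events = E, deseq = Restr (deseq q) E, display = projr \<circ> display q\<rparr>)"

text \<open>The relation whose transitive closure is the (strict) order of the interaction.\<close>

definition interaction ::
  "'a arena \<Rightarrow> 'b arena \<Rightarrow> 'c arena \<Rightarrow> ('f, 'b + 'c) augmentation \<Rightarrow> ('e \<Rightarrow> 'f) \<Rightarrow>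
   ('e, 'a + 'b) augmentation \<Rightarrow> ('e + 'f) rel" where
  "interaction A B C p \<phi> q =
     {(Inl m, Inl m') | m m'. (m, m') \<in> seq q \<and> m \<noteq> m'} \<union>
     {(Inr m, Inr m') | m m'. (m, m') \<in> seq p \<and> m \<noteq> m'} \<union>
     {(Inl m, Inr (\<phi> m)) | m.
        m \<in> events (right_part q) \<and> pol (A \<turnstile> B) (display q m) = Pos} \<union>
     {(Inr m, Inl (inv_into (events (right_part q)) \<phi> m)) | m.
        m \<in> events (left_part p) \<and> pol (B \<turnstile> C) (display p m) = Pos}"

definition compose_aug ::
  "'a arena \<Rightarrow> 'b arena \<Rightarrow> 'c arena \<Rightarrow> ('f, 'b + 'c) augmentation \<Rightarrow> ('e \<Rightarrow> 'f) \<Rightarrow>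
   ('e, 'a + 'b) augmentation \<Rightarrow> ('e + 'f, 'a + 'c) augmentation" where
  "compose_aug A B C p \<phi> q =
     (let V = events (left_part q) <+> events (right_part p) in
      \<lparr>events = V,
       deseq = sum_rel (deseq (left_part q)) (deseq (right_part p)),
       display = case_sum (\<lambda>m. Inl (projl (display q m))) (\<lambda>m. Inr (projr (display p m))),
       seq = Restr ((interaction A B C p \<phi> q)\<^sup>*) V\<rparr>)"

definition compose_isog ::
  "'a arena \<Rightarrow> 'b arena \<Rightarrow> 'c arena \<Rightarrow> (nat, 'b + 'c) augmentation set \<Rightarrow> (nat \<Rightarrow> nat) \<Rightarrow>
   (nat, 'a + 'b) augmentation set \<Rightarrow> (nat, 'a + 'c) augmentation set" where
  "compose_isog A B C P \<phi> Q =
     isog_of (A \<turnstile> C) (compose_aug A B C (representative P) \<phi> (representative Q))"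


section \<open>Strategies\<close>

type_synonym 'a strategy = "(nat, 'a) augmentation set \<Rightarrow> ennreal"

definition strategies :: "'a arena \<Rightarrow> 'a strategy set" where
  "strategies A = Isog A \<rightarrow>\<^sub>E UNIV"

definition compose_strat ::
  "'a arena \<Rightarrow> 'b arena \<Rightarrow> 'c arena \<Rightarrow>
   ('b + 'c) strategy \<Rightarrow> ('a + 'b) strategy \<Rightarrow> ('a + 'c) strategy" where
  "compose_strat A B C \<tau> \<sigma> = (\<lambda>R\<in>Isog (A \<turnstile> C).
     \<Sum>\<^sub>\<infinity>(Q, P, \<phi>) \<in> {(Q, P, \<phi>). Q \<in> Isog (A \<turnstile> B) \<and> P \<in> Isog (B \<turnstile> C) \<and>
          \<phi> \<in> symmetries (right_part (representative Q)) (left_part (representative P)) \<and>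
          compose_isog A B C P \<phi> Q = R}. \<sigma> Q * \<tau> P)"

definition copycat :: "'a arena \<Rightarrow> ('e, 'a) configuration \<Rightarrow> ('e + 'e, 'a + 'a) augmentation" where
  "copycat A x =
     \<lparr>events = events x <+> events x,
      deseq = sum_rel (deseq x) (deseq x),
      display = map_sum (display x) (display x),
      seq = (sum_rel (deseq x) (deseq x) \<union>
             {(Inl m, Inr n) | m n. (m, n) \<in> deseq x \<and> pol A (display x m) = Pos} \<union>
             {(Inr m, Inl n) | m n. (m, n) \<in> deseq x \<and> pol A (display x m) = Neg})\<^sup>+\<rparr>"

definition copycat_isog ::
  "'a arena \<Rightarrow> (nat, 'a) configuration set \<Rightarrow> (nat, 'a + 'a) augmentation set" where
  "copycat_isog A X = isog_of (A \<turnstile> A) (copycat A (representative X))"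

text \<open>A position is determined by its copycat isogmentation (its right-hand part), so the
  description in the first case denotes.\<close>

definition id_strat :: "'a arena \<Rightarrow> ('a + 'a) strategy" where
  "id_strat A = (\<lambda>Q\<in>Isog (A \<turnstile> A).
     if \<exists>X\<in>Positions A. Q = copycat_isog A X
     then 1 / of_nat (card (Sym (THE X. X \<in> Positions A \<and> Q = copycat_isog A X)))
     else 0)"


section \<open>Categories\<close>

text \<open>\<open>Comp A B C g f\<close> is the composite of \<open>f\<close> from \<open>A\<close> to \<open>B\<close> with \<open>g\<close> from \<open>B\<close> to \<open>C\<close>;
  hom-sets of different pairs of objects need not be disjoint.\<close>

locale category =
  fixes Obj :: "'o set"
    and Hom :: "'o \<Rightarrow> 'o \<Rightarrow> 'm set"
    and Id :: "'o \<Rightarrow> 'm"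
    and Comp :: "'o \<Rightarrow> 'o \<Rightarrow> 'o \<Rightarrow> 'm \<Rightarrow> 'm \<Rightarrow> 'm"
  assumes Id_in_Hom: "A \<in> Obj \<Longrightarrow> Id A \<in> Hom A A"
    and Comp_in_Hom:
      "\<lbrakk>A \<in> Obj; B \<in> Obj; C \<in> Obj; f \<in> Hom A B; g \<in> Hom B C\<rbrakk> \<Longrightarrow> Comp A B C g f \<in> Hom A C"
    and Comp_Id: "\<lbrakk>A \<in> Obj; B \<in> Obj; f \<in> Hom A B\<rbrakk> \<Longrightarrow> Comp A A B f (Id A) = f"
    and Id_Comp: "\<lbrakk>A \<in> Obj; B \<in> Obj; f \<in> Hom A B\<rbrakk> \<Longrightarrow> Comp A B B (Id B) f = f"
    and Comp_assoc:
      "\<lbrakk>A \<in> Obj; B \<in> Obj; C \<in> Obj; D \<in> Obj; f \<in> Hom A B; g \<in> Hom B C; h \<in> Hom C D\<rbrakk>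
       \<Longrightarrow> Comp A C D h (Comp A B C g f) = Comp A B D (Comp B C D h g) f"

end

theory Submission
  imports Defs
begin

text \<open>
  The interaction of \<open>q\<close> and \<open>p\<close> along \<open>\<phi>\<close> has no deadlock: in a causal cycle of minimal weight
  (the sum of the depths of its interface events), the justifier of each target must lie below
  the source of the edge, for otherwise the cycle could be shortened; but then the justifiers form
  a reversed cycle of smaller weight. Moreover every event of the interaction has at most one
  immediate predecessor, and every hidden or negative event exactly one immediate successor.
  Hence hiding the interface leaves an augmentation.

  Composition of augmentations is associative up to isomorphism because both bracketings hide the
  same three-part interaction. Choosing isomorphisms between composites and the representatives of
  their classes turns this into a bijection between the index sets of the two iterated sums.
  Composing with a copycat yields an isomorphic augmentation for every choice of mediating
  symmetry, and the number of choices cancels the weight \<open>1 / card (Sym X)\<close>.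
\<close>

section \<open>Forests\<close>

text \<open>Two obstacles shape the proof. The descent to justifiers would break off at a root of
  the interface. Negativity of the middle arena prevents this: on each side all interface roots have
  one polarity, so causality never orders a received root before a played one. The second obstacle
  is that classes are composed through chosen representatives, so a symmetry out of the
  representative of a composite is not literally a symmetry out of the composite. The chosen
  isomorphism is therefore kept, restricted to the relevant component, and used to adjust the outer
  symmetry. Pre- or postcomposition with it is invertible, so no index is lost or counted twice,
  whichever isomorphism was chosen. Coefficients in \<open>ennreal\<close> make every sum exist and
  allow any rearrangement, also when a strategy takes the value infinity.\<close>

lemma forestD:
  assumes "forest S r"
  shows forest_refl: "a \<in> S \<Longrightarrow> (a, a) \<in> r"
    and forest_subset: "(a, b) \<in> r \<Longrightarrow> a \<in> S \<and> b \<in> S"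
    and forest_trans: "(a, b) \<in> r \<Longrightarrow> (b, c) \<in> r \<Longrightarrow> (a, c) \<in> r"
    and forest_antisym: "(a, b) \<in> r \<Longrightarrow> (b, a) \<in> r \<Longrightarrow> a = b"
    and forest_finite: "finite {b. (b, a) \<in> r}"
    and forest_total: "(b, a) \<in> r \<Longrightarrow> (c, a) \<in> r \<Longrightarrow> (b, c) \<in> r \<or> (c, b) \<in> r"
proof -
  have po: "r \<subseteq> S \<times> S" "refl_on S r" "trans r" "antisym r"
    using assms by (auto simp: forest_def partial_order_on_def preorder_on_def)
  show "a \<in> S \<Longrightarrow> (a, a) \<in> r" using po by (auto simp: refl_on_def)
  show sub: "(a, b) \<in> r \<Longrightarrow> a \<in> S \<and> b \<in> S" for a b using po by auto
  show "(a, b) \<in> r \<Longrightarrow> (b, c) \<in> r \<Longrightarrow> (a, c) \<in> r" using po by (auto dest: transD)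
  show "(a, b) \<in> r \<Longrightarrow> (b, a) \<in> r \<Longrightarrow> a = b" using po by (auto dest: antisymD)
  show "finite {b. (b, a) \<in> r}"
  proof (cases "a \<in> S")
    case True
    then show ?thesis using assms by (auto simp: forest_def)
  next
    case False
    then have "{b. (b, a) \<in> r} = {}" using sub by blast
    then show ?thesis by simp
  qed
  assume ba: "(b, a) \<in> r" and ca: "(c, a) \<in> r"
  then have "a \<in> S" using sub by blast
  then have "total_on {b. (b, a) \<in> r} r" using assms by (auto simp: forest_def)
  then show "(b, c) \<in> r \<or> (c, b) \<in> r"
    using ba ca po sub by (cases "b = c") (auto simp: total_on_def refl_on_def)
qed

lemma forestI:
  assumes "r \<subseteq> S \<times> S" "\<And>a. a \<in> S \<Longrightarrow> (a, a) \<in> r"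
    "\<And>a b c. (a, b) \<in> r \<Longrightarrow> (b, c) \<in> r \<Longrightarrow> (a, c) \<in> r"
    "\<And>a b. (a, b) \<in> r \<Longrightarrow> (b, a) \<in> r \<Longrightarrow> a = b"
    "\<And>a. a \<in> S \<Longrightarrow> finite {b. (b, a) \<in> r}"
    "\<And>a b c. (b, a) \<in> r \<Longrightarrow> (c, a) \<in> r \<Longrightarrow> (b, c) \<in> r \<or> (c, b) \<in> r"
  shows "forest S r"
  unfolding forest_def partial_order_on_def preorder_on_def
proof (intro conjI ballI)
  show "refl_on S r" using assms(2) by (auto simp: refl_on_def)
  show "trans r" using assms(3) by (auto intro: transI)
  show "antisym r" using assms(4) by (auto intro: antisymI)
  show "total_on {b. (b, a) \<in> r} r" for a using assms(6) by (auto simp: total_on_def)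
qed (use assms in auto)

lemma forest_Restr:
  assumes "forest S r" and "V \<subseteq> S"
  shows "forest V (Restr r V)"
proof (rule forestI)
  note F = assms(1)
  show "finite {b. (b, a) \<in> Restr r V}" for a
    by (rule finite_subset[OF _ forest_finite[OF F, of a]]) auto
  show "(a, a) \<in> Restr r V" if "a \<in> V" for a
    using that assms(2) forest_refl[OF F] by auto
  show "(a, c) \<in> Restr r V" if "(a, b) \<in> Restr r V" "(b, c) \<in> Restr r V" for a b c
    using that forest_trans[OF F, of a b c] by simp
  show "a = b" if "(a, b) \<in> Restr r V" "(b, a) \<in> Restr r V" for a b
    using that forest_antisym[OF F, of a b] by simp
  show "(b, c) \<in> Restr r V \<or> (c, b) \<in> Restr r V"
    if "(b, a) \<in> Restr r V" "(c, a) \<in> Restr r V" for a b c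
    using that forest_total[OF F, of b a c] by simp
qed auto

section \<open>Covering pairs in forests\<close>

lemma immediateD: "(a, b) \<in> immediate r \<Longrightarrow> (a, b) \<in> r \<and> a \<noteq> b"
  by (simp add: immediate_def)

lemma immediate_between:
  "(a, b) \<in> immediate r \<Longrightarrow> (a, c) \<in> r \<Longrightarrow> (c, b) \<in> r \<Longrightarrow> c = a \<or> c = b"
  by (auto simp: immediate_def)

lemma immediate_Restr: "(a, b) \<in> immediate r \<Longrightarrow> a \<in> V \<Longrightarrow> b \<in> V \<Longrightarrow> (a, b) \<in> immediate (Restr r V)"
  by (auto simp: immediate_def)

lemma forest_card_below:
  assumes F: "forest S r" and ab: "(a, b) \<in> r" "a \<noteq> b"
  shows "card {y. (y, a) \<in> r} < card {y. (y, b) \<in> r}"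
proof (rule psubset_card_mono[OF forest_finite[OF F]])
  have "b \<in> {y. (y, b) \<in> r}" using ab forest_subset[OF F] forest_refl[OF F] by auto
  moreover have "b \<notin> {y. (y, a) \<in> r}" using ab forest_antisym[OF F] by auto
  moreover have "{y. (y, a) \<in> r} \<subseteq> {y. (y, b) \<in> r}" using ab forest_trans[OF F] by auto
  ultimately show "{y. (y, a) \<in> r} \<subset> {y. (y, b) \<in> r}" by auto
qed

text \<open>The interval from \<open>a\<close> up to but excluding \<open>b\<close> is finite
  because down-sets are, and the size of the down-set grows strictly along the order. A member with
  the largest down-set has nothing between it and \<open>b\<close>.\<close>

lemma forest_immediate_pred:
  assumes F: "forest S r" and ab: "(a, b) \<in> r" "a \<noteq> b"
  obtains c where "(c, b) \<in> immediate r" "(a, c) \<in> r"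
proof -
  define I where "I = {c. (a, c) \<in> r \<and> (c, b) \<in> r \<and> c \<noteq> b}"
  have "finite I" unfolding I_def
    by (rule finite_subset[OF _ forest_finite[OF F, of b]]) auto
  moreover have "a \<in> I" using ab forest_subset[OF F] forest_refl[OF F] by (auto simp: I_def)
  ultimately obtain c where c: "c \<in> I" "\<And>d. d \<in> I \<Longrightarrow> (c, d) \<in> r \<Longrightarrow> d = c"
  proof -
    let ?d = "\<lambda>x. card {y. (y, x) \<in> r}"
    have "Max (?d ` I) \<in> ?d ` I" using \<open>finite I\<close> \<open>a \<in> I\<close> by (intro Max_in) auto
    then obtain c where "c \<in> I" "?d c = Max (?d ` I)" by auto
    then have c: "c \<in> I" "\<And>d. d \<in> I \<Longrightarrow> ?d d \<le> ?d c" using \<open>finite I\<close> by simp_all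
    have "d = c" if d: "d \<in> I" "(c, d) \<in> r" for d
    proof (rule ccontr)
      assume "d \<noteq> c"
      have "?d c < ?d d" using forest_card_below[OF F d(2)] \<open>d \<noteq> c\<close> by simp
      then show False using c(2)[OF d(1)] by simp
    qed
    with c(1) show ?thesis by (rule that)
  qed
  have "(c, b) \<in> immediate r"
    unfolding immediate_def using c by (auto simp: I_def dest: forest_trans[OF F])
  then show ?thesis using c(1) that by (auto simp: I_def)
qed

text \<open>Descending from \<open>b\<close> through covers stays above \<open>a\<close> and shrinks
  a finite down-set, so it ends at \<open>a\<close>. Properties of covering pairs thereby extend to
  the whole order.\<close>

lemma forest_immediate_rtrancl:
  assumes F: "forest S r" and "(a, b) \<in> r"
  shows "(a, b) \<in> (immediate r)\<^sup>*"
  using assms(2)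
proof (induction "card {y. (y, b) \<in> r}" arbitrary: b rule: less_induct)
  case less
  show ?case
  proof (cases "a = b")
    case False
    then obtain c where c: "(c, b) \<in> immediate r" "(a, c) \<in> r"
      using forest_immediate_pred[OF F less.prems] by blast
    have cb: "(c, b) \<in> r" "c \<noteq> b" using immediateD[OF c(1)] by auto
    have "card {y. (y, c) \<in> r} < card {y. (y, b) \<in> r}" using forest_card_below[OF F] cb by blast
    from less.hyps[OF this c(2)] c(1) show ?thesis by (rule rtrancl_into_rtrancl)
  qed simp
qed

text \<open>The first step of a chain of covers from \<open>a\<close> to \<open>b\<close> does; such
  a chain is built downwards from \<open>b\<close>, where everything is finite.\<close>

lemma forest_immediate_succ:
  assumes F: "forest S r" and "(a, b) \<in> r" "a \<noteq> b"
  obtains c where "(a, c) \<in> immediate r" "(c, b) \<in> r"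
proof -
  have sub: "(immediate r)\<^sup>* \<subseteq> Id \<union> r"
  proof clarsimp
    fix x y assume "(x, y) \<in> (immediate r)\<^sup>*" "(x, y) \<notin> r"
    then show "x = y"
      by induction (use forest_trans[OF F] immediateD in \<open>metis\<close>)+
  qed
  from forest_immediate_rtrancl[OF F assms(2)] assms(3) obtain c
    where c: "(a, c) \<in> immediate r" "(c, b) \<in> (immediate r)\<^sup>*" by (auto elim: converse_rtranclE)
  then have "c = b \<or> (c, b) \<in> r" using sub by auto
  then have "(c, b) \<in> r" using forest_refl[OF F] forest_subset[OF F assms(2)] by auto
  with c(1) show ?thesis by (rule that)
qed

lemma forest_immediate_unique:
  assumes F: "forest S r" and "(a, b) \<in> immediate r" "(a', b) \<in> immediate r"
  shows "a = a'"
proof -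
  have r: "(a, b) \<in> r" "(a', b) \<in> r" "a \<noteq> b" "a' \<noteq> b" using assms by (auto dest: immediateD)
  from forest_total[OF F r(1,2)] show ?thesis
    using immediate_between[OF assms(2)] immediate_between[OF assms(3)] r by metis
qed

lemma not_minimal_inE:
  assumes "forest S r" "b \<in> S" "\<not> minimal_in S r b"
  obtains a where "(a, b) \<in> immediate r"
proof -
  obtain a where "(a, b) \<in> r" "a \<noteq> b" using assms by (auto simp: minimal_in_def)
  then show ?thesis using forest_immediate_pred[OF assms(1)] that by blast
qed

lemma not_maximal_inE:
  assumes "forest S r" "b \<in> S" "\<not> maximal_in S r b"
  obtains a where "(b, a) \<in> immediate r"
proof -
  obtain a where "(b, a) \<in> r" "a \<noteq> b" using assms by (auto simp: maximal_in_def)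
  then show ?thesis using forest_immediate_succ[OF assms(1), of b a] that by blast
qed

text \<open>The conditions on an augmentation that mention only its two orders and the polarities,
  with the polarity as a parameter. Arena and display are dropped so that the disjoint union of two
  augmentations, and what remains after hiding, can be treated by the same lemmas.\<close>

definition causal :: "'e set \<Rightarrow> 'e rel \<Rightarrow> 'e rel \<Rightarrow> ('e \<Rightarrow> polarity) \<Rightarrow> bool" where
  "causal S r s P \<longleftrightarrow> forest S r \<and> s \<subseteq> r \<and>
     (\<forall>a b. (a, b) \<in> immediate r \<and> (P a = Pos \<or> P b = Neg) \<longrightarrow> (a, b) \<in> immediate s) \<and>
     (\<forall>a b c. (a, b) \<in> immediate r \<and> (a, c) \<in> immediate r \<and> P a = Neg \<and> P b = Pos \<and> P c = Pos
        \<longrightarrow> b = c) \<and>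
     (\<forall>a. maximal_in S r a \<longrightarrow> P a = Pos) \<and>
     (\<forall>a. minimal_in S r a \<longrightarrow> P a = Neg)"

lemma causalD:
  assumes "causal S r s P"
  shows causal_forest: "forest S r"
    and causal_static: "(a, b) \<in> s \<Longrightarrow> (a, b) \<in> r"
    and causal_immediate:
      "(a, b) \<in> immediate r \<Longrightarrow> P a = Pos \<or> P b = Neg \<Longrightarrow> (a, b) \<in> immediate s"
    and causal_unique: "(a, b) \<in> immediate r \<Longrightarrow> (a, c) \<in> immediate r \<Longrightarrow>
      P a = Neg \<Longrightarrow> P b = Pos \<Longrightarrow> P c = Pos \<Longrightarrow> b = c"
    and causal_maximal: "maximal_in S r a \<Longrightarrow> P a = Pos"
    and causal_minimal: "minimal_in S r a \<Longrightarrow> P a = Neg"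
proof -
  note 1 = assms[unfolded causal_def]
  show "forest S r" using 1 by (elim conjE)
  show "(a, b) \<in> s \<Longrightarrow> (a, b) \<in> r" using 1 by (elim conjE) (erule subsetD)
  show "(a, b) \<in> immediate r \<Longrightarrow> P a = Pos \<or> P b = Neg \<Longrightarrow> (a, b) \<in> immediate s"
    using 1[THEN conjunct2, THEN conjunct2, THEN conjunct1] by simp
  show "(a, b) \<in> immediate r \<Longrightarrow> (a, c) \<in> immediate r \<Longrightarrow>
      P a = Neg \<Longrightarrow> P b = Pos \<Longrightarrow> P c = Pos \<Longrightarrow> b = c"
    using 1[THEN conjunct2, THEN conjunct2, THEN conjunct2, THEN conjunct1] by simp
  show "maximal_in S r a \<Longrightarrow> P a = Pos" "minimal_in S r a \<Longrightarrow> P a = Neg"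
    using 1[THEN conjunct2, THEN conjunct2, THEN conjunct2, THEN conjunct2] by simp_all
qed

lemma augmentation_iff:
  "augmentation A q \<longleftrightarrow>
     configuration A q \<and> causal (events q) (seq q) (deseq q) (\<lambda>e. pol A (display q e))"
  unfolding augmentation_def causal_def by auto

lemma not_Pos [simp]: "p \<noteq> Pos \<longleftrightarrow> p = Neg" "Pos \<noteq> p \<longleftrightarrow> p = Neg"
  and not_Neg [simp]: "p \<noteq> Neg \<longleftrightarrow> p = Pos" "Neg \<noteq> p \<longleftrightarrow> p = Pos"
  by (cases p; simp)+

section \<open>Interactions do not deadlock\<close>

text \<open>\<open>U\<close> stands for the disjoint union of the events of both augmentations,
  \<open>r\<close> and \<open>s\<close> for their causal and static (desequentialization) orders,
  \<open>H\<close> for the interface, and the involution \<open>\<theta>\<close> exchanges the two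
  copies of an interface event. With one set and one involution, every argument treats both
  augmentations at once. Assumption \<open>roots\<close> is the trace left by negativity of the
  middle arena.\<close>

locale interaction_net =
  fixes U :: "'e set" and r s :: "'e rel" and P :: "'e \<Rightarrow> polarity"
    and H :: "'e set" and \<theta> :: "'e \<Rightarrow> 'e"
  assumes fin: "finite U"
    and causal: "causal U r s P"
    and static_forest: "forest U s"
    and alternating: "(a, b) \<in> immediate s \<Longrightarrow> P a \<noteq> P b"
    and hidden_subset: "H \<subseteq> U"
    and hidden_closed: "(a, b) \<in> s \<Longrightarrow> a \<in> H \<longleftrightarrow> b \<in> H"
    and link_hidden: "a \<in> H \<Longrightarrow> \<theta> a \<in> H"
    and link_link: "a \<in> H \<Longrightarrow> \<theta> (\<theta> a) = a"
    and link_polarity: "a \<in> H \<Longrightarrow> P (\<theta> a) \<noteq> P a"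
    and link_static: "a \<in> H \<Longrightarrow> b \<in> H \<Longrightarrow> (a, b) \<in> s \<Longrightarrow> (\<theta> a, \<theta> b) \<in> s"
    and roots: "a \<in> H \<Longrightarrow> b \<in> H \<Longrightarrow> minimal_in U s a \<Longrightarrow> minimal_in U s b \<Longrightarrow> (a, b) \<in> r \<Longrightarrow>
      P a = P b"
begin

lemmas forest = causal_forest[OF causal]
lemmas static = causal_static[OF causal]
lemmas immediate_static = causal_immediate[OF causal]
lemmas immediate_unique = causal_unique[OF causal]
lemmas r_refl = forest_refl[OF forest]
lemmas r_subset = forest_subset[OF forest]
lemmas r_trans = forest_trans[OF forest]
lemmas r_antisym = forest_antisym[OF forest]
lemmas r_total = forest_total[OF forest]

text \<open>A cover with negative upper event is static, so the causal predecessor of a negative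
  event is its justifier, positive by alternation. In a forest everything strictly below
  \<open>b\<close> lies below this predecessor.\<close>

lemma negative_pred:
  assumes "P b = Neg" "(a, b) \<in> r" "a \<noteq> b"
  obtains j where "(j, b) \<in> immediate s" "(a, j) \<in> r" "P j = Pos"
proof -
  obtain j where j: "(j, b) \<in> immediate r" "(a, j) \<in> r"
    using forest_immediate_pred[OF forest assms(2,3)] by blast
  have js: "(j, b) \<in> immediate s" using immediate_static[OF j(1)] assms(1) by simp
  show ?thesis using that[OF js j(2)] alternating[OF js] assms(1) by simp
qed

lemma link_immediate:
  assumes "(a, b) \<in> immediate s" "a \<in> H"
  shows "(\<theta> a, \<theta> b) \<in> immediate s"
proof -
  have ab: "(a, b) \<in> s" "a \<noteq> b" using immediateD[OF assms(1)] by auto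
  have b: "b \<in> H" using hidden_closed[OF ab(1)] assms(2) by simp
  have "(\<theta> a, \<theta> b) \<in> s" using link_static[OF assms(2) b ab(1)] .
  moreover have "\<theta> a \<noteq> \<theta> b" using link_link[OF b] link_link[OF assms(2)] ab(2) by metis
  moreover have "c = \<theta> a \<or> c = \<theta> b" if c: "(\<theta> a, c) \<in> s" "(c, \<theta> b) \<in> s" for c
  proof -
    have cH: "c \<in> H" using hidden_closed[OF c(2)] link_hidden[OF b] by simp
    have "(a, \<theta> c) \<in> s" "(\<theta> c, b) \<in> s"
      using link_static[OF link_hidden[OF assms(2)] cH c(1)] link_static[OF cH link_hidden[OF b] c(2)]
        link_link[OF assms(2)] link_link[OF b] by simp_all
    then have "\<theta> c = a \<or> \<theta> c = b" using immediate_between[OF assms(1)] by blast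
    then show ?thesis using link_link[OF cH] by auto
  qed
  ultimately show ?thesis unfolding immediate_def by blast
qed

text \<open>A hidden event is played by one side and received by the other. Cycles are tracked through
  the copies of their hidden events on the receiving side, which are the negative ones.\<close>

definition R :: "'e rel" where
  "R = {(a, c). a \<in> H \<and> c \<in> H \<and> P a = Neg \<and> P c = Neg \<and> (a, \<theta> c) \<in> r}"

section \<open>Depth in the static forest and weighted paths\<close>

definition wt :: "'e \<Rightarrow> nat" where
  "wt a = card {b. (b, a) \<in> s}"

lemma wt_pos: "a \<in> U \<Longrightarrow> 0 < wt a"
  unfolding wt_def using forest_refl[OF static_forest] forest_finite[OF static_forest]
  by (auto simp: card_gt_0_iff)

lemma wt_mono: "(a, b) \<in> s \<Longrightarrow> a \<noteq> b \<Longrightarrow> wt a < wt b"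
  unfolding wt_def by (rule forest_card_below[OF static_forest])

text \<open>An edge contributes the depths of both its endpoints, so weight is symmetric under
  reversal and a closed path counts each vertex twice. Carrying the weight as an argument turns the
  choice of a lightest cycle into a statement about natural numbers.\<close>

inductive path :: "nat \<Rightarrow> 'e \<Rightarrow> 'e \<Rightarrow> bool" where
  path_refl: "path 0 a a"
| path_step: "path m a b \<Longrightarrow> (b, c) \<in> R \<Longrightarrow> path (m + wt b + wt c) a c"

lemma path_trans: "path n b c \<Longrightarrow> path m a b \<Longrightarrow> path (m + n) a c"
proof (induction arbitrary: m rule: path.induct)
  case (path_step n b c d)
  from path.path_step[OF path_step.IH[OF path_step.prems] path_step.hyps(2)]
  show ?case by (simp add: add_ac)
qed simp

lemma path_edge: "(a, b) \<in> R \<Longrightarrow> path (wt a + wt b) a b"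
  using path_step[OF path_refl] by simp

text \<open>Paths grow at their end; splitting off the first edge shows which vertex of a cycle
  follows a given one.\<close>

lemma path_consE:
  assumes "path m a c"
  obtains "m = 0" "a = c" | b n where "(a, b) \<in> R" "path n b c" "m = n + wt a + wt b"
  using assms
proof (induction arbitrary: thesis rule: path.induct)
  case (path_refl a)
  then show ?case by blast
next
  case (path_step m a b c)
  show ?case
  proof (rule path_step.IH)
    assume "m = 0" "a = b"
    then show thesis using path_step.hyps(2) path_refl[of c] path_step.prems(2)[of c 0] by simp
  next
    fix b' n assume "(a, b') \<in> R" "path n b' b" "m = n + wt a + wt b'"
    then show thesis
      using path_step.prems(2)[of b' "n + wt b + wt c"] path.path_step[OF _ path_step.hyps(2)]
      by (simp add: add_ac)
  qed
qed

text \<open>The static predecessor of a negative event is positive, and \<open>\<theta>\<close>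
  takes it to its negative copy, so \<open>w\<close> leads from vertices of \<open>R\<close> to
  vertices of \<open>R\<close>. Its values are the vertices of the reversed, lighter cycle.\<close>

definition w :: "'e \<Rightarrow> 'e" where
  "w a = \<theta> (THE j. (j, a) \<in> immediate s)"

lemma w_eq: "(j, a) \<in> immediate s \<Longrightarrow> w a = \<theta> j"
  unfolding w_def using forest_immediate_unique[OF static_forest]
  by (intro arg_cong[of _ _ \<theta>] the_equality)

lemma R_hidden: "(a, c) \<in> R \<Longrightarrow> a \<in> H \<and> c \<in> H \<and> P a = Neg \<and> P c = Neg \<and> P (\<theta> c) = Pos"
  using link_polarity[of c] by (auto simp: R_def)

section \<open>Cycles of least weight; weight 0 is excepted because of the empty path\<close>

context
  fixes n :: nat
  assumes minimal: "\<And>m a. path m a a \<Longrightarrow> m = 0 \<or> n \<le> m"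
begin

text \<open>Both \<open>a\<close> and \<open>j\<close> lie below \<open>\<theta> c\<close>, hence
  they are comparable. Equality would put \<open>\<theta> a\<close> below \<open>c\<close>, and the
  vertex before \<open>a\<close> could jump to the vertex after \<open>c\<close>. If
  \<open>a\<close> were strictly below \<open>j\<close>, then the justifier \<open>k\<close> of
  \<open>j\<close> would still be above \<open>a\<close>, and \<open>\<theta> k\<close> could
  replace \<open>c\<close> as a vertex of smaller depth. Cycles with one or two vertices need
  separate checks.\<close>

lemma minimal_cycle_edge:
  assumes R: "(a, c) \<in> R" and ret: "path m c a" and n: "m + wt a + wt c = n"
    and jc: "(j, \<theta> c) \<in> immediate s"
  shows "(j, a) \<in> r" "j \<noteq> a"
proof -
  have H: "a \<in> H" "c \<in> H" "P a = Neg" "P c = Neg" "P (\<theta> c) = Pos" "(a, \<theta> c) \<in> r"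
    using R R_hidden[OF R] by (auto simp: R_def)
  have j: "(j, \<theta> c) \<in> s" "j \<noteq> \<theta> c" using immediateD[OF jc] by auto
  have jH: "j \<in> H" using hidden_closed[OF j(1)] link_hidden[OF H(2)] by simp
  have jP: "P j = Neg" using alternating[OF jc] H(5) by simp
  have \<theta>j: "(\<theta> j, c) \<in> immediate s" using link_immediate[OF jc jH] link_link[OF H(2)] by simp
  have \<theta>jr: "(\<theta> j, c) \<in> r" "\<theta> j \<noteq> c" using immediateD[OF \<theta>j] static[of "\<theta> j" c] by auto
  have wt: "0 < wt a" "0 < wt c" using wt_pos H hidden_subset by blast+
  show ne: "j \<noteq> a"
  proof
    assume ja: "j = a"
    from ret show False
    proof (cases rule: path_consE)
      case 1
      then show False using r_antisym[of "\<theta> a" a] \<theta>jr ja H(6) by simp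
    next
      case (2 d k)
      have d: "(c, \<theta> d) \<in> r" "d \<in> H" using 2 by (auto simp: R_def)
      from 2(2) show False
      proof (cases rule: path.cases)
        case path_refl
        then show False using r_antisym[of c "\<theta> a"] d(1) \<theta>jr ja by simp
      next
        case (path_step l z)
        \<comment> \<open>The shortcut: in \<open>r\<close>, the events \<open>z\<close>,
          \<open>\<theta> a\<close>, \<open>c\<close>, \<open>\<theta> d\<close> form an ascending
          chain, so \<open>a\<close> and \<open>c\<close> drop out of the cycle.\<close>
        have "(z, d) \<in> R"
          using path_step(3) 2(1) r_trans[OF r_trans[of z "\<theta> a" c] d(1)] \<theta>jr(1) ja
          by (simp add: R_def)
        from path_edge[OF this] path_step(2) have "path (l + (wt z + wt d)) d d"
          using path_trans by blast
        moreover have "0 < wt d" using wt_pos d hidden_subset by blast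
        ultimately have "n \<le> l + (wt z + wt d)" using minimal by fastforce
        then show False using n 2 path_step wt by simp
      qed
    qed
  qed
  have "\<not> (a, j) \<in> r"
  proof
    assume "(a, j) \<in> r"
    then obtain k where k: "(k, j) \<in> immediate s" "(a, k) \<in> r" "P k = Pos"
      using negative_pred[of j a] jP ne by blast
    have kj: "(k, j) \<in> s" using immediateD[OF k(1)] by simp
    have kH: "k \<in> H" using hidden_closed[OF kj] jH by simp
    have \<theta>k: "(\<theta> k, \<theta> j) \<in> s" "\<theta> k \<noteq> \<theta> j" "\<theta> k \<in> H" "P (\<theta> k) = Neg"
      using immediateD[OF link_immediate[OF k(1) kH]] link_hidden[OF kH] link_polarity[OF kH] k(3)
      by simp_all
    have lt: "wt (\<theta> k) < wt c"
      using wt_mono[OF \<theta>k(1,2)] wt_mono[of "\<theta> j" c] immediateD[OF \<theta>j] by simp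
    have \<theta>kc: "(\<theta> k, c) \<in> r" by (rule r_trans[OF static[OF \<theta>k(1)] \<theta>jr(1)])
    \<comment> \<open>The substitute for \<open>c\<close>: \<open>\<theta> k\<close> lies two
      covering steps below \<open>c\<close> in the static order, and \<open>a\<close> lies below its
      played copy \<open>k\<close>.\<close>
    have aR: "(a, \<theta> k) \<in> R" using H(1,3) k(2) \<theta>k(3,4) link_link[OF kH] by (simp add: R_def)
    from ret show False
    proof (cases rule: path_consE)
      case 1
      then have "(\<theta> k, \<theta> k) \<in> R"
        using \<theta>k(3,4) link_link[OF kH] r_trans[OF \<theta>kc, of k] k(2) by (simp add: R_def)
      from path_edge[OF this] have "n \<le> wt (\<theta> k) + wt (\<theta> k)"
        using minimal wt_pos[of "\<theta> k"] \<theta>k(3) hidden_subset by fastforce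
      then show False using n 1 lt by simp
    next
      case (2 d l)
      have "(\<theta> k, d) \<in> R"
        using 2(1) \<theta>k(3,4) r_trans[OF \<theta>kc, of "\<theta> d"] by (simp add: R_def)
      from path_trans[OF 2(2) path_trans[OF path_edge[OF this] path_edge[OF aR]]]
      have "n \<le> wt a + wt (\<theta> k) + (wt (\<theta> k) + wt d) + l" using minimal wt by fastforce
      then show False using n 2 lt by simp
    qed
  qed
  then show "(j, a) \<in> r" using r_total[OF H(6) static[OF j(1)]] by blast
qed

text \<open>Were \<open>c\<close> a root, the next edge of the cycle would lead to some
  \<open>d\<close> with \<open>c\<close> below the positive event \<open>\<theta> d\<close>. By
  \<open>roots\<close> the latter is not a root, and \<open>minimal_cycle_edge\<close> puts its
  justifier strictly below \<open>c\<close>. But a negative event with anything strictly below it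
  has a justifier.\<close>

lemma minimal_cycle_nonroot:
  assumes R: "(a, c) \<in> R" and ret: "path m c a" and n: "m + wt a + wt c = n"
  shows "\<not> minimal_in U s c"
proof
  assume c: "minimal_in U s c"
  have H: "a \<in> H" "c \<in> H" "P a = Neg" "P c = Neg" "(a, \<theta> c) \<in> r"
    using R R_hidden[OF R] by (auto simp: R_def)
  obtain d k where d: "(c, d) \<in> R" and ret': "path k d c" and n': "k + wt c + wt d = n"
    using ret
  proof (cases rule: path_consE)
    case 1
    then show ?thesis using that[OF _ path_refl] R n by auto
  next
    case (2 b l)
    show ?thesis using that[OF 2(1) path_trans[OF path_edge[OF R] 2(2)]] n 2 by simp
  qed
  have dH: "d \<in> H" "\<theta> d \<in> H" "P (\<theta> d) = Pos" "(c, \<theta> d) \<in> r"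
    using d R_hidden[OF d] link_hidden[of d] by (auto simp: R_def)
  have "\<not> minimal_in U s (\<theta> d)"
    using roots[OF H(2) dH(2)] c dH H by auto
  then obtain j where j: "(j, \<theta> d) \<in> immediate s"
    using not_minimal_inE[OF static_forest] dH hidden_subset by blast
  have "(j, c) \<in> r" "j \<noteq> c" using minimal_cycle_edge[OF d ret' n' j] by auto
  then obtain i where "(i, c) \<in> immediate s" using negative_pred[OF H(4)] by blast
  then show False
    using c forest_subset[OF static_forest] by (auto simp: minimal_in_def dest: immediateD)
qed

text \<open>Let \<open>j\<close> be the justifier of \<open>\<theta> c\<close> and \<open>k\<close>
  that of \<open>a\<close>. By \<open>minimal_cycle_edge\<close>, \<open>j\<close> is strictly below
  \<open>a\<close>, hence below \<open>k\<close>. Since \<open>w c = j\<close> and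
  \<open>\<theta> (w a) = k\<close>, this is an edge of \<open>R\<close> in the opposite direction.
  Justifiers have smaller depth, and \<open>\<theta>\<close> does not raise depth.\<close>

lemma minimal_cycle_reverse:
  assumes R: "(a, c) \<in> R" and ret: "path m c a" and n: "m + wt a + wt c = n"
  shows "(w c, w a) \<in> R" "wt (w c) < wt c" "wt (w a) < wt a"
proof -
  have H: "a \<in> H" "c \<in> H" "P a = Neg" "P c = Neg" "(a, \<theta> c) \<in> r"
    using R R_hidden[OF R] by (auto simp: R_def)
  have "\<not> minimal_in U s c" by (rule minimal_cycle_nonroot[OF R ret n])
  then obtain i where i: "(i, c) \<in> immediate s"
    using not_minimal_inE[OF static_forest] H hidden_subset by blast
  have iH: "i \<in> H" using hidden_closed[of i c] H(2) immediateD[OF i] by simp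
  define j where "j = \<theta> i"
  have j: "(j, \<theta> c) \<in> immediate s" "w c = j" "j \<in> H" "(j, \<theta> c) \<in> s"
    using link_immediate[OF i iH] w_eq[OF i] link_hidden[OF iH] immediateD[of j "\<theta> c"]
    by (auto simp: j_def)
  have "(j, a) \<in> r" "j \<noteq> a" using minimal_cycle_edge[OF R ret n j(1)] by auto
  then obtain k where k: "(k, a) \<in> immediate s" "(j, k) \<in> r" "P k = Pos"
    using negative_pred[of a j] H by blast
  have kH: "k \<in> H" using hidden_closed[of k a] H(1) immediateD[OF k(1)] by simp
  have wa: "w a = \<theta> k" by (rule w_eq[OF k(1)])
  have iP: "P i = Pos" "P j = Neg"
    using alternating[OF i] H link_polarity[OF iH] by (auto simp: j_def)
  show "(w c, w a) \<in> R"
    using wa j(2,3) iP k(2,3) link_link[OF kH] link_hidden[OF kH] link_polarity[OF kH]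
    by (simp add: R_def)
  have wt_link: "wt (\<theta> x) \<le> wt x" if x: "x \<in> H" for x
  proof -
    have "b \<in> \<theta> ` {b. (b, x) \<in> s}" if b: "(b, \<theta> x) \<in> s" for b
    proof
      have bH: "b \<in> H" using hidden_closed[OF b] link_hidden[OF x] by simp
      then show "b = \<theta> (\<theta> b)" by (simp add: link_link)
      show "\<theta> b \<in> {b. (b, x) \<in> s}"
        using link_static[OF bH link_hidden[OF x] b] link_link[OF x] by simp
    qed
    then show ?thesis unfolding wt_def
      by (intro surj_card_le[OF forest_finite[OF static_forest]]) blast
  qed
  show "wt (w c) < wt c"
    using wt_link[OF iH] wt_mono[of i c] immediateD[OF i] j(2) by (simp add: j_def)
  show "wt (w a) < wt a"
    using wt_link[OF kH] wt_mono[of k a] immediateD[OF k(1)] wa by simp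
qed

text \<open>Every edge of a lightest cycle turns around under \<open>w\<close>; the reversed cycle
  is strictly lighter and still of positive weight, against minimality.\<close>

lemma no_minimal_cycle: "path n a a \<Longrightarrow> n = 0"
proof (rule ccontr)
  assume a: "path n a a" and "n \<noteq> 0"
  \<comment> \<open>The return path of weight \<open>m\<close> certifies that the partial path lies
    on a cycle of weight \<open>n\<close>, as the edge lemmas require. Positivity is carried along
    because minimality says nothing about weight 0.\<close>
  have "\<exists>l. l \<le> k \<and> (0 < k \<longrightarrow> 0 < l \<and> l < k) \<and> path l (w y) (w x)"
    if "path k x y" "path m y x" "k + m = n" for k m x y
    using that
  proof (induction arbitrary: m rule: path.induct)
    case (path_refl x)
    then show ?case using path.path_refl by blast
  next
    case (path_step k x y z)
    obtain l where l: "l \<le> k" "path l (w y) (w x)"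
      using path_step.IH[OF path_trans[OF path_step.prems(1) path_edge[OF path_step.hyps(2)]]]
        path_step.prems by auto
    have "path (m + k) z y" using path_trans[OF path_step.hyps(1) path_step.prems(1)] .
    then have e: "(w z, w y) \<in> R" "wt (w z) < wt z" "wt (w y) < wt y"
      using minimal_cycle_reverse[OF path_step.hyps(2), of "m + k"] path_step.prems by auto
    have "0 < wt (w z)" using wt_pos[of "w z"] R_hidden[OF e(1)] hidden_subset by blast
    with path_trans[OF l(2) path_edge[OF e(1)]] e l show ?case
      by (intro exI[of _ "wt (w z) + wt (w y) + l"]) auto
  qed
  from this[OF a path_refl] obtain l where "0 < l" "l < n" "path l (w a) (w a)"
    using \<open>n \<noteq> 0\<close> by auto
  then show False using minimal by fastforce
qed

end

lemma R_acyclic: "(a, a) \<notin> R\<^sup>+"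
proof
  assume "(a, a) \<in> R\<^sup>+"
  have "\<exists>m>0. path m a b" if "(a, b) \<in> R\<^sup>+" for b
    using that
  proof induction
    case (base b)
    moreover have "0 < wt a" using R_hidden[OF base] wt_pos[of a] hidden_subset by blast
    ultimately show ?case using path_edge[OF base] by (intro exI[of _ "wt a + wt b"]) simp
  next
    case (step b c)
    then obtain m where "0 < m" "path m a b" by blast
    then show ?case using path_step[OF _ step.hyps(2)] by (intro exI[of _ "m + wt b + wt c"]) simp
  qed
  with \<open>(a, a) \<in> R\<^sup>+\<close> have ex: "\<exists>m. 0 < m \<and> (\<exists>a. path m a a)" by blast
  define n where "n = (LEAST m. 0 < m \<and> (\<exists>a. path m a a))"
  have "0 < n \<and> (\<exists>a. path n a a)" unfolding n_def by (rule LeastI_ex[OF ex])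
  moreover have "m = 0 \<or> n \<le> m" if "path m b b" for m b
    unfolding n_def using that by (cases "m = 0") (auto intro!: Least_le)
  ultimately show False using no_minimal_cycle[of n] by blast
qed

section \<open>The order generated by causality and transmission\<close>

definition I :: "'e rel" where
  "I = {(a, b) \<in> r. a \<noteq> b} \<union> {(a, \<theta> a) | a. a \<in> H \<and> P a = Pos}"

lemma I_subset: "I \<subseteq> U \<times> U"
proof (rule subrelI)
  fix a b assume "(a, b) \<in> I"
  then have "(a, b) \<in> r \<or> a \<in> H \<and> b = \<theta> a" by (auto simp: I_def)
  then show "(a, b) \<in> U \<times> U" using r_subset[of a b] hidden_subset link_hidden[of a] by auto
qed

text \<open>A walk from \<open>u\<close> that never crosses the interface is strict in
  \<open>r\<close> and cannot return. Otherwise let \<open>h\<close> be the event at which it first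
  crosses and \<open>g\<close> the one at which it last arrives: the part from
  \<open>\<theta> h\<close> to \<open>g\<close> is a path in \<open>R\<close>. If the walk is
  closed, \<open>g\<close> lies below \<open>u\<close> and \<open>u\<close> below \<open>h\<close>,
  which is an edge of \<open>R\<close> from \<open>g\<close> back to
  \<open>\<theta> h\<close>.\<close>

lemma I_acyclic: "(u, u) \<notin> I\<^sup>+"
proof
  assume cycle: "(u, u) \<in> I\<^sup>+"
  let ?Q = "\<lambda>h g x. h \<in> H \<and> P h = Pos \<and> (u, h) \<in> r \<and> (\<theta> h, g) \<in> R\<^sup>* \<and> (g, x) \<in> r \<and> g \<in> H \<and> P g = Neg"
  have link: "y \<in> H \<and> P y = Neg \<and> (y, y) \<in> r" if "x \<in> H" "P x = Pos" "y = \<theta> x" for x y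
    using that r_refl hidden_subset link_hidden[OF that(1)] link_polarity[OF that(1)] by auto
  have "(u, x) \<in> r \<and> u \<noteq> x \<or> (\<exists>h g. ?Q h g x)" if "(u, x) \<in> I\<^sup>+" for x
    using that
  proof induction
    case (base x)
    show ?case
    proof (cases "(u, x) \<in> r \<and> u \<noteq> x")
      case False
      then have u: "u \<in> H" "P u = Pos" "x = \<theta> u" using base by (auto simp: I_def)
      then have "?Q u x x" using link[OF u] r_refl hidden_subset by auto
      then show ?thesis by blast
    qed simp
  next
    case (step x y)
    have xy: "(x, y) \<in> r \<and> x \<noteq> y \<or> x \<in> H \<and> P x = Pos \<and> y = \<theta> x"
      using step.hyps(2) by (auto simp: I_def)
    from step.IH show ?case
    proof (elim disjE exE)
      assume ux: "(u, x) \<in> r \<and> u \<noteq> x"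
      show ?thesis
      proof (cases "(x, y) \<in> r \<and> x \<noteq> y")
        case True
        then show ?thesis using ux r_trans[of u x y] r_antisym[of u x] by auto
      next
        case False
        then have "x \<in> H \<and> P x = Pos \<and> y = \<theta> x" using xy by blast
        then have "?Q x y y" using ux link[of x y] by simp
        then show ?thesis by blast
      qed
    next
      fix h g assume g: "?Q h g x"
      show ?thesis
      proof (cases "(x, y) \<in> r \<and> x \<noteq> y")
        case True
        then have "?Q h g y" using g r_trans[of g x y] by simp
        then show ?thesis by blast
      next
        case False
        then have y: "x \<in> H" "y = \<theta> x" "y \<in> H \<and> P y = Neg \<and> (y, y) \<in> r" using xy link[of x y] by auto
        then have "(g, y) \<in> R" using g link_link[of x] by (simp add: R_def)
        then have "(\<theta> h, y) \<in> R\<^sup>*" using g by (meson rtrancl_into_rtrancl)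
        then have "?Q h y y" using g y by simp
        then show ?thesis by blast
      qed
    qed
  qed
  from this[OF cycle] obtain h g where "?Q h g u" by blast
  then have g: "h \<in> H" "P h = Pos" "(u, h) \<in> r" "(\<theta> h, g) \<in> R\<^sup>*" "(g, u) \<in> r" "g \<in> H" "P g = Neg"
    by simp_all
  have "(g, \<theta> h) \<in> R"
    using g r_trans[OF g(5,3)] link_link[OF g(1)] link[OF g(1,2)] by (simp add: R_def)
  then show False using R_acyclic[of "\<theta> h"] rtrancl_into_trancl1[OF g(4)] by blast
qed

text \<open>The immediate predecessors in the order generated by \<open>I\<close>.\<close>

definition J :: "'e rel" where
  "J = {(a, b). if b \<in> H \<and> P b = Neg then a = \<theta> b else (a, b) \<in> immediate r}"

lemma J_link: "b \<in> H \<Longrightarrow> P b = Neg \<Longrightarrow> (a, b) \<in> J \<longleftrightarrow> a = \<theta> b"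
  and J_immediate: "\<not> (b \<in> H \<and> P b = Neg) \<Longrightarrow> (a, b) \<in> J \<longleftrightarrow> (a, b) \<in> immediate r"
  by (auto simp: J_def)

lemma link_neg: "a \<in> H \<Longrightarrow> P a = Pos \<Longrightarrow> P (\<theta> a) = Neg"
  and link_pos: "a \<in> H \<Longrightarrow> P a = Neg \<Longrightarrow> P (\<theta> a) = Pos"
  using link_polarity[of a] by auto

lemma r_I: "(a, b) \<in> r \<Longrightarrow> (a, b) \<in> I\<^sup>*"
  by (cases "a = b") (auto simp: I_def)

lemma link_I: "a \<in> H \<Longrightarrow> P a = Pos \<Longrightarrow> (a, \<theta> a) \<in> I"
  by (auto simp: I_def)

lemma J_I: "(a, b) \<in> J \<Longrightarrow> (a, b) \<in> I"
proof (cases "b \<in> H \<and> P b = Neg")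
  case True
  moreover assume "(a, b) \<in> J"
  ultimately have "a = \<theta> b" by (simp add: J_link)
  then show ?thesis
    using True link_I[of "\<theta> b"] link_pos[of b] link_link[of b] link_hidden[of b] by simp
next
  case False
  moreover assume "(a, b) \<in> J"
  ultimately have "(a, b) \<in> immediate r" by (simp add: J_immediate)
  then show ?thesis using immediateD[of a b] by (simp add: I_def)
qed

text \<open>The delicate case is a received event \<open>b\<close> with \<open>a\<close> below it on
  the same side. The justifier \<open>j\<close> of \<open>b\<close> is above \<open>a\<close> and is
  played there. Its copy \<open>\<theta> j\<close> is below \<open>\<theta> b\<close>, because
  \<open>\<theta>\<close> respects the static order. So \<open>a\<close> reaches \<open>b\<close>
  through \<open>j\<close>, \<open>\<theta> j\<close> and \<open>\<theta> b\<close>.\<close>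

lemma I_J:
  assumes "(a, b) \<in> I"
  obtains c where "(c, b) \<in> J" "(a, c) \<in> I\<^sup>*"
proof -
  have ab: "(a, b) \<in> r \<and> a \<noteq> b \<or> a \<in> H \<and> P a = Pos \<and> b = \<theta> a"
    using assms by (auto simp: I_def)
  show ?thesis
  proof (cases "b \<in> H \<and> P b = Neg")
    case b: True
    show ?thesis
    proof (cases "(a, b) \<in> r \<and> a \<noteq> b")
      case True
      then obtain j where j: "(j, b) \<in> immediate s" "(a, j) \<in> r" "P j = Pos"
        using negative_pred[of b a] b by blast
      have jb: "(j, b) \<in> s" using immediateD[OF j(1)] by simp
      have jH: "j \<in> H" using hidden_closed[OF jb] b by simp
      have "(\<theta> j, \<theta> b) \<in> I\<^sup>*" using r_I[OF static[OF link_static[OF jH _ jb]]] b by simp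
      then have "(a, \<theta> b) \<in> I\<^sup>*"
        using r_I[OF j(2)] link_I[OF jH j(3)] by (meson rtrancl_into_rtrancl rtrancl_trans)
      then show ?thesis using that[of "\<theta> b"] J_link b by simp
    next
      case False
      then have "a = \<theta> b" using ab link_link[of a] by auto
      then show ?thesis using that[of "\<theta> b"] J_link b by simp
    qed
  next
    case b: False
    then have "(a, b) \<in> r" "a \<noteq> b" using ab link_neg[of a] link_hidden[of a] by auto
    then obtain c where "(c, b) \<in> immediate r" "(a, c) \<in> r"
      using forest_immediate_pred[OF forest] by blast
    then show ?thesis using that[of c] r_I[of a c] J_immediate[OF b] by simp
  qed
qed

lemma finite_I: "finite I"
  by (rule finite_subset[OF I_subset]) (simp add: fin)

lemma I_wf: "wf I" and I_wf_converse: "wf (I\<inverse>)"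
  using finite_acyclic_wf[OF finite_I] finite_acyclic_wf_converse[OF finite_I] I_acyclic
  by (simp_all add: acyclic_def)

text \<open>Peeling off \<open>J\<close>-predecessors terminates because an acyclic relation on a
  finite set is well-founded. Hence \<open>J\<close> generates the same order as
  \<open>I\<close>.\<close>

lemma I_rtrancl_J: "(a, b) \<in> I\<^sup>* \<Longrightarrow> (a, b) \<in> J\<^sup>*"
proof (induction b rule: wf_induct_rule[OF I_wf])
  case (1 b)
  show ?case
  proof (cases "a = b")
    case False
    with "1.prems" obtain x where x: "(a, x) \<in> I\<^sup>*" "(x, b) \<in> I" by (auto elim: rtranclE)
    obtain c where c: "(c, b) \<in> J" "(x, c) \<in> I\<^sup>*" using I_J[OF x(2)] by blast
    have "(a, c) \<in> J\<^sup>*" using "1.IH"[OF J_I[OF c(1)] rtrancl_trans[OF x(1) c(2)]] .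
    then show ?thesis using c(1) by (rule rtrancl_into_rtrancl)
  qed simp
qed

lemma J_rtrancl_I: "(a, b) \<in> J\<^sup>* \<Longrightarrow> (a, b) \<in> I\<^sup>*"
  using rtrancl_mono[of J I] J_I by (auto simp: subset_iff)

lemma I_antisym: "(a, b) \<in> I\<^sup>* \<Longrightarrow> (b, a) \<in> I\<^sup>* \<Longrightarrow> a = b"
  using I_acyclic[of a] by (metis rtranclD trancl_rtrancl_trancl)

lemma J_single_valued: "single_valued (J\<inverse>)"
proof (rule single_valuedI)
  fix b a a' assume "(b, a) \<in> J\<inverse>" "(b, a') \<in> J\<inverse>"
  then show "a = a'"
    using forest_immediate_unique[OF forest, of a b a']
    by (cases "b \<in> H \<and> P b = Neg") (auto simp: J_link J_immediate)
qed

text \<open>Each event has at most one \<open>J\<close>-predecessor, so all events below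
  \<open>a\<close> lie on a single backward chain.\<close>

lemma I_total: "(b, a) \<in> I\<^sup>* \<Longrightarrow> (c, a) \<in> I\<^sup>* \<Longrightarrow> (b, c) \<in> I\<^sup>* \<or> (c, b) \<in> I\<^sup>*"
  using single_valued_confluent[OF J_single_valued, of a b c] I_rtrancl_J J_rtrancl_I
  by (auto simp: rtrancl_converse)

text \<open>A positive interface event is followed by its received copy. A negative event is not
  maximal, and a cover above it is positive: a negative one would be a static cover, against
  alternation.\<close>

lemma J_succ_ex:
  assumes "a \<in> U" "a \<in> H \<or> P a = Neg"
  obtains b where "(a, b) \<in> J"
proof (cases "P a = Pos")
  case True
  then have "\<theta> a \<in> H" "P (\<theta> a) = Neg" "\<theta> (\<theta> a) = a"
    using assms link_hidden link_neg link_link by auto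
  then show ?thesis using that[of "\<theta> a"] J_link[of "\<theta> a" a] by simp
next
  case False
  then have "\<not> maximal_in U r a" using causal_maximal[OF causal, of a] by auto
  then obtain b where b: "(a, b) \<in> immediate r" using not_maximal_inE[OF forest assms(1)] by blast
  have "P b = Pos"
    using immediate_static[OF b] alternating[of a b] False by (cases "P b") auto
  then show ?thesis using that[of b] b J_immediate[of b a] by simp
qed

text \<open>A positive interface event could branch only along a static cover; but such a cover ends
  in a negative interface event, whose \<open>J\<close>-predecessor is its linked copy instead. For
  negative events, all successors are positive and \<open>immediate_unique\<close> applies.\<close>

lemma J_succ_unique:
  assumes "a \<in> H \<or> P a = Neg" "(a, b) \<in> J" "(a, c) \<in> J"
  shows "b = c"
proof (cases "P a = Pos")
  case True
  then have a: "a \<in> H" using assms by simp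
  have "b = \<theta> a" if ab: "(a, b) \<in> J" for b
  proof (cases "b \<in> H \<and> P b = Neg")
    case True
    then show ?thesis using ab link_link[of b] by (simp add: J_link)
  next
    case False
    then have "(a, b) \<in> immediate r" using ab by (simp add: J_immediate)
    then have b: "(a, b) \<in> immediate s" using immediate_static \<open>P a = Pos\<close> by simp
    then have "b \<in> H" "P b = Neg"
      using hidden_closed[of a b] immediateD[OF b] a alternating[OF b] \<open>P a = Pos\<close> by auto
    then show ?thesis using False by simp
  qed
  from this[OF assms(2)] this[OF assms(3)] show ?thesis by simp
next
  case False
  have "(a, b) \<in> immediate r \<and> P b = Pos" if ab: "(a, b) \<in> J" for b
  proof (cases "b \<in> H \<and> P b = Neg")
    case True
    then show ?thesis using ab link_pos[of b] False by (simp add: J_link)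
  next
    case b: False
    then have "(a, b) \<in> immediate r" using ab by (simp add: J_immediate)
    then show ?thesis using immediate_static[of a b] alternating[of a b] False by (cases "P b") auto
  qed
  then show ?thesis using assms immediate_unique[of a b c] False by simp
qed

lemma J_pred_ex:
  assumes "b \<in> U" "b \<in> H \<or> P b = Pos"
  obtains a where "(a, b) \<in> J"
proof (cases "P b = Pos")
  case False
  then show ?thesis using assms that[of "\<theta> b"] J_link[of b] by simp
next
  case True
  then have "\<not> minimal_in U r b" using causal_minimal[OF causal, of b] by auto
  then obtain a where b: "(a, b) \<in> immediate r" using not_minimal_inE[OF forest assms(1)] by blast
  then show ?thesis using that[of a] J_immediate[of b a] True by simp
qed

section \<open>Passage between visible and hidden events\<close>

lemma J_from_visible:
  assumes "(a, b) \<in> J" "a \<notin> H" "P a = Pos"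
  shows "(a, b) \<in> immediate s" "b \<notin> H"
proof -
  have "\<not> (b \<in> H \<and> P b = Neg)"
    using J_link[of b a] link_hidden[of b] assms(1,2) by blast
  then have "(a, b) \<in> immediate r" using assms by (simp add: J_immediate)
  then show *: "(a, b) \<in> immediate s" using immediate_static assms by simp
  show "b \<notin> H" using hidden_closed[of a b] immediateD[OF *] assms by simp
qed

lemma J_to_visible:
  assumes "(a, b) \<in> J" "b \<notin> H" "P b = Neg"
  shows "(a, b) \<in> immediate s" "a \<notin> H"
proof -
  have "(a, b) \<in> immediate r" using assms by (simp add: J_immediate)
  then show *: "(a, b) \<in> immediate s" using immediate_static assms by simp
  show "a \<notin> H" using hidden_closed[of a b] immediateD[OF *] assms by simp
qed

lemma J_subset: "(a, b) \<in> J \<Longrightarrow> a \<in> U \<and> b \<in> U \<and> a \<noteq> b"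
  using J_I[of a b] I_subset I_acyclic[of a] by auto

text \<open>Hidden and negative events always have a \<open>J\<close>-successor, so in a finite
  acyclic relation the ascent must eventually leave the interface.\<close>

lemma visible_above:
  assumes "x \<in> U" "x \<in> H \<or> P x = Neg"
  shows "\<exists>v\<in>U - H. v \<noteq> x \<and> (x, v) \<in> I\<^sup>*"
  using assms
proof (induction x rule: wf_induct_rule[OF I_wf_converse])
  case (1 x)
  obtain b where b: "(x, b) \<in> J" using J_succ_ex[OF "1.prems"] by blast
  have xb: "(x, b) \<in> I" "b \<in> U" "x \<noteq> b" using J_I[OF b] J_subset[OF b] by auto
  show ?case
  proof (cases "b \<in> H")
    case True
    then obtain v where v: "v \<in> U - H" "v \<noteq> b" "(b, v) \<in> I\<^sup>*" using "1.IH"[of b] xb by auto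
    have "v \<noteq> x" using I_antisym[of b x] v(3) xb by auto
    then show ?thesis using v xb(1) by (meson converse_rtrancl_into_rtrancl)
  next
    case False
    then show ?thesis using xb by (intro bexI[of _ b]) auto
  qed
qed

lemma visible_below:
  assumes "x \<in> U" "x \<in> H \<or> P x = Pos"
  shows "\<exists>v\<in>U - H. v \<noteq> x \<and> (v, x) \<in> I\<^sup>*"
  using assms
proof (induction x rule: wf_induct_rule[OF I_wf])
  case (1 x)
  obtain b where b: "(b, x) \<in> J" using J_pred_ex[OF "1.prems"] by blast
  have xb: "(b, x) \<in> I" "b \<in> U" "x \<noteq> b" using J_I[OF b] J_subset[OF b] by auto
  show ?case
  proof (cases "b \<in> H")
    case True
    then obtain v where v: "v \<in> U - H" "v \<noteq> b" "(v, b) \<in> I\<^sup>*" using "1.IH"[of b] xb by auto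
    have "v \<noteq> x" using I_antisym[of b x] v(3) xb by auto
    then show ?thesis using v xb(1) by (meson rtrancl_into_rtrancl)
  next
    case False
    then show ?thesis using xb by (intro bexI[of _ b]) auto
  qed
qed

text \<open>From a hidden or negative event the next \<open>J\<close>-step is forced. Both paths
  therefore coincide as long as they remain hidden, and they leave the interface at the same
  event.\<close>

lemma first_visible_unique:
  assumes "(x, e) \<in> J\<^sup>+" "(x, e') \<in> J\<^sup>+" "x \<in> H \<or> P x = Neg" "e \<notin> H" "e' \<notin> H"
    and "\<And>y. (x, y) \<in> J\<^sup>+ \<Longrightarrow> (y, e) \<in> J\<^sup>+ \<Longrightarrow> y \<in> H"
    and "\<And>y. (x, y) \<in> J\<^sup>+ \<Longrightarrow> (y, e') \<in> J\<^sup>+ \<Longrightarrow> y \<in> H"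
  shows "e = e'"
  using assms
proof (induction x rule: converse_trancl_induct)
  case (base x)
  obtain z where z: "(x, z) \<in> J" "(z, e') \<in> J\<^sup>*" using tranclD[OF base(2)] by blast
  have "z = e" using J_succ_unique[OF base(3) z(1) base(1)] .
  show ?case
  proof (rule ccontr)
    assume "e \<noteq> e'"
    then have "(e, e') \<in> J\<^sup>+" using z(2) \<open>z = e\<close> by (auto dest: rtranclD)
    then show False using base(1,4) base(7)[of e] by blast
  qed
next
  case (step x y)
  obtain z where z: "(x, z) \<in> J" "(z, e') \<in> J\<^sup>*" using tranclD[OF step(4)] by blast
  have zy: "z = y" using J_succ_unique[OF step(5) z(1) step(1)] .
  have xy: "(x, y) \<in> J\<^sup>+" using step(1) by blast
  have y: "y \<in> H" using step(8)[OF xy step(2)] .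
  then have "y \<noteq> e'" using step(7) by blast
  then have ye': "(y, e') \<in> J\<^sup>+" using z(2) zy by (auto dest: rtranclD)
  show ?case
  proof (rule step(3)[OF ye' _ step(6,7)])
    show "y \<in> H \<or> P y = Neg" using y by simp
    show "u \<in> H" if "(y, u) \<in> J\<^sup>+" "(u, e) \<in> J\<^sup>+" for u
      using step(8)[OF trancl_trans[OF xy that(1)] that(2)] .
    show "u \<in> H" if "(y, u) \<in> J\<^sup>+" "(u, e') \<in> J\<^sup>+" for u
      using step(9)[OF trancl_trans[OF xy that(1)] that(2)] .
  qed
qed

lemma J_trancl_I: "(a, b) \<in> J\<^sup>+ \<longleftrightarrow> (a, b) \<in> I\<^sup>* \<and> a \<noteq> b"
proof
  assume "(a, b) \<in> J\<^sup>+"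
  moreover have "(a, b) \<in> I\<^sup>+" using trancl_mono[OF \<open>(a, b) \<in> J\<^sup>+\<close>, of I] J_I by (auto simp: subset_iff)
  ultimately show "(a, b) \<in> I\<^sup>* \<and> a \<noteq> b" using I_acyclic[of a] by auto
next
  assume "(a, b) \<in> I\<^sup>* \<and> a \<noteq> b"
  then show "(a, b) \<in> J\<^sup>+" using I_rtrancl_J[of a b] by (auto dest: rtranclD)
qed

text \<open>A cover of the restricted order is a \<open>J\<close>-path with hidden interior. If its
  source is positive or its target negative, the adjacent \<open>J\<close>-step is static and stays
  visible, so it is the whole path. If its source is negative, the first visible event on the way is
  determined. The conditions on extremal events come from the visible events above and
  below.\<close>

theorem causal_hide: "causal (U - H) (Restr (I\<^sup>*) (U - H)) (Restr s (U - H)) P"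
proof -
  let ?V = "U - H" let ?r = "Restr (I\<^sup>*) (U - H)"
  have F: "forest ?V ?r"
  proof (rule forestI)
    show "(a, c) \<in> ?r" if "(a, b) \<in> ?r" "(b, c) \<in> ?r" for a b c
      using that by (auto dest: rtrancl_trans)
    show "a = b" if "(a, b) \<in> ?r" "(b, a) \<in> ?r" for a b
      using that I_antisym by auto
    show "finite {b. (b, a) \<in> ?r}" for a
      by (rule finite_subset[OF _ fin]) auto
    show "(b, c) \<in> ?r \<or> (c, b) \<in> ?r" if "(b, a) \<in> ?r" "(c, a) \<in> ?r" for a b c
      using that I_total[of b a c] by auto
  qed auto
  have imm: "a \<in> ?V \<and> b \<in> ?V \<and> (a, b) \<in> J\<^sup>+ \<and> (\<forall>y. (a, y) \<in> J\<^sup>+ \<and> (y, b) \<in> J\<^sup>+ \<longrightarrow> y \<in> H)"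
    if ab: "(a, b) \<in> immediate ?r" for a b
  proof (intro conjI allI impI)
    note 1 = immediateD[OF ab]
    show "a \<in> ?V" "b \<in> ?V" "(a, b) \<in> J\<^sup>+" using 1 J_trancl_I by auto
    fix y assume "(a, y) \<in> J\<^sup>+ \<and> (y, b) \<in> J\<^sup>+"
    then have y: "(a, y) \<in> I\<^sup>*" "a \<noteq> y" "(y, b) \<in> I\<^sup>*" "y \<noteq> b" using J_trancl_I by auto
    have "y \<in> U" using y 1 I_subset by (auto elim: rtranclE)
    then show "y \<in> H" using immediate_between[OF ab, of y] y 1 by auto
  qed
  have static': "(a, b) \<in> immediate (Restr s ?V)"
    if ab: "(a, b) \<in> immediate ?r" and P: "P a = Pos \<or> P b = Neg" for a b
  proof -
    note 1 = imm[OF ab]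
    then have ab': "(a, b) \<in> J\<^sup>+" by simp
    have "(a, b) \<in> immediate s"
    proof (cases "P a = Pos")
      case True
      obtain z where z: "(a, z) \<in> J" "(z, b) \<in> J\<^sup>*" using tranclD[OF ab'] by blast
      have az: "(a, z) \<in> immediate s" "z \<notin> H" using J_from_visible[OF z(1)] 1 True by auto
      have "z = b" using 1 z az by (metis r_into_trancl rtranclD)
      then show ?thesis using az by simp
    next
      case False
      obtain z where z: "(a, z) \<in> J\<^sup>*" "(z, b) \<in> J" using tranclD2[OF ab'] by blast
      have az: "(z, b) \<in> immediate s" "z \<notin> H" using J_to_visible[OF z(2)] 1 False P by auto
      have "z = a" using 1 z az by (metis r_into_trancl rtranclD)
      then show ?thesis using az by simp
    qed
    then show ?thesis using 1 by (simp add: immediate_Restr)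
  qed
  have unique: "b = c"
    if "(a, b) \<in> immediate ?r" "(a, c) \<in> immediate ?r" "P a = Neg" for a b c
    using first_visible_unique[of a b c] imm[OF that(1)] imm[OF that(2)] that(3) by blast
  have max: "P a = Pos" if "maximal_in ?V ?r a" for a
    using that visible_above[of a] by (cases "P a") (auto simp: maximal_in_def)
  have min: "P a = Neg" if "minimal_in ?V ?r a" for a
    using that visible_below[of a] by (cases "P a") (auto simp: minimal_in_def)
  have sub: "Restr s ?V \<subseteq> ?r" using static r_I by auto
  show ?thesis unfolding causal_def using F sub static' unique max min by blast
qed

end

section \<open>Configurations on an arrow arena\<close>

lemma sum_rel_simps [simp]:
  "(Inl a, Inl b) \<in> sum_rel r s \<longleftrightarrow> (a, b) \<in> r"
  "(Inr c, Inr d) \<in> sum_rel r s \<longleftrightarrow> (c, d) \<in> s"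
  "(Inl a, Inr d) \<notin> sum_rel r s" "(Inr c, Inl b) \<notin> sum_rel r s"
  by (auto simp: sum_rel_def)

lemma ball_Plus: "(\<forall>x\<in>S <+> T. Q x) \<longleftrightarrow> (\<forall>a\<in>S. Q (Inl a)) \<and> (\<forall>b\<in>T. Q (Inr b))"
  by auto

lemma ex_sum: "(\<exists>x. Q x) \<longleftrightarrow> (\<exists>a. Q (Inl a)) \<or> (\<exists>b. Q (Inr b))"
proof
  assume "\<exists>x. Q x"
  then obtain x where "Q x" by blast
  then show "(\<exists>a. Q (Inl a)) \<or> (\<exists>b. Q (Inr b))" by (cases x) auto
qed auto

lemma immediate_sum_rel [simp]:
  "(Inl a, Inl b) \<in> immediate (sum_rel r s) \<longleftrightarrow> (a, b) \<in> immediate r"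
  "(Inr c, Inr d) \<in> immediate (sum_rel r s) \<longleftrightarrow> (c, d) \<in> immediate s"
  "(Inl a, Inr d) \<notin> immediate (sum_rel r s)" "(Inr c, Inl b) \<notin> immediate (sum_rel r s)"
  by (simp_all add: immediate_def ex_sum)

lemma minimal_in_sum_rel [simp]:
  "minimal_in (S <+> T) (sum_rel r s) (Inl a) \<longleftrightarrow> minimal_in S r a"
  "minimal_in (S <+> T) (sum_rel r s) (Inr b) \<longleftrightarrow> minimal_in T s b"
  by (simp_all add: minimal_in_def ball_Plus InlI InrI) (auto elim!: PlusE)

lemma maximal_in_sum_rel [simp]:
  "maximal_in (S <+> T) (sum_rel r s) (Inl a) \<longleftrightarrow> maximal_in S r a"
  "maximal_in (S <+> T) (sum_rel r s) (Inr b) \<longleftrightarrow> maximal_in T s b"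
  by (simp_all add: maximal_in_def ball_Plus InlI InrI) (auto elim!: PlusE)

lemma forest_sum_rel:
  assumes F: "forest S r" and G: "forest T s"
  shows "forest (S <+> T) (sum_rel r s)"
proof (rule forestI)
  show "sum_rel r s \<subseteq> (S <+> T) \<times> (S <+> T)"
    using forest_subset[OF F] forest_subset[OF G] by (auto simp: sum_rel_def)
  show "(a, a) \<in> sum_rel r s" if "a \<in> S <+> T" for a
    using that forest_refl[OF F] forest_refl[OF G] by auto
  show "(a, c) \<in> sum_rel r s" if "(a, b) \<in> sum_rel r s" "(b, c) \<in> sum_rel r s" for a b c
    using that by (cases a; cases b; cases c) (auto intro: forest_trans[OF F] forest_trans[OF G])
  show "a = b" if "(a, b) \<in> sum_rel r s" "(b, a) \<in> sum_rel r s" for a b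
    using that forest_antisym[OF F] forest_antisym[OF G] by (cases a; cases b) simp_all
  show "finite {b. (b, a) \<in> sum_rel r s}" for a
  proof (cases a)
    case (Inl x)
    have "{b. (b, a) \<in> sum_rel r s} \<subseteq> Inl ` {b. (b, x) \<in> r}" by (auto simp: Inl sum_rel_def)
    then show ?thesis using forest_finite[OF F, of x] by (auto intro: finite_subset)
  next
    case (Inr x)
    have "{b. (b, a) \<in> sum_rel r s} \<subseteq> Inr ` {b. (b, x) \<in> s}" by (auto simp: Inr sum_rel_def)
    then show ?thesis using forest_finite[OF G, of x] by (auto intro: finite_subset)
  qed
  show "(b, c) \<in> sum_rel r s \<or> (c, b) \<in> sum_rel r s"
    if "(b, a) \<in> sum_rel r s" "(c, a) \<in> sum_rel r s" for a b c
    using that forest_total[OF F] forest_total[OF G] by (cases a; cases b; cases c) simp_all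
qed

lemma causal_sum_rel:
  assumes 1: "causal S r s P" and 2: "causal S' r' s' P'"
  shows "causal (S <+> S') (sum_rel r r') (sum_rel s s') (case_sum P P')"
  unfolding causal_def
proof (intro conjI allI impI; (elim conjE)?)
  show "forest (S <+> S') (sum_rel r r')"
    using forest_sum_rel causal_forest[OF 1] causal_forest[OF 2] .
  show "sum_rel s s' \<subseteq> sum_rel r r'"
    using causal_static[OF 1] causal_static[OF 2] by (auto simp: sum_rel_def)
  show "(a, b) \<in> immediate (sum_rel s s')"
    if "(a, b) \<in> immediate (sum_rel r r')" "case_sum P P' a = Pos \<or> case_sum P P' b = Neg" for a b
    using that causal_immediate[OF 1] causal_immediate[OF 2] by (cases a; cases b) simp_all
  show "b = c" if "(a, b) \<in> immediate (sum_rel r r')" "(a, c) \<in> immediate (sum_rel r r')"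
    "case_sum P P' a = Neg" "case_sum P P' b = Pos" "case_sum P P' c = Pos" for a b c
    using that causal_unique[OF 1] causal_unique[OF 2] by (cases a; cases b; cases c) simp_all
  show "case_sum P P' a = Pos" if "maximal_in (S <+> S') (sum_rel r r') a" for a
    using that causal_maximal[OF 1] causal_maximal[OF 2] by (cases a) simp_all
  show "case_sum P P' a = Neg" if "minimal_in (S <+> S') (sum_rel r r') a" for a
    using that causal_minimal[OF 1] causal_minimal[OF 2] by (cases a) simp_all
qed

lemma immediate_subset: "forest S r \<Longrightarrow> (a, b) \<in> immediate r \<Longrightarrow> a \<in> S \<and> b \<in> S"
  using immediateD forest_subset by metis

text \<open>The conditions only speak of events in \<open>S\<close>. This allows the polarities seen
  by two composed augmentations to be exchanged for those of the arena of the composite.\<close>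

lemma causal_cong:
  assumes "causal S r s P" and eq: "\<And>a. a \<in> S \<Longrightarrow> P a = P' a"
  shows "causal S r s P'"
  unfolding causal_def
proof (intro conjI allI impI; (elim conjE)?)
  note F = causal_forest[OF assms(1)]
  show "forest S r" by (rule F)
  show "s \<subseteq> r" using causal_static[OF assms(1)] by auto
  show "(a, b) \<in> immediate s" if "(a, b) \<in> immediate r" "P' a = Pos \<or> P' b = Neg" for a b
    using that causal_immediate[OF assms(1), of a b] immediate_subset[OF F that(1)] eq by simp
  show "b = c" if "(a, b) \<in> immediate r" "(a, c) \<in> immediate r" "P' a = Neg" "P' b = Pos" "P' c = Pos"
    for a b c
    using that causal_unique[OF assms(1), of a b c] immediate_subset[OF F that(1)]
      immediate_subset[OF F that(2)] eq by simp
  show "P' a = Pos" if "maximal_in S r a" for a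
    using that causal_maximal[OF assms(1), of a] eq by (simp add: maximal_in_def)
  show "P' a = Neg" if "minimal_in S r a" for a
    using that causal_minimal[OF assms(1), of a] eq by (simp add: minimal_in_def)
qed

lemma hom_arena_simps [simp]:
  "moves (A \<turnstile> B) = moves A <+> moves B"
  "arena_le (A \<turnstile> B) = sum_rel (arena_le A) (arena_le B)"
  "a \<in> moves A \<Longrightarrow> pol (A \<turnstile> B) (Inl a) = opposite (pol A a)"
  "b \<in> moves B \<Longrightarrow> pol (A \<turnstile> B) (Inr b) = pol B b"
  by (simp_all add: hom_arena_def tensor_def dual_def InlI InrI)

lemma opposite_eq_iff [simp]:
  "opposite p = Pos \<longleftrightarrow> p = Neg" "opposite p = Neg \<longleftrightarrow> p = Pos" "opposite p = opposite p' \<longleftrightarrow> p = p'"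
  by (cases p; cases p'; simp)+

lemma arena_forest: "arena A \<Longrightarrow> forest (moves A) (arena_le A)"
  by (simp add: arena_def)

lemma arena_alternating: "arena A \<Longrightarrow> (a, b) \<in> immediate (arena_le A) \<Longrightarrow> pol A a \<noteq> pol A b"
  unfolding arena_def by blast

lemma hom_arena_alternating:
  assumes "arena A" "arena B" "(a, b) \<in> immediate (arena_le (A \<turnstile> B))"
  shows "pol (A \<turnstile> B) a \<noteq> pol (A \<turnstile> B) b"
proof -
  have "(a, b) \<in> immediate (sum_rel (arena_le A) (arena_le B))" using assms(3) by simp
  then show ?thesis
    using arena_alternating[OF assms(1)] arena_alternating[OF assms(2)]
      immediate_subset[OF arena_forest[OF assms(1)]] immediate_subset[OF arena_forest[OF assms(2)]]
    by (cases a; cases b) (simp_all del: not_Pos not_Neg)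
qed

section \<open>Configurations and their two components\<close>

lemma configurationD:
  assumes "configuration A x"
  shows configuration_finite: "finite (events x)"
    and configuration_forest: "forest (events x) (deseq x)"
    and configuration_display: "m \<in> events x \<Longrightarrow> display x m \<in> moves A"
    and configuration_minimal: "m \<in> events x \<Longrightarrow>
      minimal_in (events x) (deseq x) m \<longleftrightarrow> minimal_in (moves A) (arena_le A) (display x m)"
    and configuration_immediate: "(m, n) \<in> immediate (deseq x) \<Longrightarrow>
      (display x m, display x n) \<in> immediate (arena_le A)"
  using assms unfolding configuration_def by blast+

lemma configurationI:
  assumes "finite (events x)" "forest (events x) (deseq x)"
    "\<And>m. m \<in> events x \<Longrightarrow> display x m \<in> moves A"
    "\<And>m. m \<in> events x \<Longrightarrow>
      minimal_in (events x) (deseq x) m \<longleftrightarrow> minimal_in (moves A) (arena_le A) (display x m)"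
    "\<And>m n. (m, n) \<in> immediate (deseq x) \<Longrightarrow> (display x m, display x n) \<in> immediate (arena_le A)"
  shows "configuration A x"
  using assms unfolding configuration_def by blast

text \<open>Covers generate the static order, and they are displayed to covers of the arena, which
  never pass from one component to the other.\<close>

lemma configuration_component:
  assumes "configuration (A \<turnstile> B) q" "(m, n) \<in> deseq q"
  shows "isl (display q m) \<longleftrightarrow> isl (display q n)"
proof -
  have "isl (display q m) \<longleftrightarrow> isl (display q n)" if "(m, n) \<in> immediate (deseq q)" for m n
    using configuration_immediate[OF assms(1) that]
    by (cases "display q m"; cases "display q n") simp_all
  with forest_immediate_rtrancl[OF configuration_forest[OF assms(1)] assms(2)]
  show ?thesis by (induction) auto
qed

lemma part_simps [simp]:
  "events (left_part q) = {m \<in> events q. isl (display q m)}"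
  "deseq (left_part q) = Restr (deseq q) {m \<in> events q. isl (display q m)}"
  "display (left_part q) m = projl (display q m)"
  "events (right_part q) = {m \<in> events q. \<not> isl (display q m)}"
  "deseq (right_part q) = Restr (deseq q) {m \<in> events q. \<not> isl (display q m)}"
  "display (right_part q) m = projr (display q m)"
  by (simp_all add: left_part_def right_part_def Let_def)

lemma immediate_Restr_closed:
  assumes "\<And>a b. (a, b) \<in> r \<Longrightarrow> a \<in> E \<longleftrightarrow> b \<in> E"
  shows "(a, b) \<in> immediate (Restr r E) \<longleftrightarrow> (a, b) \<in> immediate r \<and> a \<in> E"
  using assms unfolding immediate_def by blast

lemma minimal_in_Restr_closed:
  assumes "\<And>a b. (a, b) \<in> r \<Longrightarrow> a \<in> E \<longleftrightarrow> b \<in> E" "E \<subseteq> S" "a \<in> E"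
  shows "minimal_in E (Restr r E) a \<longleftrightarrow> minimal_in S r a"
  using assms unfolding minimal_in_def by blast

lemma part_closed:
  assumes "configuration (A \<turnstile> B) q" "(m, n) \<in> deseq q"
  shows "m \<in> {m \<in> events q. isl (display q m)} \<longleftrightarrow> n \<in> {m \<in> events q. isl (display q m)}"
    "m \<in> {m \<in> events q. \<not> isl (display q m)} \<longleftrightarrow> n \<in> {m \<in> events q. \<not> isl (display q m)}"
  using configuration_component[OF assms] forest_subset[OF configuration_forest[OF assms(1)] assms(2)]
  by auto

text \<open>Common core of both projections: \<open>K\<close> selects a component closed under the
  static order in both directions, so covers and minimal events in it are those of the whole, and
  only the display changes.\<close>

lemma configuration_part:
  assumes q: "configuration A q"
    and y: "events y = {m \<in> events q. K (display q m)}" "deseq y = Restr (deseq q) (events y)"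
    and K: "\<And>m n. (m, n) \<in> deseq q \<Longrightarrow> K (display q m) \<longleftrightarrow> K (display q n)"
    and moves: "\<And>m. m \<in> events y \<Longrightarrow> display q m \<in> moves A \<Longrightarrow> display y m \<in> moves B"
    and minimal: "\<And>m. m \<in> events y \<Longrightarrow> minimal_in (moves A) (arena_le A) (display q m) \<longleftrightarrow>
      minimal_in (moves B) (arena_le B) (display y m)"
    and immediate: "\<And>m n. m \<in> events y \<Longrightarrow> n \<in> events y \<Longrightarrow>
      (display q m, display q n) \<in> immediate (arena_le A) \<Longrightarrow>
      (display y m, display y n) \<in> immediate (arena_le B)"
  shows "configuration B y"
proof (rule configurationI)
  note F = configuration_forest[OF q]
  have c: "m \<in> events y \<longleftrightarrow> n \<in> events y" if "(m, n) \<in> deseq q" for m n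
    using K[OF that] forest_subset[OF F that] by (simp add: y(1))
  have sub: "events y \<subseteq> events q" by (auto simp: y(1))
  show "finite (events y)" using configuration_finite[OF q] by (simp add: y(1))
  show "forest (events y) (deseq y)" unfolding y(2) by (rule forest_Restr[OF F sub])
  fix m assume m: "m \<in> events y"
  then have mq: "m \<in> events q" using sub by blast
  show "display y m \<in> moves B" using moves[OF m configuration_display[OF q mq]] .
  show "minimal_in (events y) (deseq y) m \<longleftrightarrow> minimal_in (moves B) (arena_le B) (display y m)"
    using configuration_minimal[OF q mq] minimal[OF m] minimal_in_Restr_closed[OF _ sub m, where r = "deseq q"] c
    unfolding y(2) by blast
next
  fix m n assume mn: "(m, n) \<in> immediate (deseq y)"
  have c: "m \<in> events y \<longleftrightarrow> n \<in> events y" if "(m, n) \<in> deseq q" for m n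
    using K[OF that] forest_subset[OF configuration_forest[OF q] that] by (simp add: y(1))
  have "(m, n) \<in> immediate (deseq q)" "m \<in> events y"
    using mn immediate_Restr_closed[of "deseq q" "events y" m n, OF c] unfolding y(2) by blast+
  moreover from this have "n \<in> events y" using c[of m n] immediateD[of m n] by simp
  ultimately show "(display y m, display y n) \<in> immediate (arena_le B)"
    using immediate configuration_immediate[OF q] by blast
qed

lemma configuration_left_part:
  assumes q: "configuration (A \<turnstile> B) q"
  shows "configuration A (left_part q)"
proof (rule configuration_part[OF q, where K = isl])
  show "isl (display q m) \<longleftrightarrow> isl (display q n)" if "(m, n) \<in> deseq q" for m n
    by (rule configuration_component[OF q that])
qed (auto simp: isl_def)

lemma configuration_right_part:
  assumes q: "configuration (A \<turnstile> B) q"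
  shows "configuration B (right_part q)"
proof (rule configuration_part[OF q, where K = "\<lambda>d. \<not> isl d"])
  show "\<not> isl (display q m) \<longleftrightarrow> \<not> isl (display q n)" if "(m, n) \<in> deseq q" for m n
    using configuration_component[OF q that] by simp
  have r: "\<exists>b. display q m = Inr b" if "m \<in> events (right_part q)" for m
    using that by (cases "display q m") auto
  show "display (right_part q) m \<in> moves B"
    if "m \<in> events (right_part q)" "display q m \<in> moves (A \<turnstile> B)" for m
    using r[OF that(1)] that(2) by auto
  show "minimal_in (moves (A \<turnstile> B)) (arena_le (A \<turnstile> B)) (display q m) \<longleftrightarrow>
      minimal_in (moves B) (arena_le B) (display (right_part q) m)"
    if "m \<in> events (right_part q)" for m
    using r[OF that] by auto
  show "(display (right_part q) m, display (right_part q) n) \<in> immediate (arena_le B)"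
    if "m \<in> events (right_part q)" "n \<in> events (right_part q)"
      "(display q m, display q n) \<in> immediate (arena_le (A \<turnstile> B))" for m n
    using r[OF that(1)] r[OF that(2)] that(3) by auto
qed simp_all

lemma configuration_sum:
  assumes x: "configuration A x" and y: "configuration B y"
    and z: "events z = events x <+> events y" "deseq z = sum_rel (deseq x) (deseq y)"
    and l: "\<And>m. m \<in> events x \<Longrightarrow> display z (Inl m) = Inl (display x m)"
    and r: "\<And>m. m \<in> events y \<Longrightarrow> display z (Inr m) = Inr (display y m)"
  shows "configuration (A \<turnstile> B) z"
proof (rule configurationI)
  show "finite (events z)" using configuration_finite[OF x] configuration_finite[OF y] by (simp add: z)
  show "forest (events z) (deseq z)"
    using forest_sum_rel[OF configuration_forest[OF x] configuration_forest[OF y]] by (simp add: z)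
  show "display z m \<in> moves (A \<turnstile> B)" if "m \<in> events z" for m
    using that l r configuration_display[OF x] configuration_display[OF y] by (auto simp: z)
  show "minimal_in (events z) (deseq z) m \<longleftrightarrow>
    minimal_in (moves (A \<turnstile> B)) (arena_le (A \<turnstile> B)) (display z m)" if "m \<in> events z" for m
    using that l r configuration_minimal[OF x] configuration_minimal[OF y] by (auto simp: z)
  show "(display z m, display z n) \<in> immediate (arena_le (A \<turnstile> B))"
    if "(m, n) \<in> immediate (deseq z)" for m n
    using that l r configuration_immediate[OF x] configuration_immediate[OF y]
      immediate_subset[OF configuration_forest[OF x]] immediate_subset[OF configuration_forest[OF y]]
    by (cases m; cases n) (simp_all add: z)
qed

section \<open>Symmetries and the edges of an interaction\<close>

lemma symmetriesD:
  assumes "\<phi> \<in> symmetries x y"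
  shows symmetries_extensional: "\<phi> \<in> extensional (events x)"
    and symmetries_bij: "bij_betw \<phi> (events x) (events y)"
    and symmetries_deseq: "m \<in> events x \<Longrightarrow> n \<in> events x \<Longrightarrow>
      (m, n) \<in> deseq x \<longleftrightarrow> (\<phi> m, \<phi> n) \<in> deseq y"
    and symmetries_display: "m \<in> events x \<Longrightarrow> display y (\<phi> m) = display x m"
    and symmetries_in: "m \<in> events x \<Longrightarrow> \<phi> m \<in> events y"
  using assms unfolding symmetries_def by (auto dest: bij_betwE)

lemma interaction_simps:
  "(Inl m, Inl m') \<in> interaction A B C p \<phi> q \<longleftrightarrow> (m, m') \<in> seq q \<and> m \<noteq> m'"
  "(Inr n, Inr n') \<in> interaction A B C p \<phi> q \<longleftrightarrow> (n, n') \<in> seq p \<and> n \<noteq> n'"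
  "(Inl m, Inr n) \<in> interaction A B C p \<phi> q \<longleftrightarrow>
    m \<in> events (right_part q) \<and> pol (A \<turnstile> B) (display q m) = Pos \<and> n = \<phi> m"
  "(Inr n, Inl m) \<in> interaction A B C p \<phi> q \<longleftrightarrow>
    n \<in> events (left_part p) \<and> pol (B \<turnstile> C) (display p n) = Pos \<and>
    m = inv_into (events (right_part q)) \<phi> n"
  unfolding interaction_def by auto

section \<open>Composites are augmentations\<close>

lemma Plus_iff [simp]: "Inl a \<in> S <+> T \<longleftrightarrow> a \<in> S" "Inr b \<in> S <+> T \<longleftrightarrow> b \<in> T"
  by auto

definition interface ::
  "('e, 'a + 'b) augmentation \<Rightarrow> ('f, 'b + 'c) augmentation \<Rightarrow> ('e + 'f) set" where
  "interface q p = events (right_part q) <+> events (left_part p)"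

definition link ::
  "('e, 'a + 'b) augmentation \<Rightarrow> ('e \<Rightarrow> 'f) \<Rightarrow> 'e + 'f \<Rightarrow> 'e + 'f" where
  "link q \<phi> = case_sum (\<lambda>m. Inr (\<phi> m)) (\<lambda>n. Inl (inv_into (events (right_part q)) \<phi> n))"

text \<open>Each event has the polarity given by its own augmentation, so the two copies of an
  interface event disagree: one side plays it, the other receives it.\<close>

definition polarity_sum ::
  "'a arena \<Rightarrow> 'b arena \<Rightarrow> 'c arena \<Rightarrow> ('f, 'b + 'c) augmentation \<Rightarrow>
   ('e, 'a + 'b) augmentation \<Rightarrow> 'e + 'f \<Rightarrow> polarity" where
  "polarity_sum A B C p q =
     case_sum (\<lambda>m. pol (A \<turnstile> B) (display q m)) (\<lambda>n. pol (B \<turnstile> C) (display p n))"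

lemma augmentation_configuration: "augmentation A q \<Longrightarrow> configuration A q"
  and augmentation_causal:
    "augmentation A q \<Longrightarrow> causal (events q) (seq q) (deseq q) (\<lambda>e. pol A (display q e))"
  by (simp_all add: augmentation_iff)

lemma inv_symmetry:
  assumes "\<phi> \<in> symmetries x y" "n \<in> events y"
  shows "inv_into (events x) \<phi> n \<in> events x" "\<phi> (inv_into (events x) \<phi> n) = n"
  using symmetries_bij[OF assms(1)] assms(2)
  by (metis bij_betw_imp_surj_on inv_into_into, metis bij_betw_inv_into_right)

lemma inv_symmetry_left:
  assumes "\<phi> \<in> symmetries x y" "m \<in> events x"
  shows "inv_into (events x) \<phi> (\<phi> m) = m"
  using symmetries_bij[OF assms(1)] assms(2) by (metis bij_betw_inv_into_left)

text \<open>Linked events show the same move of \<open>B\<close>, but \<open>q\<close> reads it in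
  \<open>B\<close> and \<open>p\<close> in the dual of \<open>B\<close>, whence opposite polarities.
  Roots of \<open>B\<close> are negative, so interface roots are negative throughout the first
  summand and positive throughout the second; as \<open>sum_rel\<close> joins nothing across the
  summands, \<open>roots\<close> follows.\<close>

lemma interaction_net:
  assumes arenas: "arena A" "arena B" "arena C" and neg: "negative B"
    and q: "augmentation (A \<turnstile> B) q" and p: "augmentation (B \<turnstile> C) p"
    and \<phi>: "\<phi> \<in> symmetries (right_part q) (left_part p)"
  shows "interaction_net (events q <+> events p) (sum_rel (seq q) (seq p))
    (sum_rel (deseq q) (deseq p)) (polarity_sum A B C p q) (interface q p) (link q \<phi>)"
proof -
  note cq = augmentation_configuration[OF q] and cp = augmentation_configuration[OF p]
  note Fq = configuration_forest[OF cq] and Fp = configuration_forest[OF cp]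
  let ?P = "polarity_sum A B C p q" and ?H = "interface q p" and ?\<theta> = "link q \<phi>"
  note defs = interface_def link_def polarity_sum_def
  note inv = inv_symmetry[OF \<phi>] and invl = inv_symmetry_left[OF \<phi>]
  have dq: "\<exists>b\<in>moves B. display q m = Inr b" if "m \<in> events (right_part q)" for m
    using configuration_display[OF cq, of m] that by (cases "display q m") auto
  have dp: "\<exists>b\<in>moves B. display p n = Inl b" if "n \<in> events (left_part p)" for n
    using configuration_display[OF cp, of n] that by (cases "display p n") auto
  have polarity: "pol (A \<turnstile> B) (display q m) \<noteq> pol (B \<turnstile> C) (display p (\<phi> m))"
    if m: "m \<in> events (right_part q)" for m
  proof -
    obtain b b' where b: "b \<in> moves B" "display q m = Inr b" "b' \<in> moves B" "display p (\<phi> m) = Inl b'"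
      using dq[OF m] dp[OF symmetries_in[OF \<phi> m]] by blast
    have "b = b'" using symmetries_display[OF \<phi> m] b by simp
    then show ?thesis using b by (cases "pol B b") simp_all
  qed
  show ?thesis
  proof
    show "finite (events q <+> events p)"
      using configuration_finite[OF cq] configuration_finite[OF cp] by simp
    show "causal (events q <+> events p) (sum_rel (seq q) (seq p)) (sum_rel (deseq q) (deseq p)) ?P"
      unfolding polarity_sum_def
      by (rule causal_sum_rel[OF augmentation_causal[OF q] augmentation_causal[OF p]])
    show "forest (events q <+> events p) (sum_rel (deseq q) (deseq p))"
      by (rule forest_sum_rel[OF Fq Fp])
    show "?P a \<noteq> ?P b" if "(a, b) \<in> immediate (sum_rel (deseq q) (deseq p))" for a b
      using that hom_arena_alternating[OF arenas(1,2) configuration_immediate[OF cq]]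
        hom_arena_alternating[OF arenas(2,3) configuration_immediate[OF cp]]
      by (cases a; cases b) (simp_all add: polarity_sum_def del: not_Pos not_Neg)
    show "?H \<subseteq> events q <+> events p" by (auto simp: interface_def)
    show "a \<in> ?H \<longleftrightarrow> b \<in> ?H" if ab: "(a, b) \<in> sum_rel (deseq q) (deseq p)" for a b
    proof (cases a; cases b)
      fix m n assume "a = Inl m" "b = Inl n"
      then show ?thesis using ab part_closed(2)[OF cq, of m n] by (simp add: interface_def)
    next
      fix m n assume "a = Inr m" "b = Inr n"
      then show ?thesis using ab part_closed(1)[OF cp, of m n] by (simp add: interface_def)
    qed (use ab in simp_all)
    show "?\<theta> a \<in> ?H" if "a \<in> ?H" for a
      using that symmetries_in[OF \<phi>] inv(1) unfolding defs by (cases a) auto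
    show "?\<theta> (?\<theta> a) = a" if "a \<in> ?H" for a
      using that invl inv(2) unfolding defs by (cases a) auto
    show "?P (?\<theta> a) \<noteq> ?P a" if a: "a \<in> ?H" for a
    proof (cases a)
      case (Inl m)
      then show ?thesis using a polarity[of m] unfolding defs by auto
    next
      case (Inr n)
      then have n: "n \<in> events (left_part p)" using a unfolding defs by auto
      show ?thesis using polarity[OF inv(1)[OF n]] inv(2)[OF n] Inr unfolding defs by auto
    qed
    show "(?\<theta> a, ?\<theta> b) \<in> sum_rel (deseq q) (deseq p)"
      if "a \<in> ?H" "b \<in> ?H" "(a, b) \<in> sum_rel (deseq q) (deseq p)" for a b
    proof (cases a; cases b)
      fix m n assume ab: "a = Inl m" "b = Inl n"
      then have mn: "m \<in> events (right_part q)" "n \<in> events (right_part q)" "(m, n) \<in> deseq q"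
        using that unfolding defs by auto
      then have "(m, n) \<in> deseq (right_part q)" by simp
      then have "(\<phi> m, \<phi> n) \<in> deseq (left_part p)" using symmetries_deseq[OF \<phi> mn(1,2)] by blast
      then show ?thesis using ab by (simp add: link_def)
    next
      fix m n assume ab: "a = Inr m" "b = Inr n"
      then have mn: "m \<in> events (left_part p)" "n \<in> events (left_part p)" "(m, n) \<in> deseq p"
        using that unfolding defs by auto
      then have "(m, n) \<in> deseq (left_part p)" by simp
      then have "(inv_into (events (right_part q)) \<phi> m, inv_into (events (right_part q)) \<phi> n)
          \<in> deseq (right_part q)"
        using symmetries_deseq[OF \<phi> inv(1)[OF mn(1)] inv(1)[OF mn(2)]] inv(2)[OF mn(1)] inv(2)[OF mn(2)]
        by metis
      then show ?thesis using ab by (simp add: link_def)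
    qed (use that in simp_all)
    show "?P a = ?P b"
      if ab: "a \<in> ?H" "b \<in> ?H" "minimal_in (events q <+> events p) (sum_rel (deseq q) (deseq p)) a"
        "minimal_in (events q <+> events p) (sum_rel (deseq q) (deseq p)) b"
        "(a, b) \<in> sum_rel (seq q) (seq p)" for a b
    proof -
      have l: "?P (Inl m) = Neg"
        if m: "m \<in> events (right_part q)" "minimal_in (events q) (deseq q) m" for m
      proof -
        obtain b where b: "b \<in> moves B" "display q m = Inr b" using dq[OF m(1)] by blast
        then have "minimal_in (moves B) (arena_le B) b"
          using configuration_minimal[OF cq, of m] m by simp
        then show ?thesis using neg b by (simp add: negative_def polarity_sum_def)
      qed
      have r: "?P (Inr m) = Pos"
        if m: "m \<in> events (left_part p)" "minimal_in (events p) (deseq p) m" for m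
      proof -
        obtain b where b: "b \<in> moves B" "display p m = Inl b" using dp[OF m(1)] by blast
        then have "minimal_in (moves B) (arena_le B) b"
          using configuration_minimal[OF cp, of m] m by simp
        then show ?thesis using neg b by (simp add: negative_def polarity_sum_def)
      qed
      show ?thesis
      proof (cases a; cases b)
        fix m n assume "a = Inl m" "b = Inl n"
        then show ?thesis using ab l[of m] l[of n] unfolding interface_def by auto
      next
        fix m n assume "a = Inr m" "b = Inr n"
        then show ?thesis using ab r[of m] r[of n] unfolding interface_def by auto
      qed (use ab in simp_all)
    qed
  qed
qed

lemma compose_simps [simp]:
  "events (compose_aug A B C p \<phi> q) = events (left_part q) <+> events (right_part p)"
  "deseq (compose_aug A B C p \<phi> q) = sum_rel (deseq (left_part q)) (deseq (right_part p))"
  "display (compose_aug A B C p \<phi> q) (Inl m) = Inl (projl (display q m))"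
  "display (compose_aug A B C p \<phi> q) (Inr n) = Inr (projr (display p n))"
  "seq (compose_aug A B C p \<phi> q) =
     Restr ((interaction A B C p \<phi> q)\<^sup>*) (events (left_part q) <+> events (right_part p))"
  by (simp_all add: compose_aug_def Let_def)

text \<open>The relation \<open>I\<close> of the net is exactly the interaction, and removing the
  interface leaves the events of the composite. On these, \<open>q\<close> and \<open>p\<close> see
  the polarities of \<open>A \<turnstile> C\<close>: \<open>A\<close> is dualised in both arenas and
  \<open>C\<close> in neither.\<close>

theorem augmentation_compose:
  assumes arenas: "arena A" "arena B" "arena C" and neg: "negative B"
    and q: "augmentation (A \<turnstile> B) q" and p: "augmentation (B \<turnstile> C) p"
    and \<phi>: "\<phi> \<in> symmetries (right_part q) (left_part p)"
  shows "augmentation (A \<turnstile> C) (compose_aug A B C p \<phi> q)"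
proof -
  note cq = augmentation_configuration[OF q] and cp = augmentation_configuration[OF p]
  interpret N: interaction_net "events q <+> events p" "sum_rel (seq q) (seq p)"
    "sum_rel (deseq q) (deseq p)" "polarity_sum A B C p q" "interface q p" "link q \<phi>"
    by (rule interaction_net[OF assms])
  let ?V = "events (left_part q) <+> events (right_part p)"
  have V: "(events q <+> events p) - interface q p = ?V" by (auto simp: interface_def)
  have I: "N.I = interaction A B C p \<phi> q"
  proof (rule set_eqI, clarify)
    fix a b show "(a, b) \<in> N.I \<longleftrightarrow> (a, b) \<in> interaction A B C p \<phi> q"
      unfolding N.I_def
      by (cases a; cases b) (auto simp: interaction_simps interface_def link_def polarity_sum_def)
  qed
  have D: "Restr (sum_rel (deseq q) (deseq p)) ?V = sum_rel (deseq (left_part q)) (deseq (right_part p))"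
    by (auto simp: sum_rel_def)
  have "causal ?V (Restr ((interaction A B C p \<phi> q)\<^sup>*) ?V)
      (sum_rel (deseq (left_part q)) (deseq (right_part p))) (polarity_sum A B C p q)"
    using N.causal_hide unfolding V I D .
  then have "causal ?V (Restr ((interaction A B C p \<phi> q)\<^sup>*) ?V)
      (sum_rel (deseq (left_part q)) (deseq (right_part p)))
      (\<lambda>e. pol (A \<turnstile> C) (display (compose_aug A B C p \<phi> q) e))"
  proof (rule causal_cong)
    fix e assume "e \<in> ?V"
    then show "polarity_sum A B C p q e = pol (A \<turnstile> C) (display (compose_aug A B C p \<phi> q) e)"
    proof (rule PlusE)
      fix m assume m: "e = Inl m" "m \<in> events (left_part q)"
      then obtain a where "display q m = Inl a" "a \<in> moves A"
        using configuration_display[OF cq, of m] by (cases "display q m") auto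
      then show ?thesis using m by (simp add: polarity_sum_def)
    next
      fix m assume m: "e = Inr m" "m \<in> events (right_part p)"
      then obtain a where "display p m = Inr a" "a \<in> moves C"
        using configuration_display[OF cp, of m] by (cases "display p m") auto
      then show ?thesis using m by (simp add: polarity_sum_def)
    qed
  qed
  moreover have "configuration (A \<turnstile> C) (compose_aug A B C p \<phi> q)"
    by (rule configuration_sum[OF configuration_left_part[OF cq] configuration_right_part[OF cp]])
      simp_all
  ultimately show ?thesis by (simp add: augmentation_iff)
qed

section \<open>Isomorphisms of augmentations\<close>

lemma symmetriesI:
  assumes "bij_betw f (events x) (events y)"
    "\<And>m n. m \<in> events x \<Longrightarrow> n \<in> events x \<Longrightarrow> (m, n) \<in> deseq x \<longleftrightarrow> (f m, f n) \<in> deseq y"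
    "\<And>m. m \<in> events x \<Longrightarrow> display y (f m) = display x m"
  shows "restrict f (events x) \<in> symmetries x y"
  using assms unfolding symmetries_def by (auto simp: bij_betw_restrict_eq)

lemma symmetries_id: "restrict id (events x) \<in> symmetries x x"
  by (rule symmetriesI) auto

lemma symmetries_compose:
  assumes f: "f \<in> symmetries x y" and g: "g \<in> symmetries y z"
  shows "restrict (g \<circ> f) (events x) \<in> symmetries x z"
proof (rule symmetriesI)
  show "bij_betw (g \<circ> f) (events x) (events z)"
    using symmetries_bij[OF f] symmetries_bij[OF g] by (rule bij_betw_trans)
qed (simp_all add: symmetries_deseq[OF f] symmetries_deseq[OF g] symmetries_in[OF f]
    symmetries_display[OF f] symmetries_display[OF g])

lemma symmetries_inverse:
  assumes f: "f \<in> symmetries x y"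
  shows "restrict (inv_into (events x) f) (events y) \<in> symmetries y x"
proof (rule symmetriesI)
  show "bij_betw (inv_into (events x) f) (events y) (events x)"
    by (rule bij_betw_inv_into[OF symmetries_bij[OF f]])
  fix m n assume m: "m \<in> events y"
  note i = inv_symmetry[OF f m]
  show "display x (inv_into (events x) f m) = display y m"
    using symmetries_display[OF f i(1)] i(2) by simp
  assume n: "n \<in> events y"
  show "(m, n) \<in> deseq y \<longleftrightarrow> (inv_into (events x) f m, inv_into (events x) f n) \<in> deseq x"
    using symmetries_deseq[OF f i(1) inv_symmetry(1)[OF f n]] i(2) inv_symmetry(2)[OF f n] by simp
qed

lemma isomorphisms_symmetries: "f \<in> isomorphisms q p \<Longrightarrow> f \<in> symmetries q p"
  and isomorphisms_seq: "f \<in> isomorphisms q p \<Longrightarrow> m \<in> events q \<Longrightarrow> n \<in> events q \<Longrightarrow>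
    (m, n) \<in> seq q \<longleftrightarrow> (f m, f n) \<in> seq p"
  by (simp_all add: isomorphisms_def)

lemma isomorphismsI:
  assumes "f \<in> symmetries q p"
    "\<And>m n. m \<in> events q \<Longrightarrow> n \<in> events q \<Longrightarrow> (m, n) \<in> seq q \<longleftrightarrow> (f m, f n) \<in> seq p"
  shows "f \<in> isomorphisms q p"
  using assms unfolding isomorphisms_def by blast

lemma isomorphisms_id: "restrict id (events q) \<in> isomorphisms q q"
  by (rule isomorphismsI[OF symmetries_id]) simp

lemma isomorphisms_compose:
  assumes f: "f \<in> isomorphisms q p" and g: "g \<in> isomorphisms p s"
  shows "restrict (g \<circ> f) (events q) \<in> isomorphisms q s"
  by (rule isomorphismsI[OF symmetries_compose[OF isomorphisms_symmetries[OF f] isomorphisms_symmetries[OF g]]])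
    (simp add: isomorphisms_seq[OF f] isomorphisms_seq[OF g] symmetries_in[OF isomorphisms_symmetries[OF f]])

lemma isomorphisms_inverse:
  assumes f: "f \<in> isomorphisms q p"
  shows "restrict (inv_into (events q) f) (events p) \<in> isomorphisms p q"
proof (rule isomorphismsI[OF symmetries_inverse[OF isomorphisms_symmetries[OF f]]])
  note i = inv_symmetry[OF isomorphisms_symmetries[OF f]]
  fix m n assume "m \<in> events p" "n \<in> events p"
  then show "(m, n) \<in> seq p \<longleftrightarrow> (restrict (inv_into (events q) f) (events p) m,
      restrict (inv_into (events q) f) (events p) n) \<in> seq q"
    using isomorphisms_seq[OF f i(1) i(1), of m n] i(2) by simp
qed

definition isomorphic ::
  "('e, 'a) augmentation \<Rightarrow> ('f, 'a) augmentation \<Rightarrow> bool" (infix "\<simeq>" 50) where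
  "q \<simeq> p \<longleftrightarrow> isomorphisms q p \<noteq> {}"

lemma isomorphicI: "f \<in> isomorphisms q p \<Longrightarrow> q \<simeq> p"
  by (auto simp: isomorphic_def)

lemma isomorphic_trans: "q \<simeq> p \<Longrightarrow> p \<simeq> s \<Longrightarrow> q \<simeq> s"
  unfolding isomorphic_def using isomorphisms_compose by blast

lemma isomorphic_sym: "q \<simeq> p \<Longrightarrow> p \<simeq> q"
  unfolding isomorphic_def using isomorphisms_inverse by blast

section \<open>Transport along order isomorphisms\<close>

locale order_iso =
  fixes f :: "'e \<Rightarrow> 'f" and S :: "'e set" and T :: "'f set" and r r'
  assumes bij: "bij_betw f S T" and sub: "r \<subseteq> S \<times> S" and sub': "r' \<subseteq> T \<times> T"
    and iff: "a \<in> S \<Longrightarrow> b \<in> S \<Longrightarrow> (a, b) \<in> r \<longleftrightarrow> (f a, f b) \<in> r'"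
begin

lemma inj: "a \<in> S \<Longrightarrow> b \<in> S \<Longrightarrow> f a = f b \<longleftrightarrow> a = b"
  using bij by (auto simp: bij_betw_def inj_on_def)

lemma image: "f ` S = T"
  using bij by (simp add: bij_betw_def)

lemma image_eq: "r' = map_prod f f ` r"
proof (rule set_eqI, clarify)
  fix a b show "(a, b) \<in> r' \<longleftrightarrow> (a, b) \<in> map_prod f f ` r"
  proof
    assume ab: "(a, b) \<in> r'"
    then obtain x y where "x \<in> S" "y \<in> S" "a = f x" "b = f y" using sub' image by blast
    then show "(a, b) \<in> map_prod f f ` r" using ab iff by (intro image_eqI[of _ _ "(x, y)"]) auto
  next
    assume "(a, b) \<in> map_prod f f ` r"
    then show "(a, b) \<in> r'" using iff sub by auto
  qed
qed

lemma immediate: "a \<in> S \<Longrightarrow> b \<in> S \<Longrightarrow> (a, b) \<in> immediate r \<longleftrightarrow> (f a, f b) \<in> immediate r'"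
proof -
  assume ab: "a \<in> S" "b \<in> S"
  have "(\<exists>c. c \<noteq> a \<and> c \<noteq> b \<and> (a, c) \<in> r \<and> (c, b) \<in> r) \<longleftrightarrow>
    (\<exists>d. d \<noteq> f a \<and> d \<noteq> f b \<and> (f a, d) \<in> r' \<and> (d, f b) \<in> r')"
  proof
    assume "\<exists>c. c \<noteq> a \<and> c \<noteq> b \<and> (a, c) \<in> r \<and> (c, b) \<in> r"
    then obtain c where c: "c \<noteq> a" "c \<noteq> b" "(a, c) \<in> r" "(c, b) \<in> r" by blast
    moreover have "c \<in> S" using c sub by blast
    ultimately show "\<exists>d. d \<noteq> f a \<and> d \<noteq> f b \<and> (f a, d) \<in> r' \<and> (d, f b) \<in> r'"
      using ab iff inj by (intro exI[of _ "f c"]) auto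
  next
    assume "\<exists>d. d \<noteq> f a \<and> d \<noteq> f b \<and> (f a, d) \<in> r' \<and> (d, f b) \<in> r'"
    then obtain d where d: "d \<noteq> f a" "d \<noteq> f b" "(f a, d) \<in> r'" "(d, f b) \<in> r'" by blast
    moreover obtain c where "c \<in> S" "d = f c" using d sub' image by blast
    ultimately show "\<exists>c. c \<noteq> a \<and> c \<noteq> b \<and> (a, c) \<in> r \<and> (c, b) \<in> r"
      using ab iff by (intro exI[of _ c]) auto
  qed
  moreover have "(a, b) \<in> r \<longleftrightarrow> (f a, f b) \<in> r'" "a \<noteq> b \<longleftrightarrow> f a \<noteq> f b" using ab iff inj by auto
  ultimately show ?thesis by (simp only: immediate_def mem_Collect_eq case_prod_conv)
qed

lemma minimal: "a \<in> S \<Longrightarrow> minimal_in S r a \<longleftrightarrow> minimal_in T r' (f a)"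
  using iff inj unfolding minimal_in_def image[symmetric] by auto

lemma maximal: "a \<in> S \<Longrightarrow> maximal_in S r a \<longleftrightarrow> maximal_in T r' (f a)"
  using iff inj unfolding maximal_in_def image[symmetric] by auto

lemma forest:
  assumes F: "forest S r"
  shows "forest T r'"
proof (rule forestI)
  show "r' \<subseteq> T \<times> T" by (rule sub')
  show "(a, a) \<in> r'" if "a \<in> T" for a
    using that forest_refl[OF F] iff unfolding image[symmetric] by auto
  have lift: "\<exists>x y. x \<in> S \<and> y \<in> S \<and> a = f x \<and> b = f y \<and> (x, y) \<in> r" if "(a, b) \<in> r'" for a b
    using that sub unfolding image_eq by auto
  show "(a, c) \<in> r'" if ab: "(a, b) \<in> r'" "(b, c) \<in> r'" for a b c
  proof -
    obtain x y where 1: "x \<in> S" "y \<in> S" "a = f x" "b = f y" "(x, y) \<in> r" using lift[OF ab(1)] by blast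
    obtain y' z where 2: "y' \<in> S" "z \<in> S" "b = f y'" "c = f z" "(y', z) \<in> r" using lift[OF ab(2)] by blast
    have "y = y'" using 1 2 inj by metis
    then have "(x, z) \<in> r" using forest_trans[OF F 1(5)] 2 by simp
    then show ?thesis using 1 2 iff by simp
  qed
  show "a = b" if ab: "(a, b) \<in> r'" "(b, a) \<in> r'" for a b
  proof -
    obtain x y where 1: "x \<in> S" "y \<in> S" "a = f x" "b = f y" "(x, y) \<in> r" using lift[OF ab(1)] by blast
    then have "(y, x) \<in> r" using ab(2) iff by simp
    then show ?thesis using forest_antisym[OF F 1(5)] 1 by simp
  qed
  show "finite {b. (b, a) \<in> r'}" if "a \<in> T" for a
  proof -
    obtain x where x: "x \<in> S" "a = f x" using \<open>a \<in> T\<close> image by blast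
    have "{b. (b, a) \<in> r'} \<subseteq> f ` {y. (y, x) \<in> r}"
    proof clarify
      fix b assume "(b, a) \<in> r'"
      then obtain y z where yz: "y \<in> S" "z \<in> S" "b = f y" "a = f z" "(y, z) \<in> r" using lift by blast
      then have "z = x" using x inj by metis
      then show "b \<in> f ` {y. (y, x) \<in> r}" using yz by blast
    qed
    then show ?thesis using forest_finite[OF F, of x] by (rule finite_surj[rotated])
  qed
  show "(b, c) \<in> r' \<or> (c, b) \<in> r'" if ab: "(b, a) \<in> r'" "(c, a) \<in> r'" for a b c
  proof -
    obtain x y where 1: "x \<in> S" "y \<in> S" "b = f x" "a = f y" "(x, y) \<in> r" using lift[OF ab(1)] by blast
    obtain z y' where 2: "z \<in> S" "y' \<in> S" "c = f z" "a = f y'" "(z, y') \<in> r" using lift[OF ab(2)] by blast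
    have "y = y'" using 1 2 inj by metis
    then have "(x, z) \<in> r \<or> (z, x) \<in> r" using forest_total[OF F 1(5)] 2 by simp
    then show ?thesis using 1 2 iff by simp
  qed
qed

lemma rtrancl_iff:
  assumes "a \<in> S" "b \<in> S"
  shows "(a, b) \<in> r\<^sup>* \<longleftrightarrow> (f a, f b) \<in> r'\<^sup>*"
proof
  assume "(a, b) \<in> r\<^sup>*"
  then show "(f a, f b) \<in> r'\<^sup>*"
  proof induction
    case (step y z)
    then have "(f y, f z) \<in> r'" using sub iff by blast
    with step.IH show ?case by (rule rtrancl_into_rtrancl)
  qed simp
next
  have "\<exists>z\<in>S. y = f z \<and> (a, z) \<in> r\<^sup>*" if "(f a, y) \<in> r'\<^sup>*" for y
    using that
  proof induction
    case base
    then show ?case using assms by blast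
  next
    case (step y w)
    then obtain z where z: "z \<in> S" "y = f z" "(a, z) \<in> r\<^sup>*" by blast
    obtain v where v: "v \<in> S" "w = f v" using step.hyps(2) sub' image by blast
    then have "(z, v) \<in> r" using step.hyps(2) z iff by simp
    then show ?case using z v by (blast intro: rtrancl_into_rtrancl)
  qed
  moreover assume "(f a, f b) \<in> r'\<^sup>*"
  ultimately obtain z where z: "z \<in> S" "f b = f z" "(a, z) \<in> r\<^sup>*" by blast
  then have "b = z" using inj assms by simp
  then show "(a, b) \<in> r\<^sup>*" using z by simp
qed

end

text \<open>An isomorphism constrains the relations of \<open>p\<close> on its events only, which is
  why the two inclusions are assumed. With them, the orders of \<open>p\<close> are exact images of
  those of \<open>q\<close>, and every condition transfers.\<close>

lemma augmentation_transport:
  assumes q: "augmentation A q" and f: "f \<in> isomorphisms q p"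
    and deseq: "deseq p \<subseteq> events p \<times> events p" and seq: "seq p \<subseteq> events p \<times> events p"
  shows "augmentation A p"
proof -
  note c = augmentation_configuration[OF q] and k = augmentation_causal[OF q]
  note sym = isomorphisms_symmetries[OF f]
  note disp = symmetries_display[OF sym]
  have sub: "deseq q \<subseteq> events q \<times> events q" "seq q \<subseteq> events q \<times> events q"
    using forest_subset[OF configuration_forest[OF c]] forest_subset[OF causal_forest[OF k]] by auto
  interpret D: order_iso f "events q" "events p" "deseq q" "deseq p"
    by (rule order_iso.intro[OF symmetries_bij[OF sym] sub(1) deseq symmetries_deseq[OF sym]])
  interpret S: order_iso f "events q" "events p" "seq q" "seq p"
    by (rule order_iso.intro[OF symmetries_bij[OF sym] sub(2) seq isomorphisms_seq[OF f]])
  have lift: "\<exists>x y. x \<in> events q \<and> y \<in> events q \<and> a = f x \<and> b = f y \<and> (x, y) \<in> immediate (seq q)"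
    if ab: "(a, b) \<in> immediate (seq p)" for a b
  proof -
    have "a \<in> events p" "b \<in> events p" using immediateD[OF ab] seq by auto
    then obtain x y where "x \<in> events q" "y \<in> events q" "a = f x" "b = f y" using S.image by blast
    then show ?thesis using S.immediate[of x y] ab by blast
  qed
  have liftd: "\<exists>x y. x \<in> events q \<and> y \<in> events q \<and> a = f x \<and> b = f y \<and> (x, y) \<in> immediate (deseq q)"
    if ab: "(a, b) \<in> immediate (deseq p)" for a b
  proof -
    have "a \<in> events p" "b \<in> events p" using immediateD[OF ab] deseq by auto
    then obtain x y where "x \<in> events q" "y \<in> events q" "a = f x" "b = f y" using S.image by blast
    then show ?thesis using D.immediate[of x y] ab by blast
  qed
  have lifte: "\<exists>x\<in>events q. a = f x" if "a \<in> events p" for a using that S.image by blast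
  have "configuration A p"
  proof (rule configurationI)
    show "finite (events p)" using configuration_finite[OF c] bij_betw_finite[OF S.bij] by simp
    show "forest (events p) (deseq p)" by (rule D.forest[OF configuration_forest[OF c]])
    show "display p a \<in> moves A" if a: "a \<in> events p" for a
      using lifte[OF a] disp configuration_display[OF c] by auto
    show "minimal_in (events p) (deseq p) a \<longleftrightarrow> minimal_in (moves A) (arena_le A) (display p a)"
      if a: "a \<in> events p" for a
      using lifte[OF a] disp configuration_minimal[OF c] D.minimal by auto
    show "(display p a, display p b) \<in> immediate (arena_le A)" if ab: "(a, b) \<in> immediate (deseq p)" for a b
      using liftd[OF ab] disp configuration_immediate[OF c] by auto
  qed
  moreover have "causal (events p) (seq p) (deseq p) (\<lambda>e. pol A (display p e))"
    unfolding causal_def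
  proof (intro conjI allI impI; (elim conjE)?)
    show "forest (events p) (seq p)" by (rule S.forest[OF causal_forest[OF k]])
    show "deseq p \<subseteq> seq p" unfolding D.image_eq S.image_eq using causal_static[OF k] by auto
    show "(a, b) \<in> immediate (deseq p)"
      if ab: "(a, b) \<in> immediate (seq p)" "pol A (display p a) = Pos \<or> pol A (display p b) = Neg" for a b
    proof -
      obtain x y where xy: "x \<in> events q" "y \<in> events q" "a = f x" "b = f y" "(x, y) \<in> immediate (seq q)"
        using lift[OF ab(1)] by blast
      then have "(x, y) \<in> immediate (deseq q)" using causal_immediate[OF k xy(5)] ab(2) disp by simp
      then show ?thesis using D.immediate xy by simp
    qed
    show "b = c" if ab: "(a, b) \<in> immediate (seq p)" "(a, c) \<in> immediate (seq p)"
      "pol A (display p a) = Neg" "pol A (display p b) = Pos" "pol A (display p c) = Pos" for a b c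
    proof -
      obtain x y where xy: "x \<in> events q" "y \<in> events q" "a = f x" "b = f y" "(x, y) \<in> immediate (seq q)"
        using lift[OF ab(1)] by blast
      obtain x' z where xz: "x' \<in> events q" "z \<in> events q" "a = f x'" "c = f z" "(x', z) \<in> immediate (seq q)"
        using lift[OF ab(2)] by blast
      have "x' = x" using xy xz S.inj by metis
      then show ?thesis using causal_unique[OF k xy(5), of z] xy xz ab(3-5) disp by simp
    qed
    show "pol A (display p a) = Pos" if a: "maximal_in (events p) (seq p) a" for a
    proof -
      obtain x where "x \<in> events q" "a = f x" using lifte[of a] a by (auto simp: maximal_in_def)
      then show ?thesis using causal_maximal[OF k, of x] S.maximal[of x] a disp by simp
    qed
    show "pol A (display p a) = Neg" if a: "minimal_in (events p) (seq p) a" for a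
    proof -
      obtain x where "x \<in> events q" "a = f x" using lifte[of a] a by (auto simp: minimal_in_def)
      then show ?thesis using causal_minimal[OF k, of x] S.minimal[of x] a disp by simp
    qed
  qed
  ultimately show ?thesis by (simp add: augmentation_iff)
qed

text \<open>A finite event set embeds in the natural numbers. Composites have events in a sum type,
  so this is what makes their classes inhabited.\<close>

lemma augmentation_nat_copy:
  fixes q :: "('e, 'a) augmentation"
  assumes q: "augmentation A q"
  obtains p :: "(nat, 'a) augmentation" where "augmentation A p" "q \<simeq> p"
proof -
  note c = augmentation_configuration[OF q] and k = augmentation_causal[OF q]
  obtain f :: "'e \<Rightarrow> nat" where f: "inj_on f (events q)"
    using finite_imp_inj_to_nat_seg[OF configuration_finite[OF c]] by blast
  define p :: "(nat, 'a) augmentation" where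
    "p = \<lparr>events = f ` events q, deseq = map_prod f f ` deseq q,
          display = display q \<circ> inv_into (events q) f, seq = map_prod f f ` seq q\<rparr>"
  have inj: "f a = f b \<longleftrightarrow> a = b" if "a \<in> events q" "b \<in> events q" for a b
    using f that by (auto simp: inj_on_def)
  have iff: "(a, b) \<in> r \<longleftrightarrow> (f a, f b) \<in> map_prod f f ` r"
    if ab: "a \<in> events q" "b \<in> events q" "r \<subseteq> events q \<times> events q" for a b r
  proof
    assume "(f a, f b) \<in> map_prod f f ` r"
    then obtain x y where xy: "(x, y) \<in> r" "f a = f x" "f b = f y" by auto
    then have "a = x" "b = y" using ab inj[of a x] inj[of b y] by auto
    then show "(a, b) \<in> r" using xy by simp
  qed auto
  have sub: "deseq q \<subseteq> events q \<times> events q" "seq q \<subseteq> events q \<times> events q"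
    using forest_subset[OF configuration_forest[OF c]] forest_subset[OF causal_forest[OF k]] by auto
  have sym: "restrict f (events q) \<in> symmetries q p"
    by (rule symmetriesI) (use f sub iff in \<open>auto simp: p_def bij_betw_def\<close>)
  have iso: "restrict f (events q) \<in> isomorphisms q p"
    by (rule isomorphismsI[OF sym]) (use iff[OF _ _ sub(2)] in \<open>auto simp: p_def\<close>)
  have "augmentation A p"
    by (rule augmentation_transport[OF q iso]) (use sub in \<open>auto simp: p_def\<close>)
  then show ?thesis using that isomorphicI[OF iso] by blast
qed

section \<open>Isogmentations, their representatives and their components\<close>

lemma isog_of_iff: "p \<in> isog_of A q \<longleftrightarrow> augmentation A p \<and> q \<simeq> p"
  by (simp add: isog_of_def isomorphic_def)

lemma isog_of_cong:
  assumes "q \<simeq> p"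
  shows "isog_of A q = isog_of A p"
  using isomorphic_trans[OF assms] isomorphic_trans[OF isomorphic_sym[OF assms]]
  by (intro set_eqI) (auto simp: isog_of_iff)

text \<open>Equal classes share a member, because the class of an augmentation is inhabited, and the
  isomorphism passes through it. The two event types may differ, as they do for a composite and a
  representative.\<close>

lemma isog_of_eq_iff:
  fixes q :: "('e, 'a) augmentation" and p :: "('f, 'a) augmentation"
  assumes "augmentation A q" "augmentation A p"
  shows "isog_of A q = isog_of A p \<longleftrightarrow> q \<simeq> p"
proof
  assume eq: "isog_of A q = isog_of A p"
  obtain s :: "(nat, 'a) augmentation" where s: "augmentation A s" "q \<simeq> s"
    using augmentation_nat_copy[OF assms(1)] by blast
  then have "s \<in> isog_of A p" unfolding eq[symmetric] by (simp add: isog_of_iff)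
  then show "q \<simeq> p" using s isomorphic_trans[OF s(2) isomorphic_sym] by (simp add: isog_of_iff)
qed (rule isog_of_cong)

lemma isog_of_Isog:
  assumes "augmentation A q"
  shows "isog_of A q \<in> Isog A"
proof -
  obtain s :: "(nat, 'a) augmentation" where s: "augmentation A s" "q \<simeq> s"
    using augmentation_nat_copy[OF assms] by blast
  then have "isog_of A q = isog_of A s" using isog_of_eq_iff[OF assms s(1)] by simp
  then show ?thesis using s(1) by (auto simp: Isog_def)
qed

lemma representative_isog_of:
  assumes "augmentation A q"
  shows "augmentation A (representative (isog_of A q))" "q \<simeq> representative (isog_of A q)"
proof -
  obtain s :: "(nat, 'a) augmentation" where "augmentation A s" "q \<simeq> s"
    using augmentation_nat_copy[OF assms] by blast
  then have "s \<in> isog_of A q" by (simp add: isog_of_iff)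
  then have "representative (isog_of A q) \<in> isog_of A q"
    unfolding representative_def by (rule someI)
  then show "augmentation A (representative (isog_of A q))" "q \<simeq> representative (isog_of A q)"
    by (simp_all add: isog_of_iff)
qed

lemma representative_Isog:
  assumes "Q \<in> Isog A"
  shows "augmentation A (representative Q)" "isog_of A (representative Q) = Q"
proof -
  obtain q :: "(nat, 'a) augmentation" where q: "augmentation A q" "Q = isog_of A q"
    using assms by (auto simp: Isog_def)
  show *: "augmentation A (representative Q)" using representative_isog_of(1)[OF q(1)] q(2) by simp
  have "q \<simeq> representative Q" using representative_isog_of(2)[OF q(1)] q(2) by simp
  then show "isog_of A (representative Q) = Q"
    using isog_of_eq_iff[OF q(1) *] q(2) by simp
qed

lemma bij_betw_display:
  assumes f: "f \<in> symmetries q p"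
  shows "bij_betw f {m \<in> events q. K (display q m)} {m \<in> events p. K (display p m)}"
  unfolding bij_betw_def
proof
  have img: "f ` events q = events p" "inj_on f (events q)"
    using symmetries_bij[OF f] by (auto simp: bij_betw_def)
  show "inj_on f {m \<in> events q. K (display q m)}" using img(2) by (rule inj_on_subset) auto
  show "f ` {m \<in> events q. K (display q m)} = {m \<in> events p. K (display p m)}"
  proof (intro equalityI subsetI)
    fix n assume n: "n \<in> {m \<in> events p. K (display p m)}"
    then obtain m where m: "m \<in> events q" "n = f m" using img(1) by blast
    then have "K (display q m)" using n symmetries_display[OF f m(1)] by simp
    then show "n \<in> f ` {m \<in> events q. K (display q m)}" using m by blast
  qed (use symmetries_display[OF f] symmetries_in[OF f] in auto)
qed

lemma isomorphisms_parts:
  assumes "f \<in> isomorphisms q p"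
  shows isomorphisms_left_part:
      "restrict f (events (left_part q)) \<in> symmetries (left_part q) (left_part p)"
    and isomorphisms_right_part:
      "restrict f (events (right_part q)) \<in> symmetries (right_part q) (right_part p)"
proof -
  note s = isomorphisms_symmetries[OF assms]
  show "restrict f (events (left_part q)) \<in> symmetries (left_part q) (left_part p)"
  proof (rule symmetriesI)
    show "bij_betw f (events (left_part q)) (events (left_part p))"
      using bij_betw_display[OF s, of isl] by simp
  qed (use symmetries_deseq[OF s] symmetries_display[OF s] symmetries_in[OF s] in simp_all)
  show "restrict f (events (right_part q)) \<in> symmetries (right_part q) (right_part p)"
  proof (rule symmetriesI)
    show "bij_betw f (events (right_part q)) (events (right_part p))"
      using bij_betw_display[OF s, of "\<lambda>d. \<not> isl d"] by simp
  qed (use symmetries_deseq[OF s] symmetries_display[OF s] symmetries_in[OF s] in simp_all)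
qed

section \<open>Invariance and associativity of composition\<close>

lemma inv_symmetry_eq_iff:
  assumes "\<phi> \<in> symmetries x y" "n \<in> events y"
  shows "m = inv_into (events x) \<phi> n \<longleftrightarrow> m \<in> events x \<and> \<phi> m = n"
  using inv_symmetry[OF assms] inv_symmetry_left[OF assms(1), of m] by auto

lemma bij_betw_map_sum:
  assumes "bij_betw f S S'" "bij_betw g T T'"
  shows "bij_betw (map_sum f g) (S <+> T) (S' <+> T')"
  unfolding bij_betw_def
proof
  show "inj_on (map_sum f g) (S <+> T)"
  proof (rule inj_onI)
    fix a b assume "a \<in> S <+> T" "b \<in> S <+> T" "map_sum f g a = map_sum f g b"
    then show "a = b"
      using bij_betw_imp_inj_on[OF assms(1)] bij_betw_imp_inj_on[OF assms(2)]
      by (cases a; cases b) (simp_all add: inj_on_eq_iff)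
  qed
  show "map_sum f g ` (S <+> T) = S' <+> T'"
    using assms by (auto simp: bij_betw_def Plus_def image_Un image_image)
qed

lemma augmentation_subset:
  assumes "augmentation A q"
  shows "deseq q \<subseteq> events q \<times> events q" "seq q \<subseteq> events q \<times> events q"
  using forest_subset[OF configuration_forest[OF augmentation_configuration[OF assms]]]
    forest_subset[OF causal_forest[OF augmentation_causal[OF assms]]] by auto

lemma interaction_subset:
  assumes "augmentation (A \<turnstile> B) q" "augmentation (B \<turnstile> C) p"
    "\<phi> \<in> symmetries (right_part q) (left_part p)"
  shows "interaction A B C p \<phi> q \<subseteq> (events q <+> events p) \<times> (events q <+> events p)"
proof (rule subrelI)
  fix a b assume ab: "(a, b) \<in> interaction A B C p \<phi> q"
  show "(a, b) \<in> (events q <+> events p) \<times> (events q <+> events p)"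
  proof (cases a; cases b)
    fix m n assume "a = Inl m" "b = Inr n"
    then show ?thesis using ab symmetries_in[OF assms(3), of m] by (simp add: interaction_simps)
  next
    fix m n assume "a = Inr m" "b = Inl n"
    then show ?thesis using ab inv_symmetry(1)[OF assms(3), of m] by (simp add: interaction_simps)
  qed (use ab augmentation_subset[OF assms(1)] augmentation_subset[OF assms(2)] in
      \<open>auto simp: interaction_simps\<close>)
qed

text \<open>\<open>map_sum \<alpha> \<beta>\<close> preserves the edges inside either augmentation
  because \<open>\<alpha>\<close> and \<open>\<beta>\<close> are isomorphisms, and the links because
  of \<open>square\<close>. An isomorphism of generating relations is one of their closures, and
  this one takes visible events to visible events.\<close>

theorem compose_isomorphic:
  assumes q: "augmentation (A \<turnstile> B) q" and q': "augmentation (A \<turnstile> B) q'"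
    and p: "augmentation (B \<turnstile> C) p" and p': "augmentation (B \<turnstile> C) p'"
    and \<alpha>: "\<alpha> \<in> isomorphisms q q'" and \<beta>: "\<beta> \<in> isomorphisms p p'"
    and \<phi>: "\<phi> \<in> symmetries (right_part q) (left_part p)"
    and \<phi>': "\<phi>' \<in> symmetries (right_part q') (left_part p')"
    and square: "\<And>m. m \<in> events (right_part q) \<Longrightarrow> \<phi>' (\<alpha> m) = \<beta> (\<phi> m)"
  shows "compose_aug A B C p \<phi> q \<simeq> compose_aug A B C p' \<phi>' q'"
proof -
  note sa = isomorphisms_symmetries[OF \<alpha>] and sb = isomorphisms_symmetries[OF \<beta>]
  note da = symmetries_display[OF sa] and db = symmetries_display[OF sb]
  have inj: "\<alpha> m = \<alpha> n \<longleftrightarrow> m = n" if "m \<in> events q" "n \<in> events q" for m n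
    using symmetries_bij[OF sa] that by (auto simp: bij_betw_def inj_on_def)
  have injb: "\<beta> m = \<beta> n \<longleftrightarrow> m = n" if "m \<in> events p" "n \<in> events p" for m n
    using symmetries_bij[OF sb] that by (auto simp: bij_betw_def inj_on_def)
  have right: "\<alpha> m \<in> events (right_part q') \<longleftrightarrow> m \<in> events (right_part q)" if "m \<in> events q" for m
    using that da[OF that] symmetries_in[OF sa that] by simp
  have left: "\<beta> m \<in> events (left_part p') \<longleftrightarrow> m \<in> events (left_part p)" if "m \<in> events p" for m
    using that db[OF that] symmetries_in[OF sb that] by simp
  let ?g = "map_sum \<alpha> \<beta>"
  interpret O: order_iso ?g "events q <+> events p" "events q' <+> events p'"
    "interaction A B C p \<phi> q" "interaction A B C p' \<phi>' q'"
  proof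
    show "bij_betw ?g (events q <+> events p) (events q' <+> events p')"
      using bij_betw_map_sum symmetries_bij[OF sa] symmetries_bij[OF sb] .
    show "interaction A B C p \<phi> q \<subseteq> (events q <+> events p) \<times> (events q <+> events p)"
      by (rule interaction_subset[OF q p \<phi>])
    show "interaction A B C p' \<phi>' q' \<subseteq> (events q' <+> events p') \<times> (events q' <+> events p')"
      by (rule interaction_subset[OF q' p' \<phi>'])
    fix a b assume ab: "a \<in> events q <+> events p" "b \<in> events q <+> events p"
    show "(a, b) \<in> interaction A B C p \<phi> q \<longleftrightarrow> (?g a, ?g b) \<in> interaction A B C p' \<phi>' q'"
    proof (cases a; cases b)
      fix m n assume mn: "a = Inl m" "b = Inl n"
      then show ?thesis using ab inj[of m n] isomorphisms_seq[OF \<alpha>, of m n]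
        by (simp add: interaction_simps)
    next
      fix m n assume mn: "a = Inr m" "b = Inr n"
      then show ?thesis using ab injb[of m n] isomorphisms_seq[OF \<beta>, of m n]
        by (simp add: interaction_simps)
    next
      fix m n assume mn: "a = Inl m" "b = Inr n"
      then have m: "m \<in> events q" "n \<in> events p" using ab by auto
      show ?thesis
      proof (cases "m \<in> events (right_part q)")
        case True
        then have "\<phi> m \<in> events p" using symmetries_in[OF \<phi> True] by simp
        then have "\<beta> n = \<phi>' (\<alpha> m) \<longleftrightarrow> n = \<phi> m" using square[OF True] injb[of n "\<phi> m"] m by simp
        then show ?thesis using mn m True right[OF m(1)] da[OF m(1)] by (simp add: interaction_simps)
      next
        case False
        then have "\<alpha> m \<notin> events (right_part q')" using right[OF m(1)] by blast
        then show ?thesis using mn False by (simp only: interaction_simps map_sum.simps simp_thms)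
      qed
    next
      fix n m assume mn: "a = Inr n" "b = Inl m"
      then have m: "m \<in> events q" "n \<in> events p" using ab by auto
      show ?thesis
      proof (cases "n \<in> events (left_part p)")
        case True
        then have n': "\<beta> n \<in> events (left_part p')" using left[OF m(2)] by blast
        have "\<phi> m \<in> events p" if "m \<in> events (right_part q)" using symmetries_in[OF \<phi> that] by simp
        then have "(\<alpha> m \<in> events (right_part q') \<and> \<phi>' (\<alpha> m) = \<beta> n) \<longleftrightarrow>
            (m \<in> events (right_part q) \<and> \<phi> m = n)"
          using square[of m] injb[of "\<phi> m" n] m right[OF m(1)] by metis
        then have "\<alpha> m = inv_into (events (right_part q')) \<phi>' (\<beta> n) \<longleftrightarrow>
            m = inv_into (events (right_part q)) \<phi> n"
          by (simp only: inv_symmetry_eq_iff[OF \<phi> True] inv_symmetry_eq_iff[OF \<phi>' n'])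
        then show ?thesis using mn True n' db[OF m(2)]
          by (simp only: interaction_simps map_sum.simps simp_thms)
      next
        case False
        then have "\<beta> n \<notin> events (left_part p')" using left[OF m(2)] by blast
        then show ?thesis using mn False by (simp only: interaction_simps map_sum.simps simp_thms)
      qed
    qed
  qed
  let ?V = "events (left_part q) <+> events (right_part p)"
  have bij: "bij_betw ?g (events (compose_aug A B C p \<phi> q)) (events (compose_aug A B C p' \<phi>' q'))"
    using bij_betw_map_sum[OF bij_betw_display[OF sa, of isl] bij_betw_display[OF sb, of "\<lambda>d. \<not> isl d"]]
    by simp
  have sym: "restrict ?g (events (compose_aug A B C p \<phi> q)) \<in>
      symmetries (compose_aug A B C p \<phi> q) (compose_aug A B C p' \<phi>' q')"
  proof (rule symmetriesI[OF bij])
    fix a assume a: "a \<in> events (compose_aug A B C p \<phi> q)"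
    show "display (compose_aug A B C p' \<phi>' q') (?g a) = display (compose_aug A B C p \<phi> q) a"
      using a da db by auto
    fix b assume b: "b \<in> events (compose_aug A B C p \<phi> q)"
    show "(a, b) \<in> deseq (compose_aug A B C p \<phi> q) \<longleftrightarrow>
        (?g a, ?g b) \<in> deseq (compose_aug A B C p' \<phi>' q')"
      using a b symmetries_deseq[OF sa] symmetries_deseq[OF sb] da db symmetries_in[OF sa]
        symmetries_in[OF sb] by (cases a; cases b) simp_all
  qed
  show ?thesis
  proof (rule isomorphicI[OF isomorphismsI[OF sym]])
    fix a b assume ab: "a \<in> events (compose_aug A B C p \<phi> q)" "b \<in> events (compose_aug A B C p \<phi> q)"
    then have "a \<in> events q <+> events p" "b \<in> events q <+> events p"
      "?g a \<in> events (compose_aug A B C p' \<phi>' q')" "?g b \<in> events (compose_aug A B C p' \<phi>' q')"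
      using bij_betwE[OF bij] by auto
    then show "(a, b) \<in> seq (compose_aug A B C p \<phi> q) \<longleftrightarrow>
        (restrict ?g (events (compose_aug A B C p \<phi> q)) a,
         restrict ?g (events (compose_aug A B C p \<phi> q)) b) \<in> seq (compose_aug A B C p' \<phi>' q')"
      using ab O.rtrancl_iff[of a b] by simp
  qed
qed

text \<open>In the application \<open>W\<close> carries the inner interaction \<open>K\<close>,
  \<open>Z\<close> consists of its visible events, and the outer edges \<open>L\<close> meet
  \<open>W\<close> only inside \<open>Z\<close>. The \<open>L\<close>-edges cut a path over
  \<open>K \<union> L\<close> into \<open>K\<close>-segments with visible ends, and each such
  segment is trivial or a single edge of the hidden order.\<close>

lemma rtrancl_hide:
  assumes K: "K \<subseteq> W \<times> W" and Z: "Z \<subseteq> W"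
    and L: "\<And>a b. (a, b) \<in> L \<Longrightarrow> (a \<in> W \<longrightarrow> a \<in> Z) \<and> (b \<in> W \<longrightarrow> b \<in> Z)"
    and u: "u \<in> W \<Longrightarrow> u \<in> Z" and v: "v \<in> W \<Longrightarrow> v \<in> Z"
  shows "(u, v) \<in> ({(a, b) \<in> Restr (K\<^sup>*) Z. a \<noteq> b} \<union> L)\<^sup>* \<longleftrightarrow> (u, v) \<in> (K \<union> L)\<^sup>*"
    (is "_ \<in> ?I\<^sup>* \<longleftrightarrow> _")
proof
  have "K\<^sup>* \<subseteq> (K \<union> L)\<^sup>*" by (rule rtrancl_mono) simp
  then have "?I \<subseteq> (K \<union> L)\<^sup>*" by auto
  then have "?I\<^sup>* \<subseteq> (K \<union> L)\<^sup>*" by (rule rtrancl_subset_rtrancl)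
  moreover assume "(u, v) \<in> ?I\<^sup>*"
  ultimately show "(u, v) \<in> (K \<union> L)\<^sup>*" ..
next
  have Zstep: "(u, y) \<in> ?I\<^sup>*" if "z \<in> Z" "y \<in> Z" "(u, z) \<in> ?I\<^sup>*" "(z, y) \<in> K\<^sup>*" for z y
  proof (cases "z = y")
    case False
    then have "(z, y) \<in> ?I" using that by simp
    with that(3) show ?thesis by (rule rtrancl_into_rtrancl)
  qed (use that in simp)
  assume "(u, v) \<in> (K \<union> L)\<^sup>*"
  \<comment> \<open>Invariant along the path: inside \<open>W\<close>, the current event is joined
    by a \<open>K\<close>-path to a visible event that the hidden relation already reaches.\<close>
  then have "(v \<notin> W \<and> (u, v) \<in> ?I\<^sup>*) \<or> (v \<in> W \<and> (\<exists>z\<in>Z. (u, z) \<in> ?I\<^sup>* \<and> (z, v) \<in> K\<^sup>*))"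
  proof induction
    case base
    then show ?case using u by auto
  next
    case (step x y)
    show ?case
    proof (cases "(x, y) \<in> K")
      case True
      then have "x \<in> W" "y \<in> W" using K by auto
      then show ?thesis using step.IH True by (meson rtrancl_into_rtrancl)
    next
      case False
      then have xy: "(x, y) \<in> L" using step.hyps by simp
      have "(u, x) \<in> ?I\<^sup>*" using step.IH L[OF xy] Zstep by blast
      moreover have "(x, y) \<in> ?I" using xy by simp
      ultimately have "(u, y) \<in> ?I\<^sup>*" by (rule rtrancl_into_rtrancl)
      then show ?thesis using L[OF xy] by blast
    qed
  qed
  then show "(u, v) \<in> ?I\<^sup>*" using v Zstep by blast
qed

lemma rtrancl_map_prod: "inj f \<Longrightarrow> (f a, f b) \<in> (map_prod f f ` r)\<^sup>* \<longleftrightarrow> (a, b) \<in> r\<^sup>*"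
proof -
  assume f: "inj f"
  interpret order_iso f UNIV "range f" r "map_prod f f ` r"
  proof
    show "(a, b) \<in> r \<longleftrightarrow> (f a, f b) \<in> map_prod f f ` r" for a b
      using f by (auto simp: inj_on_def)
  qed (use f in \<open>auto simp: bij_betw_def\<close>)
  show ?thesis using rtrancl_iff by simp
qed

text \<open>The right part of a composite consists of \<open>Inr\<close> copies of the right part of
  its second factor; through this identification a symmetry \<open>\<psi>\<close> out of the factor
  becomes one out of the composite.\<close>

definition lift_right ::
  "('e + 'f, 'a + 'c) augmentation \<Rightarrow> ('f \<Rightarrow> 'g) \<Rightarrow> 'e + 'f \<Rightarrow> 'g" where
  "lift_right r \<psi> = restrict (\<lambda>e. \<psi> (projr e)) (events (right_part r))"

definition lift_left :: "('e, 'a + 'b) augmentation \<Rightarrow> ('e \<Rightarrow> 'f) \<Rightarrow> 'e \<Rightarrow> 'f + 'g" where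
  "lift_left q \<phi> = restrict (\<lambda>m. Inl (\<phi> m)) (events (right_part q))"

lemma compose_parts:
  "events (right_part (compose_aug A B C p \<phi> q)) = Inr ` events (right_part p)"
  "events (left_part (compose_aug A B C p \<phi> q)) = Inl ` events (left_part q)"
  by auto

lemma lift_right_symmetry:
  assumes \<psi>: "\<psi> \<in> symmetries (right_part p) y"
  shows "lift_right (compose_aug A B C p \<phi> q) \<psi> \<in> symmetries (right_part (compose_aug A B C p \<phi> q)) y"
  unfolding lift_right_def
proof (rule symmetriesI)
  let ?r = "compose_aug A B C p \<phi> q"
  have "bij_betw (\<psi> \<circ> projr) (events (right_part ?r)) (events y)"
    unfolding compose_parts
    by (rule bij_betw_trans[OF _ symmetries_bij[OF \<psi>]]) (auto simp: bij_betw_def inj_on_def image_image)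
  then show "bij_betw (\<lambda>e. \<psi> (projr e)) (events (right_part ?r)) (events y)" by (simp add: comp_def)
  fix e assume e: "e \<in> events (right_part ?r)"
  then obtain m where m: "e = Inr m" "m \<in> events (right_part p)" unfolding compose_parts by blast
  show "display y (\<psi> (projr e)) = display (right_part ?r) e" using symmetries_display[OF \<psi> m(2)] m(1) by simp
  fix e' assume "e' \<in> events (right_part ?r)"
  then obtain n where n: "e' = Inr n" "n \<in> events (right_part p)" unfolding compose_parts by blast
  show "(e, e') \<in> deseq (right_part ?r) \<longleftrightarrow> (\<psi> (projr e), \<psi> (projr e')) \<in> deseq y"
    using symmetries_deseq[OF \<psi> m(2) n(2)] m n by simp
qed

lemma lift_left_symmetry:
  assumes \<phi>: "\<phi> \<in> symmetries (right_part q) (left_part p)"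
  shows "lift_left q \<phi> \<in> symmetries (right_part q) (left_part (compose_aug B C D s \<psi> p))"
  unfolding lift_left_def
proof (rule symmetriesI)
  let ?r = "compose_aug B C D s \<psi> p"
  have "bij_betw (Inl \<circ> \<phi>) (events (right_part q)) (events (left_part ?r))"
    unfolding compose_parts
    by (rule bij_betw_trans[OF symmetries_bij[OF \<phi>]]) (auto simp: bij_betw_def inj_on_def)
  then show "bij_betw (\<lambda>m. Inl (\<phi> m)) (events (right_part q)) (events (left_part ?r))" by (simp add: comp_def)
  fix m assume m: "m \<in> events (right_part q)"
  show "display (left_part ?r) (Inl (\<phi> m)) = display (right_part q) m"
    using symmetries_display[OF \<phi> m] by simp
  fix n assume n: "n \<in> events (right_part q)"
  show "(m, n) \<in> deseq (right_part q) \<longleftrightarrow> (Inl (\<phi> m), Inl (\<phi> n)) \<in> deseq (left_part ?r)"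
    using symmetries_deseq[OF \<phi> m n] symmetries_in[OF \<phi> m] symmetries_in[OF \<phi> n] by simp
qed

text \<open>Each nested composite is the restriction of an inner interaction, and the outer links only
  touch its visible events; so both composites are restrictions of a three-part interaction.\<close>

theorem compose_associative:
  fixes q :: "('e, 'a + 'b) augmentation" and p :: "('f, 'b + 'c) augmentation"
    and s :: "('g, 'c + 'd) augmentation"
  assumes q: "augmentation (A \<turnstile> B) q" and p: "augmentation (B \<turnstile> C) p" and s: "augmentation (C \<turnstile> D) s"
    and \<phi>: "\<phi> \<in> symmetries (right_part q) (left_part p)"
    and \<psi>: "\<psi> \<in> symmetries (right_part p) (left_part s)"
  shows "compose_aug A C D s (lift_right (compose_aug A B C p \<phi> q) \<psi>) (compose_aug A B C p \<phi> q) \<simeq>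
    compose_aug A B D (compose_aug B C D s \<psi> p) (lift_left q \<phi>) q"
proof -
  let ?pq = "compose_aug A B C p \<phi> q" and ?sp = "compose_aug B C D s \<psi> p"
  let ?\<psi>' = "lift_right ?pq \<psi>"
  let ?\<phi>' = "lift_left q \<phi> :: 'e \<Rightarrow> 'f + 'g"
  let ?K1 = "interaction A B C p \<phi> q" and ?K2 = "interaction B C D s \<psi> p"
  let ?I1 = "interaction A C D s ?\<psi>' ?pq" and ?I2 = "interaction A B D ?sp ?\<phi>' q"
  note \<psi>' = lift_right_symmetry[OF \<psi>, of A B C \<phi> q]
  note \<phi>' = lift_left_symmetry[OF \<phi>, of B C D s \<psi>]
  \<comment> \<open>Only the outer edges that are not internal to the inner composite. The internal
    ones are causal paths of the inner interaction, and \<open>T1\<close> and \<open>T2\<close> put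
    its generating edges in their place.\<close>
  define L1 where "L1 = {(a, b) \<in> ?I1. \<not> (isl a \<and> isl b)}"
  define L2 where "L2 = {(a, b) \<in> ?I2. isl a \<or> isl b}"
  define T1 where "T1 = map_prod Inl Inl ` ?K1 \<union> L1"
  define T2 where "T2 = map_prod Inr Inr ` ?K2 \<union> L2"
  define Z1 :: "(('e + 'f) + 'g) set" where "Z1 = Inl ` events ?pq"
  define Z2 :: "('e + ('f + 'g)) set" where "Z2 = Inr ` events ?sp"
  \<comment> \<open>Reassociation of the nested sums. It identifies \<open>T1\<close> with
    \<open>T2\<close>, which are one three-part interaction under two bracketings.\<close>
  define as :: "('e + 'f) + 'g \<Rightarrow> 'e + ('f + 'g)" where
    "as = case_sum (case_sum Inl (\<lambda>b. Inr (Inl b))) (\<lambda>c. Inr (Inr c))"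
  have I1: "?I1 = {(a, b) \<in> Restr ((map_prod Inl Inl ` ?K1)\<^sup>*) Z1. a \<noteq> b} \<union> L1"
  proof (rule set_eqI, clarify)
    fix a b :: "('e + 'f) + 'g"
    show "(a, b) \<in> ?I1 \<longleftrightarrow> (a, b) \<in> {(a, b) \<in> Restr ((map_prod Inl Inl ` ?K1)\<^sup>*) Z1. a \<noteq> b} \<union> L1"
    proof (cases "isl a \<and> isl b")
      case True
      then obtain x y where xy: "a = Inl x" "b = Inl y" by (auto simp: isl_def)
      have "(a, b) \<in> ?I1 \<longleftrightarrow> (x, y) \<in> ?K1\<^sup>* \<and> x \<in> events ?pq \<and> y \<in> events ?pq \<and> x \<noteq> y"
        using xy by (auto simp: interaction_simps)
      then show ?thesis
        using xy by (auto simp: rtrancl_map_prod Z1_def L1_def)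
    next
      case False
      then show ?thesis by (auto simp: L1_def Z1_def)
    qed
  qed
  have I2: "?I2 = {(a, b) \<in> Restr ((map_prod Inr Inr ` ?K2)\<^sup>*) Z2. a \<noteq> b} \<union> L2"
  proof (rule set_eqI, clarify)
    fix a b :: "'e + ('f + 'g)"
    show "(a, b) \<in> ?I2 \<longleftrightarrow> (a, b) \<in> {(a, b) \<in> Restr ((map_prod Inr Inr ` ?K2)\<^sup>*) Z2. a \<noteq> b} \<union> L2"
    proof (cases "isl a \<or> isl b")
      case False
      then obtain x y where xy: "a = Inr x" "b = Inr y" by (cases a; cases b) auto
      have "(a, b) \<in> ?I2 \<longleftrightarrow> (x, y) \<in> ?K2\<^sup>* \<and> x \<in> events ?sp \<and> y \<in> events ?sp \<and> x \<noteq> y"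
        using xy by (auto simp: interaction_simps)
      then show ?thesis
        using xy by (auto simp: rtrancl_map_prod Z2_def L2_def)
    next
      case True
      then show ?thesis by (auto simp: L2_def Z2_def)
    qed
  qed
  have pol_p: "pol (A \<turnstile> C) (Inr (projr (display p m))) = pol (B \<turnstile> C) (display p m)"
    if "m \<in> events (right_part p)" for m
    using that configuration_display[OF augmentation_configuration[OF p], of m]
    by (cases "display p m") auto
  have pol_p': "pol (B \<turnstile> D) (Inl (projl (display p m))) = pol (B \<turnstile> C) (display p m)"
    if "m \<in> events (left_part p)" for m
    using that configuration_display[OF augmentation_configuration[OF p], of m]
    by (cases "display p m") auto
  \<comment> \<open>Links from \<open>s\<close> back into the inner composite use the inverse of the
    lifted symmetry, which takes values only among the copies of events of \<open>p\<close>.\<close>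
  have i1: "(Inl a = inv_into (events (right_part ?pq)) ?\<psi>' c) \<longleftrightarrow> False"
    "(Inr b = inv_into (events (right_part ?pq)) ?\<psi>' c) \<longleftrightarrow> b = inv_into (events (right_part p)) \<psi> c"
    if c: "c \<in> events (left_part s)" for a b c
  proof -
    show "(Inl a = inv_into (events (right_part ?pq)) ?\<psi>' c) \<longleftrightarrow> False"
      unfolding inv_symmetry_eq_iff[OF \<psi>' c] by auto
    show "(Inr b = inv_into (events (right_part ?pq)) ?\<psi>' c) \<longleftrightarrow> b = inv_into (events (right_part p)) \<psi> c"
      unfolding inv_symmetry_eq_iff[OF \<psi>' c] inv_symmetry_eq_iff[OF \<psi> c]
      by (auto simp: lift_right_def)
  qed
  have i2: "a = inv_into (events (right_part q)) ?\<phi>' (Inl b) \<longleftrightarrow> a = inv_into (events (right_part q)) \<phi> b"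
    if b: "b \<in> events (left_part p)" for a b
  proof -
    have b': "(Inl b :: 'f + 'g) \<in> events (left_part ?sp)" using b by simp
    show ?thesis unfolding inv_symmetry_eq_iff[OF \<phi>' b'] inv_symmetry_eq_iff[OF \<phi> b]
      by (auto simp: lift_left_def)
  qed
  interpret T: order_iso as UNIV UNIV T1 T2
  proof
    show "bij_betw as UNIV UNIV"
    proof (rule bij_betw_byWitness[where f' = "case_sum (\<lambda>a. Inl (Inl a)) (case_sum (\<lambda>b. Inl (Inr b)) Inr)"])
    qed (auto simp: as_def split: sum.splits)
    fix u v :: "('e + 'f) + 'g"
    have E: "(Inl x, Inl y) \<in> T1 \<longleftrightarrow> (x, y) \<in> ?K1" for x y
      by (auto simp: T1_def L1_def)
    have E1: "(x, y) \<in> T1 \<longleftrightarrow> (x, y) \<in> ?I1" if "\<not> (isl x \<and> isl y)" for x y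
      using that by (auto simp: T1_def L1_def)
    have F: "(Inr x, Inr y) \<in> T2 \<longleftrightarrow> (x, y) \<in> ?K2" for x y
      by (auto simp: T2_def L2_def)
    have F1: "(x, y) \<in> T2 \<longleftrightarrow> (x, y) \<in> ?I2" if "isl x \<or> isl y" for x y
      using that by (auto simp: T2_def L2_def)
    consider (ll) x y where "u = Inl x" "v = Inl y" | (lr) x c where "u = Inl x" "v = Inr c"
      | (rl) c x where "u = Inr c" "v = Inl x" | (rr) c c' where "u = Inr c" "v = Inr c'"
      by (cases u; cases v) auto
    then show "(u, v) \<in> T1 \<longleftrightarrow> (as u, as v) \<in> T2"
    proof cases
      case ll
      show ?thesis
      proof (cases x; cases y)
        fix a b assume "x = Inl a" "y = Inl b"
        then show ?thesis using ll by (simp add: E F1 as_def interaction_simps)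
      next
        fix a b assume "x = Inr a" "y = Inr b"
        then show ?thesis using ll by (simp add: E F as_def interaction_simps)
      next
        fix a b assume "x = Inl a" "y = Inr b"
        then show ?thesis using ll symmetries_in[OF \<phi>, of a]
          by (auto simp add: E F1 as_def interaction_simps lift_left_def)
      next
        fix b a assume x: "x = Inr b" "y = Inl a"
        show ?thesis
        proof (cases "b \<in> events (left_part p)")
          case True
          then show ?thesis using ll x i2[OF True, of a] pol_p'[OF True]
            by (simp add: E F1 as_def interaction_simps)
        next
          case False
          then show ?thesis using ll x by (auto simp add: E F1 as_def interaction_simps)
        qed
      qed
    next
      case lr
      show ?thesis
      proof (cases x)
        case (Inl a)
        then show ?thesis using lr by (auto simp: E1 F1 as_def interaction_simps lift_left_def)
      next
        case (Inr b)
        then show ?thesis using lr pol_p[of b]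
          by (auto simp add: E1 F as_def interaction_simps lift_right_def)
      qed
    next
      case rl
      show ?thesis
      proof (cases x)
        case (Inl a)
        moreover have "(Inr c :: 'f + 'g) \<notin> events (left_part ?sp)" by auto
        ultimately show ?thesis using rl i1(1)[of c a]
          by (auto simp add: E1 F1 as_def interaction_simps simp del: part_simps)
      next
        case (Inr b)
        then show ?thesis using rl i1(2)[of c b]
          by (auto simp add: E1 F as_def interaction_simps simp del: part_simps)
      qed
    next
      case rr
      then show ?thesis by (simp add: E1 F as_def interaction_simps)
    qed
  qed auto
  have h1: "(u, v) \<in> ?I1\<^sup>* \<longleftrightarrow> (u, v) \<in> T1\<^sup>*"
    if uv: "isl u \<Longrightarrow> u \<in> Z1" "isl v \<Longrightarrow> v \<in> Z1" for u v
    unfolding I1 T1_def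
  proof (rule rtrancl_hide[where W = "range Inl"])
    show "(a \<in> range Inl \<longrightarrow> a \<in> Z1) \<and> (b \<in> range Inl \<longrightarrow> b \<in> Z1)" if "(a, b) \<in> L1" for a b
    proof -
      have "(a, b) \<in> ?I1" "\<not> (isl a \<and> isl b)" using that by (auto simp: L1_def)
      then show ?thesis
        using inv_symmetry(1)[OF \<psi>'] by (cases a; cases b) (auto simp: interaction_simps Z1_def)
    qed
  qed (use uv in \<open>auto simp: Z1_def\<close>)
  have h2: "(u, v) \<in> ?I2\<^sup>* \<longleftrightarrow> (u, v) \<in> T2\<^sup>*"
    if uv: "\<not> isl u \<Longrightarrow> u \<in> Z2" "\<not> isl v \<Longrightarrow> v \<in> Z2" for u v
    unfolding I2 T2_def
  proof (rule rtrancl_hide[where W = "range Inr"])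
    show "(a \<in> range Inr \<longrightarrow> a \<in> Z2) \<and> (b \<in> range Inr \<longrightarrow> b \<in> Z2)" if "(a, b) \<in> L2" for a b
    proof -
      have "(a, b) \<in> ?I2" "isl a \<or> isl b" using that by (auto simp: L2_def)
      then show ?thesis
        using symmetries_in[OF \<phi>'] by (cases a; cases b) (auto simp: interaction_simps Z2_def)
    qed
  qed (use uv in \<open>auto simp: Z2_def\<close>)
  let ?r1 = "compose_aug A C D s ?\<psi>' ?pq" and ?r2 = "compose_aug A B D ?sp ?\<phi>' q"
  have ev1: "events ?r1 = Inl ` Inl ` events (left_part q) \<union> Inr ` events (right_part s)"
    by auto
  have ev2: "events ?r2 = Inl ` events (left_part q) \<union> Inr ` Inr ` events (right_part s)"
    by auto
  have sym: "restrict as (events ?r1) \<in> symmetries ?r1 ?r2"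
  proof (rule symmetriesI)
    show "bij_betw as (events ?r1) (events ?r2)"
      unfolding bij_betw_def
    proof
      show "inj_on as (events ?r1)" using T.bij by (auto simp: bij_betw_def intro: inj_on_subset)
      show "as ` events ?r1 = events ?r2"
        unfolding ev1 ev2 image_Un image_image by (simp add: as_def)
    qed
    fix u v assume u: "u \<in> events ?r1"
    show "display ?r2 (as u) = display ?r1 u" using u unfolding ev1 by (auto simp: as_def)
    assume "v \<in> events ?r1"
    then show "(u, v) \<in> deseq ?r1 \<longleftrightarrow> (as u, as v) \<in> deseq ?r2"
      using u unfolding ev1 by (auto simp: as_def)
  qed
  show ?thesis
  proof (rule isomorphicI[OF isomorphismsI[OF sym]])
    fix u v assume uv: "u \<in> events ?r1" "v \<in> events ?r1"
    have z1: "w \<in> Z1" if "w \<in> events ?r1" "isl w" for w using that unfolding ev1 by (auto simp: Z1_def)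
    have z2: "as w \<in> Z2" if "w \<in> events ?r1" "\<not> isl (as w)" for w
      using that unfolding ev1 by (auto simp: as_def Z2_def)
    have "as u \<in> events ?r2" "as v \<in> events ?r2" using symmetries_in[OF sym] uv by auto
    moreover have "(u, v) \<in> ?I1\<^sup>* \<longleftrightarrow> (as u, as v) \<in> ?I2\<^sup>*"
      using h1[of u v] h2[of "as u" "as v"] z1 z2 uv T.rtrancl_iff[of u v] by blast
    ultimately show "(u, v) \<in> seq ?r1 \<longleftrightarrow>
        (restrict as (events ?r1) u, restrict as (events ?r1) v) \<in> seq ?r2"
      using uv by (simp only: compose_simps(5) compose_simps(1) restrict_apply' Int_iff mem_Sigma_iff simp_thms)
  qed
qed

section \<open>Copycat\<close>

abbreviation base :: "'e + 'e \<Rightarrow> 'e" where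
  "base \<equiv> case_sum id id"

abbreviation other :: "'e + 'e \<Rightarrow> 'e + 'e" where
  "other \<equiv> case_sum Inr Inl"

text \<open>Of the two copies of an event of \<open>x\<close>, the one that is negative in
  \<open>A \<turnstile> A\<close>: the left copy of a positive move, the right copy of a negative
  one. It is the copy that causes the other.\<close>

definition leading :: "'a arena \<Rightarrow> ('e, 'a) configuration \<Rightarrow> 'e + 'e \<Rightarrow> bool" where
  "leading A x = case_sum (\<lambda>m. pol A (display x m) = Pos) (\<lambda>m. pol A (display x m) = Neg)"

text \<open>The copycat order is lexicographic: by the order of the configuration, then by polarity.\<close>

definition copycat_le :: "'a arena \<Rightarrow> ('e, 'a) configuration \<Rightarrow> ('e + 'e) rel" where
  "copycat_le A x = {(u, v). (base u, base v) \<in> deseq x \<and> (base u = base v \<longrightarrow> u = v \<or> leading A x u)}"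

lemma leading_other: "leading A x (other u) \<longleftrightarrow> \<not> leading A x u"
  by (cases u) (auto simp: leading_def)

lemma same_base: "base u = base v \<Longrightarrow> u = v \<or> u = other v"
  by (cases u; cases v) auto

lemma base_other [simp]: "base (other u) = base u"
  by (cases u) auto

lemma other_neq [simp]: "other u \<noteq> u" "u \<noteq> other u"
  by (cases u; simp)+

lemma copycat_simps [simp]:
  "events (copycat A x) = events x <+> events x"
  "deseq (copycat A x) = sum_rel (deseq x) (deseq x)"
  "display (copycat A x) (Inl m) = Inl (display x m)"
  "display (copycat A x) (Inr m) = Inr (display x m)"
  by (simp_all add: copycat_def)

lemma configuration_alternating:
  "arena A \<Longrightarrow> configuration A x \<Longrightarrow> (m, n) \<in> immediate (deseq x) \<Longrightarrow>
    pol A (display x m) \<noteq> pol A (display x n)"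
  using arena_alternating configuration_immediate by metis

text \<open>The lexicographic relation is transitive and contains the generators. Conversely,
  generators change sides only at a leading event. To get from a non-leading \<open>u\<close> to the
  other side, move on the side of \<open>u\<close> to a cover of its base: by alternation this event
  is leading, and the crossing happens there.\<close>

lemma seq_copycat:
  assumes A: "arena A" and x: "configuration A x"
  shows "seq (copycat A x) = copycat_le A x"
proof -
  note F = configuration_forest[OF x]
  let ?G = "sum_rel (deseq x) (deseq x) \<union>
             {(Inl m, Inr n) | m n. (m, n) \<in> deseq x \<and> pol A (display x m) = Pos} \<union>
             {(Inr m, Inl n) | m n. (m, n) \<in> deseq x \<and> pol A (display x m) = Neg}"
  have le: "?G \<subseteq> copycat_le A x"
    by (auto simp: copycat_le_def leading_def sum_rel_def)
  have tr: "trans (copycat_le A x)"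
  proof (rule transI)
    fix u v w assume uv: "(u, v) \<in> copycat_le A x" and vw: "(v, w) \<in> copycat_le A x"
    then have "(base u, base w) \<in> deseq x"
      using forest_trans[OF F, of "base u" "base v" "base w"] by (auto simp: copycat_le_def)
    moreover have "u = w \<or> leading A x u" if uw: "base u = base w"
    proof -
      have "base v = base u" "base v = base w"
        using uw uv vw forest_antisym[OF F, of "base u" "base v"] by (auto simp: copycat_le_def)
      then show ?thesis using uv vw by (auto simp: copycat_le_def)
    qed
    ultimately show "(u, w) \<in> copycat_le A x" by (simp add: copycat_le_def)
  qed
  have "?G\<^sup>+ \<subseteq> copycat_le A x"
    using trancl_mono_subset[OF le] trancl_id[OF tr] by simp
  moreover have "(u, v) \<in> ?G\<^sup>+" if uv: "(u, v) \<in> copycat_le A x" for u v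
  proof -
    have G: "(u, v) \<in> ?G" if "(base u, base v) \<in> deseq x" "isl u = isl v \<or> leading A x u" for u v
      using that by (cases u; cases v) (auto simp: leading_def)
    have 1: "(base u, base v) \<in> deseq x" "base u = base v \<longrightarrow> u = v \<or> leading A x u"
      using uv by (auto simp: copycat_le_def)
    show ?thesis
    proof (cases "isl u = isl v \<or> leading A x u")
      case True
      show ?thesis using G[OF 1(1) True] by (rule r_into_trancl)
    next
      case False
      then obtain k where k: "(base u, k) \<in> immediate (deseq x)" "(k, base v) \<in> deseq x"
        using forest_immediate_succ[OF F 1(1)] 1(2) by blast
      define w where "w = (if isl u then Inl k else Inr k)"
      have w: "base w = k" "isl w = isl u" by (simp_all add: w_def)
      have "leading A x w"
        using configuration_alternating[OF A x k(1)] False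
        by (cases u) (auto simp: w_def leading_def)
      then have "(u, w) \<in> ?G" "(w, v) \<in> ?G"
        using G[of u w] G[of w v] w k(2) immediateD[OF k(1)] by simp_all
      then show ?thesis by (meson r_into_trancl trancl_into_trancl)
    qed
  qed
  ultimately show ?thesis unfolding copycat_def by auto
qed

text \<open>There are two kinds of covers: from a leading copy to its other copy, and from a
  non-leading copy to the leading copy of a covering event. The first kind runs from negative to
  positive. The second stays on one side by alternation, so it is static.\<close>

lemma causal_copycat:
  assumes A: "arena A" and x: "configuration A x"
    and P: "\<And>u. base u \<in> events x \<Longrightarrow> P u = Neg \<longleftrightarrow> leading A x u"
  shows "causal (events x <+> events x) (copycat_le A x) (sum_rel (deseq x) (deseq x)) P"
proof -
  note F = configuration_forest[OF x]
  let ?S = "events x <+> events x" and ?r = "copycat_le A x" and ?l = "leading A x"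
  have le: "(u, v) \<in> ?r \<longleftrightarrow> (base u, base v) \<in> deseq x \<and> (base u = base v \<longrightarrow> u = v \<or> ?l u)" for u v
    by (simp add: copycat_le_def)
  have inS: "u \<in> ?S \<longleftrightarrow> base u \<in> events x" for u by (cases u) auto
  have dup: "base u \<in> events x \<Longrightarrow> ?l u \<Longrightarrow> (u, other u) \<in> ?r" for u
    using forest_refl[OF F] by (simp add: le)
  have dup': "base u \<in> events x \<Longrightarrow> \<not> ?l u \<Longrightarrow> (other u, u) \<in> ?r" for u
    using forest_refl[OF F] by (simp add: le leading_other)
  have forest: "forest ?S ?r"
  proof (rule forestI)
    show "?r \<subseteq> ?S \<times> ?S" using forest_subset[OF F] inS le by auto
    show "(u, u) \<in> ?r" if "u \<in> ?S" for u using that forest_refl[OF F] inS le by auto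
    show "(u, w) \<in> ?r" if "(u, v) \<in> ?r" "(v, w) \<in> ?r" for u v w
      using that unfolding seq_copycat[OF A x, symmetric] copycat_def by simp
    show "u = v" if uv: "(u, v) \<in> ?r" "(v, u) \<in> ?r" for u v
    proof (rule ccontr)
      assume ne: "u \<noteq> v"
      have "base u = base v" using uv forest_antisym[OF F, of "base u" "base v"] le by auto
      moreover from this have "u = other v" using same_base[of u v] ne by simp
      ultimately show False using uv ne le leading_other[of A x v] by auto
    qed
    show "finite {v. (v, u) \<in> ?r}" for u
      by (rule finite_subset[of _ ?S]) (use forest_subset[OF F] inS le configuration_finite[OF x] in auto)
    show "(v, w) \<in> ?r \<or> (w, v) \<in> ?r" if vw: "(v, u) \<in> ?r" "(w, u) \<in> ?r" for u v w
    proof -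
      have b: "(base v, base w) \<in> deseq x \<or> (base w, base v) \<in> deseq x"
        using vw forest_total[OF F, of "base v" "base u" "base w"] le by auto
      show ?thesis
      proof (cases "base v = base w")
        case True
        then have "v = w \<or> v = other w" by (rule same_base)
        then show ?thesis using b True leading_other[of A x w] le by auto
      next
        case False
        then show ?thesis using b le by auto
      qed
    qed
  qed
  have imm: "base u \<noteq> base v \<Longrightarrow> \<not> ?l u \<and> ?l v \<and> (base u, base v) \<in> immediate (deseq x)"
    "base u = base v \<Longrightarrow> ?l u \<and> v = other u"
    if uv: "(u, v) \<in> immediate ?r" for u v
  proof -
    note 1 = immediateD[OF uv]
    have S: "base u \<in> events x" "base v \<in> events x" using 1 forest_subset[OF F] le by auto
    show "?l u \<and> v = other u" if "base u = base v"
      using 1 that le same_base[of v u] by auto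
    assume ne: "base u \<noteq> base v"
    show "\<not> ?l u \<and> ?l v \<and> (base u, base v) \<in> immediate (deseq x)"
    proof (intro conjI)
      show "\<not> ?l u"
      proof
        assume "?l u"
        \<comment> \<open>A leading \<open>u\<close> would have \<open>other u\<close> strictly
          between itself and \<open>v\<close>.\<close>
        moreover have "(other u, v) \<in> ?r" using 1 ne le by simp
        ultimately have "other u = u \<or> other u = v" using immediate_between[OF uv] dup S by blast
        then show False using ne base_other[of u] other_neq by metis
      qed
      show "?l v"
      proof (rule ccontr)
        assume "\<not> ?l v"
        moreover have "(u, other v) \<in> ?r" using 1 ne le by simp
        ultimately have "other v = u \<or> other v = v" using immediate_between[OF uv] dup' S by blast
        then show False using ne base_other[of v] other_neq by metis
      qed
      show "(base u, base v) \<in> immediate (deseq x)"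
      proof -
        have False if "\<exists>k. k \<noteq> base u \<and> k \<noteq> base v \<and> (base u, k) \<in> deseq x \<and> (k, base v) \<in> deseq x"
        proof -
          obtain k where "k \<noteq> base u" "k \<noteq> base v" "(base u, k) \<in> deseq x" "(k, base v) \<in> deseq x"
            using \<open>\<exists>k. _\<close> by blast
          then show False using immediate_between[OF uv, of "Inl k"] le by auto
        qed
        then show ?thesis using 1 le ne unfolding immediate_def by blast
      qed
    qed
  qed
  show ?thesis
    unfolding causal_def
  proof (intro conjI allI impI; (elim conjE)?)
    show "forest ?S ?r" by (rule forest)
    show "sum_rel (deseq x) (deseq x) \<subseteq> ?r" by (auto simp: le sum_rel_def)
    show "(u, v) \<in> immediate (sum_rel (deseq x) (deseq x))"
      if uv: "(u, v) \<in> immediate ?r" and "P u = Pos \<or> P v = Neg" for u v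
    proof -
      have S: "base u \<in> events x" "base v \<in> events x"
        using immediateD[OF uv] forest_subset[OF F] le by auto
      have "\<not> ?l u \<or> ?l v" using that(2) P[OF S(1)] P[OF S(2)] by auto
      then have "base u \<noteq> base v" using imm(2)[OF uv] leading_other[of A x u] by auto
      then have *: "\<not> ?l u" "?l v" "(base u, base v) \<in> immediate (deseq x)" using imm(1)[OF uv] by auto
      then show ?thesis using configuration_alternating[OF A x *(3)]
        by (cases u; cases v) (auto simp: leading_def)
    qed
    show "v = w" if uv: "(u, v) \<in> immediate ?r" "(u, w) \<in> immediate ?r" "P u = Neg" for u v w
    proof -
      have "?l u" using that P[of u] forest_subset[OF F] immediateD[OF uv(1)] le by auto
      then show ?thesis using imm[OF uv(1)] imm[OF uv(2)] by metis
    qed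
    show "P u = Pos" if u: "maximal_in ?S ?r u" for u
    proof (rule ccontr)
      have S: "base u \<in> events x" "base (other u) \<in> events x" using u inS by (auto simp: maximal_in_def)
      assume "P u \<noteq> Pos"
      then have "(u, other u) \<in> ?r" using P[OF S(1)] dup[OF S(1)] by simp
      then show False using u S inS other_neq by (metis maximal_in_def)
    qed
    show "P u = Neg" if u: "minimal_in ?S ?r u" for u
    proof (rule ccontr)
      have S: "base u \<in> events x" "base (other u) \<in> events x" using u inS by (auto simp: minimal_in_def)
      assume "P u \<noteq> Neg"
      then have "(other u, u) \<in> ?r" using P[OF S(1)] dup'[OF S(1)] by auto
      then show False using u S inS other_neq by (metis minimal_in_def)
    qed
  qed
qed

theorem augmentation_copycat:
  assumes A: "arena A" and x: "configuration A x"
  shows "augmentation (A \<turnstile> A) (copycat A x)"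
proof -
  have "configuration (A \<turnstile> A) (copycat A x)"
    by (rule configuration_sum[OF x x]) simp_all
  moreover have "causal (events x <+> events x) (copycat_le A x) (sum_rel (deseq x) (deseq x))
      (\<lambda>u. pol (A \<turnstile> A) (display (copycat A x) u))"
  proof (rule causal_copycat[OF A x])
    fix u assume "base u \<in> events x"
    then show "pol (A \<turnstile> A) (display (copycat A x) u) = Neg \<longleftrightarrow> leading A x u"
      using configuration_display[OF x] by (cases u) (auto simp: leading_def)
  qed
  ultimately show ?thesis by (simp add: augmentation_iff seq_copycat[OF A x])
qed

section \<open>Composition with a copycat\<close>

lemma retract_order:
  assumes F: "forest E r"
    and g: "\<And>a b. (a, b) \<in> K \<Longrightarrow> (g a, g b) \<in> r"
    and h: "\<And>e e'. (e, e') \<in> immediate r \<Longrightarrow> (h e, h e') \<in> K\<^sup>*"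
    and u: "g u \<in> E" "h (g u) = u" and v: "h (g v) = v"
  shows "(u, v) \<in> K\<^sup>* \<longleftrightarrow> (g u, g v) \<in> r"
proof
  assume "(u, v) \<in> K\<^sup>*"
  then show "(g u, g v) \<in> r"
  proof induction
    case (step y z)
    then show ?case using g forest_trans[OF F] by blast
  qed (use u forest_refl[OF F] in simp)
next
  assume "(g u, g v) \<in> r"
  \<comment> \<open>Covers generate the forest order, so it suffices that \<open>h\<close> lifts
    each cover to a path in \<open>K\<close>.\<close>
  from forest_immediate_rtrancl[OF F this] have "(h (g u), h (g v)) \<in> K\<^sup>*"
  proof induction
    case (step y z)
    then show ?case using h rtrancl_trans by metis
  qed simp
  then show "(u, v) \<in> K\<^sup>*" using u v by simp
qed

text \<open>\<open>K\<close> is the interaction of \<open>q\<close> with a copycat. The map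
  \<open>g\<close> collapses each event onto the event of \<open>q\<close> that it imitates,
  \<open>k\<close> embeds \<open>q\<close> into the interaction, and \<open>h\<close> picks the
  visible copy. A static cover of \<open>q\<close> lifts by \<open>static\<close>. Any other cover
  runs from a negative \<open>e\<close> to a positive \<open>e'\<close> and lifts to the path
  through \<open>h e\<close>, \<open>k e\<close>, \<open>k e'\<close> and
  \<open>h e'\<close>.\<close>

lemma retract_isomorphic:
  assumes q: "augmentation A q"
    and seq: "seq r = Restr (K\<^sup>*) (events r)"
    and hg: "\<And>u. u \<in> events r \<Longrightarrow> g u \<in> events q \<and> h (g u) = u \<and> display q (g u) = display r u"
    and gh: "\<And>e. e \<in> events q \<Longrightarrow> h e \<in> events r \<and> g (h e) = e"
    and deseq: "\<And>u v. u \<in> events r \<Longrightarrow> v \<in> events r \<Longrightarrow> (u, v) \<in> deseq r \<longleftrightarrow> (g u, g v) \<in> deseq q"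
    and g: "\<And>a b. (a, b) \<in> K \<Longrightarrow> (g a, g b) \<in> seq q"
    and static: "\<And>u v. (u, v) \<in> deseq r \<Longrightarrow> (u, v) \<in> K\<^sup>*"
    and inner: "\<And>e e'. (e, e') \<in> seq q \<Longrightarrow> e \<noteq> e' \<Longrightarrow> (k e, k e') \<in> K"
    and down: "\<And>e. e \<in> events q \<Longrightarrow> pol A (display q e) = Neg \<Longrightarrow> (h e, k e) \<in> K\<^sup>*"
    and up: "\<And>e. e \<in> events q \<Longrightarrow> pol A (display q e) = Pos \<Longrightarrow> (k e, h e) \<in> K\<^sup>*"
  shows "r \<simeq> q"
proof -
  note causal = augmentation_causal[OF q]
  note F = causal_forest[OF causal]
  have h: "(h e, h e') \<in> K\<^sup>*" if ee: "(e, e') \<in> immediate (seq q)" for e e'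
  proof -
    have e: "e \<in> events q" "e' \<in> events q" using immediate_subset[OF F ee] by auto
    show ?thesis
    proof (cases "pol A (display q e) = Pos \<or> pol A (display q e') = Neg")
      case True
      then have "(e, e') \<in> deseq q" using immediateD[OF causal_immediate[OF causal ee]] by blast
      then show ?thesis using static deseq[of "h e" "h e'"] gh[OF e(1)] gh[OF e(2)] by simp
    next
      case False
      then have P: "pol A (display q e) = Neg" "pol A (display q e') = Pos" by auto
      have "(k e, k e') \<in> K\<^sup>*" using inner[of e e'] immediateD[OF ee] by blast
      then show ?thesis
        by (rule rtrancl_trans[OF rtrancl_trans[OF down[OF e(1) P(1)]] up[OF e(2) P(2)]])
    qed
  qed
  have sym: "restrict g (events r) \<in> symmetries r q"
  proof (rule symmetriesI)
    show "bij_betw g (events r) (events q)"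
      by (rule bij_betw_byWitness[where f' = h]) (use hg gh in auto)
  qed (use hg deseq in auto)
  show ?thesis
  proof (rule isomorphicI[OF isomorphismsI[OF sym]])
    fix u v assume uv: "u \<in> events r" "v \<in> events r"
    have "(u, v) \<in> K\<^sup>* \<longleftrightarrow> (g u, g v) \<in> seq q"
      using retract_order[OF F, of K g h u v] g h hg uv by blast
    then show "(u, v) \<in> seq r \<longleftrightarrow> (restrict g (events r) u, restrict g (events r) v) \<in> seq q"
      using uv seq by simp
  qed
qed

lemma copycat_parts:
  "events (right_part (copycat A x)) = Inr ` events x"
  "events (left_part (copycat A x)) = Inl ` events x"
  by auto

lemma copycat_le_simps:
  assumes "configuration A x"
  shows "(Inl m, Inl n) \<in> copycat_le A x \<longleftrightarrow> (m, n) \<in> deseq x"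
    "(Inr m, Inr n) \<in> copycat_le A x \<longleftrightarrow> (m, n) \<in> deseq x"
    "m \<in> events x \<Longrightarrow> pol A (display x m) = Pos \<Longrightarrow> (Inl m, Inr m) \<in> copycat_le A x"
    "m \<in> events x \<Longrightarrow> pol A (display x m) = Neg \<Longrightarrow> (Inr m, Inl m) \<in> copycat_le A x"
  using forest_refl[OF configuration_forest[OF assms]] by (auto simp: copycat_le_def leading_def)

text \<open>An event \<open>e\<close> of \<open>q\<close> in \<open>A\<close> is linked with the
  inner (right) copy of \<open>m e\<close>, and its visible substitute is the outer (left) copy.
  Copycat leads inward from the outer copy when \<open>e\<close> is negative and outward when it is
  positive. The symmetry is arbitrary, since \<open>m\<close> is read off from it.\<close>

theorem compose_copycat_right:
  fixes x :: "('e, 'a) configuration" and q :: "('f, 'a + 'b) augmentation"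
  assumes A: "arena A" and x: "configuration A x" and q: "augmentation (A \<turnstile> B) q"
    and \<phi>: "\<phi> \<in> symmetries (right_part (copycat A x)) (left_part q)"
  shows "compose_aug A A B q \<phi> (copycat A x) \<simeq> q"
proof -
  let ?cc = "copycat A x" let ?I = "interaction A A B q \<phi> ?cc"
  let ?r = "compose_aug A A B q \<phi> ?cc"
  note c = augmentation_configuration[OF q] and k = augmentation_causal[OF q]
  note F = causal_forest[OF k]
  note seqcc = seq_copycat[OF A x] and ccs = copycat_le_simps[OF x]
  define g where "g = case_sum (\<lambda>u. \<phi> (Inr (base u))) id"
  define m where "m e = base (inv_into (events (right_part ?cc)) \<phi> e)" for e
  define h :: "'f \<Rightarrow> ('e + 'e) + 'f"
    where "h e = (if isl (display q e) then Inl (Inl (m e)) else Inr e)" for e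
  have m: "inv_into (events (right_part ?cc)) \<phi> e = Inr (m e)" "m e \<in> events x" "\<phi> (Inr (m e)) = e"
    "display q e = Inl (display x (m e))" "display x (m e) \<in> moves A"
    if e: "e \<in> events (left_part q)" for e
  proof -
    note i = inv_symmetry[OF \<phi> e]
    show 1: "inv_into (events (right_part ?cc)) \<phi> e = Inr (m e)" "m e \<in> events x"
      using i(1) unfolding copycat_parts m_def by auto
    show 2: "\<phi> (Inr (m e)) = e" using i(2) 1 by simp
    have "Inr (m e) \<in> events (right_part ?cc)" using 1(2) unfolding copycat_parts by simp
    then have "display (left_part q) e = display x (m e)"
      using symmetries_display[OF \<phi>, of "Inr (m e)"] 2 by simp
    then show "display q e = Inl (display x (m e))" using e by (cases "display q e") auto
    show "display x (m e) \<in> moves A" by (rule configuration_display[OF x 1(2)])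
  qed
  have \<phi>in: "\<phi> (Inr n) \<in> events (left_part q)" if "n \<in> events x" for n
    using symmetries_in[OF \<phi>, of "Inr n"] that unfolding copycat_parts by blast
  have m\<phi>: "m (\<phi> (Inr n)) = n" if "n \<in> events x" for n
    using inv_symmetry_left[OF \<phi>, of "Inr n"] that unfolding copycat_parts m_def by simp
  have \<phi>le: "(\<phi> (Inr a), \<phi> (Inr b)) \<in> deseq q \<longleftrightarrow> (a, b) \<in> deseq x" if "a \<in> events x" "b \<in> events x" for a b
    using symmetries_deseq[OF \<phi>, of "Inr a" "Inr b"] that \<phi>in[OF that(1)] \<phi>in[OF that(2)]
    unfolding copycat_parts by simp
  have down: "(h e, Inr e) \<in> ?I\<^sup>*" if e: "e \<in> events q" "pol (A \<turnstile> B) (display q e) = Neg" for e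
  proof (cases "isl (display q e)")
    case True
    then have el: "e \<in> events (left_part q)" using e by simp
    note me = m[OF el]
    have pos: "pol A (display x (m e)) = Pos" using e(2) me(4,5) by simp
    have "(Inl (Inl (m e)), Inl (Inr (m e))) \<in> ?I"
      using ccs(3)[OF me(2) pos] by (simp add: interaction_simps seqcc)
    moreover have "(Inl (Inr (m e)), Inr e) \<in> ?I"
      using me(2,3,5) pos by (simp add: interaction_simps)
    ultimately show ?thesis using True by (simp add: h_def)
  qed (simp add: h_def)
  have up: "(Inr e, h e) \<in> ?I\<^sup>*" if e: "e \<in> events q" "pol (A \<turnstile> B) (display q e) = Pos" for e
  proof (cases "isl (display q e)")
    case True
    then have el: "e \<in> events (left_part q)" using e by simp
    note me = m[OF el]
    have neg: "pol A (display x (m e)) = Neg" using e(2) me(4,5) by simp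
    have "(Inl (Inr (m e)), Inl (Inl (m e))) \<in> ?I"
      using ccs(4)[OF me(2) neg] by (simp add: interaction_simps seqcc)
    moreover have "(Inr e, Inl (Inr (m e))) \<in> ?I"
      using el e(2) me(1) by (simp only: interaction_simps simp_thms)
    ultimately show ?thesis using True by (simp add: h_def)
  qed (simp add: h_def)
  \<comment> \<open>The copycat order projects to the order of \<open>x\<close>, which
    \<open>\<phi>\<close> carries into the static order of \<open>q\<close>; links collapse to a
    single event.\<close>
  have g_mono: "(g a, g b) \<in> seq q" if ab: "(a, b) \<in> ?I" for a b
  proof (cases a; cases b)
    fix u v assume uv: "a = Inl u" "b = Inl v"
    then have "(base u, base v) \<in> deseq x" using ab by (simp add: interaction_simps seqcc copycat_le_def)
    moreover from this have "base u \<in> events x" "base v \<in> events x"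
      using forest_subset[OF configuration_forest[OF x]] by auto
    ultimately show ?thesis using uv \<phi>le causal_static[OF k] by (simp add: g_def)
  next
    fix e e' assume "a = Inr e" "b = Inr e'"
    then show ?thesis using ab by (simp add: interaction_simps g_def)
  next
    fix u e assume ue: "a = Inl u" "b = Inr e"
    then have "u \<in> events (right_part ?cc)" "e = \<phi> u" using ab by (simp_all add: interaction_simps)
    then obtain n where "n \<in> events x" "u = Inr n" "e = \<phi> (Inr n)" unfolding copycat_parts by blast
    then show ?thesis using ue \<phi>in[of n] forest_refl[OF F] by (simp add: g_def)
  next
    fix u e assume ue: "a = Inr e" "b = Inl u"
    then have e: "e \<in> events (left_part q)" "u = inv_into (events (right_part ?cc)) \<phi> e"
      using ab by (simp_all only: interaction_simps)
    then show ?thesis using ue m[OF e(1)] forest_refl[OF F] by (simp add: g_def)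
  qed
  have ev: "events ?r = Inl ` Inl ` events x \<union> Inr ` events (right_part q)" by auto
  have hg: "g u \<in> events q \<and> h (g u) = u \<and> display q (g u) = display ?r u" if "u \<in> events ?r" for u
    using that unfolding ev
  proof
    assume "u \<in> Inl ` Inl ` events x"
    then obtain n where n: "u = Inl (Inl n)" "n \<in> events x" by blast
    then show ?thesis using \<phi>in[of n] m\<phi>[of n] m(4)[OF \<phi>in, of n] by (simp add: g_def h_def)
  next
    assume "u \<in> Inr ` events (right_part q)"
    then obtain e where "u = Inr e" "e \<in> events (right_part q)" by blast
    then show ?thesis by (cases "display q e") (simp_all add: g_def h_def)
  qed
  have gh: "h e \<in> events ?r \<and> g (h e) = e" if e: "e \<in> events q" for e
  proof (cases "isl (display q e)")
    case True
    then have "e \<in> events (left_part q)" using e by simp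
    then show ?thesis using True m[of e] by (simp add: g_def h_def)
  next
    case False
    then show ?thesis using e by (simp add: g_def h_def)
  qed
  show ?thesis
  proof (rule retract_isomorphic[where K = ?I and g = g and h = h and k = Inr, OF q _ hg gh _ g_mono _ _ down up])
    show "seq ?r = Restr (?I\<^sup>*) (events ?r)" by simp
    show "(Inr e, Inr e') \<in> ?I" if "(e, e') \<in> seq q" "e \<noteq> e'" for e e'
      using that by (simp add: interaction_simps)
    show "(u, v) \<in> ?I\<^sup>*" if "(u, v) \<in> deseq ?r" for u v
    proof (cases "u = v")
      case False
      then show ?thesis
        using that ccs(1) causal_static[OF k]
        by (intro r_into_rtrancl) (auto simp: sum_rel_def interaction_simps seqcc)
    qed simp
    show "(u, v) \<in> deseq ?r \<longleftrightarrow> (g u, g v) \<in> deseq q" if "u \<in> events ?r" "v \<in> events ?r" for u v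
    proof (cases "isl u \<longleftrightarrow> isl v")
      case True
      then show ?thesis using that \<phi>le unfolding ev by (auto simp: g_def)
    next
      \<comment> \<open>Events in different components are statically unrelated, both in the
        composite and in \<open>q\<close>.\<close>
      case False
      then have "(u, v) \<notin> deseq ?r" by (cases u; cases v) simp_all
      moreover have "isl (display q (g u)) \<longleftrightarrow> isl u" "isl (display q (g v)) \<longleftrightarrow> isl v"
        using hg[OF that(1)] hg[OF that(2)] by (cases u; cases v; simp)+
      ultimately show ?thesis using False configuration_component[OF c, of "g u" "g v"] by blast
    qed
  qed
qed

text \<open>The mirror image, with the left copies now inner and the right ones visible. Here
  \<open>\<phi>\<close> runs from \<open>q\<close> into the copycat, so the collapse
  \<open>g\<close> uses its inverse \<open>i\<close>, and \<open>h\<close> uses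
  \<open>\<phi>\<close> itself.\<close>

theorem compose_copycat_left:
  fixes y :: "('f, 'b) configuration" and q :: "('e, 'a + 'b) augmentation"
  assumes B: "arena B" and y: "configuration B y" and q: "augmentation (A \<turnstile> B) q"
    and \<phi>: "\<phi> \<in> symmetries (right_part q) (left_part (copycat B y))"
  shows "compose_aug A B B (copycat B y) \<phi> q \<simeq> q"
proof -
  let ?cc = "copycat B y" let ?I = "interaction A B B ?cc \<phi> q"
  let ?r = "compose_aug A B B ?cc \<phi> q"
  note c = augmentation_configuration[OF q] and k = augmentation_causal[OF q]
  note F = causal_forest[OF k]
  note seqcc = seq_copycat[OF B y] and ccs = copycat_le_simps[OF y]
  define i where "i n = inv_into (events (right_part q)) \<phi> (Inl n)" for n
  define g where "g = case_sum id (\<lambda>u. i (base u))"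
  define m where "m e = base (\<phi> e)" for e
  define h :: "'e \<Rightarrow> 'e + ('f + 'f)"
    where "h e = (if isl (display q e) then Inl e else Inr (Inr (m e)))" for e
  have m: "\<phi> e = Inl (m e)" "m e \<in> events y" "i (m e) = e"
    "display q e = Inr (display y (m e))" "display y (m e) \<in> moves B"
    if e: "e \<in> events (right_part q)" for e
  proof -
    show 1: "\<phi> e = Inl (m e)" "m e \<in> events y"
      using symmetries_in[OF \<phi> e] unfolding copycat_parts m_def by auto
    show "i (m e) = e" unfolding i_def using inv_symmetry_left[OF \<phi> e] 1 by simp
    have "display (right_part q) e = display y (m e)"
      using symmetries_display[OF \<phi> e] 1 by simp
    then show "display q e = Inr (display y (m e))" using e by (cases "display q e") auto
    show "display y (m e) \<in> moves B" by (rule configuration_display[OF y 1(2)])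
  qed
  have iin: "i n \<in> events (right_part q)" "\<phi> (i n) = Inl n" if "n \<in> events y" for n
    using inv_symmetry[OF \<phi>, of "Inl n"] that unfolding copycat_parts i_def by blast+
  have mi: "m (i n) = n" if "n \<in> events y" for n
    using iin(2)[OF that] by (simp add: m_def)
  have ile: "(i a, i b) \<in> deseq q \<longleftrightarrow> (a, b) \<in> deseq y" if "a \<in> events y" "b \<in> events y" for a b
    using symmetries_deseq[OF \<phi> iin(1)[OF that(1)] iin(1)[OF that(2)]] that
      iin[OF that(1)] iin[OF that(2)] by simp
  have down: "(h e, Inl e) \<in> ?I\<^sup>*" if e: "e \<in> events q" "pol (A \<turnstile> B) (display q e) = Neg" for e
  proof (cases "isl (display q e)")
    case False
    then have el: "e \<in> events (right_part q)" using e by simp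
    note me = m[OF el]
    have neg: "pol B (display y (m e)) = Neg" using e(2) me(4,5) by simp
    have "(Inr (Inr (m e)), Inr (Inl (m e))) \<in> ?I"
      using ccs(4)[OF me(2) neg] by (simp add: interaction_simps seqcc)
    moreover have "(Inr (Inl (m e)), Inl e) \<in> ?I"
      using me(2,3,5) neg by (simp add: interaction_simps i_def)
    ultimately show ?thesis using False by (simp add: h_def)
  qed (simp add: h_def)
  have up: "(Inl e, h e) \<in> ?I\<^sup>*" if e: "e \<in> events q" "pol (A \<turnstile> B) (display q e) = Pos" for e
  proof (cases "isl (display q e)")
    case False
    then have el: "e \<in> events (right_part q)" using e by simp
    note me = m[OF el]
    have pos: "pol B (display y (m e)) = Pos" using e(2) me(4,5) by simp
    have "(Inr (Inl (m e)), Inr (Inr (m e))) \<in> ?I"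
      using ccs(3)[OF me(2) pos] by (simp add: interaction_simps seqcc)
    moreover have "(Inl e, Inr (Inl (m e))) \<in> ?I"
      using el e(2) me(1) by (simp only: interaction_simps simp_thms)
    ultimately show ?thesis using False by (simp add: h_def)
  qed (simp add: h_def)
  have g_mono: "(g a, g b) \<in> seq q" if ab: "(a, b) \<in> ?I" for a b
  proof (cases a; cases b)
    fix u v assume uv: "a = Inr u" "b = Inr v"
    then have "(base u, base v) \<in> deseq y" using ab by (simp add: interaction_simps seqcc copycat_le_def)
    moreover from this have "base u \<in> events y" "base v \<in> events y"
      using forest_subset[OF configuration_forest[OF y]] by auto
    ultimately show ?thesis using uv ile causal_static[OF k] by (simp add: g_def)
  next
    fix e e' assume "a = Inl e" "b = Inl e'"
    then show ?thesis using ab by (simp add: interaction_simps g_def)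
  next
    fix e u assume ue: "a = Inl e" "b = Inr u"
    then have e: "e \<in> events (right_part q)" "u = \<phi> e" using ab by (simp_all add: interaction_simps)
    then show ?thesis using ue m[OF e(1)] forest_refl[OF F] by (simp add: g_def)
  next
    fix u e assume ue: "a = Inr u" "b = Inl e"
    then have e: "u \<in> events (left_part ?cc)" "e = inv_into (events (right_part q)) \<phi> u"
      using ab by (simp_all only: interaction_simps)
    then obtain n where n: "n \<in> events y" "u = Inl n" unfolding copycat_parts by blast
    then show ?thesis using ue e(2) iin(1)[OF n(1)] forest_refl[OF F] by (simp add: g_def i_def)
  qed
  have ev: "events ?r = Inl ` events (left_part q) \<union> Inr ` Inr ` events y" by auto
  have hg: "g u \<in> events q \<and> h (g u) = u \<and> display q (g u) = display ?r u" if "u \<in> events ?r" for u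
    using that unfolding ev
  proof
    assume "u \<in> Inr ` Inr ` events y"
    then obtain n where n: "u = Inr (Inr n)" "n \<in> events y" by blast
    then show ?thesis using iin(1)[of n] mi[of n] m(4)[OF iin(1), of n] by (simp add: g_def h_def)
  next
    assume "u \<in> Inl ` events (left_part q)"
    then obtain e where "u = Inl e" "e \<in> events (left_part q)" by blast
    then show ?thesis by (cases "display q e") (simp_all add: g_def h_def)
  qed
  have gh: "h e \<in> events ?r \<and> g (h e) = e" if e: "e \<in> events q" for e
  proof (cases "isl (display q e)")
    case False
    then have "e \<in> events (right_part q)" using e by simp
    then show ?thesis using False m[of e] by (simp add: g_def h_def)
  next
    case True
    then show ?thesis using e by (simp add: g_def h_def)
  qed
  show ?thesis
  proof (rule retract_isomorphic[where K = ?I and g = g and h = h and k = Inl, OF q _ hg gh _ g_mono _ _ down up])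
    show "seq ?r = Restr (?I\<^sup>*) (events ?r)" by simp
    show "(Inl e, Inl e') \<in> ?I" if "(e, e') \<in> seq q" "e \<noteq> e'" for e e'
      using that by (simp add: interaction_simps)
    show "(u, v) \<in> ?I\<^sup>*" if "(u, v) \<in> deseq ?r" for u v
    proof (cases "u = v")
      case False
      then show ?thesis
        using that ccs(2) causal_static[OF k]
        by (intro r_into_rtrancl) (auto simp: sum_rel_def interaction_simps seqcc)
    qed simp
    show "(u, v) \<in> deseq ?r \<longleftrightarrow> (g u, g v) \<in> deseq q" if "u \<in> events ?r" "v \<in> events ?r" for u v
    proof (cases "isl u \<longleftrightarrow> isl v")
      case True
      then show ?thesis using that ile unfolding ev by (auto simp: g_def)
    next
      case False
      then have "(u, v) \<notin> deseq ?r" by (cases u; cases v) simp_all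
      moreover have "isl (display q (g u)) \<longleftrightarrow> isl u" "isl (display q (g v)) \<longleftrightarrow> isl v"
        using hg[OF that(1)] hg[OF that(2)] by (cases u; cases v; simp)+
      ultimately show ?thesis using False configuration_component[OF c, of "g u" "g v"] by blast
    qed
  qed
qed

section \<open>Sums over isogmentations\<close>

lemma infsum_ennreal_Sup:
  fixes f :: "'i \<Rightarrow> ennreal"
  shows "infsum f A = (SUP F\<in>{F. finite F \<and> F \<subseteq> A}. sum f F)"
  by (rule nonneg_infsum_complete) simp

lemma sum_le_infsum_ennreal:
  fixes f :: "'i \<Rightarrow> ennreal"
  shows "finite F \<Longrightarrow> F \<subseteq> A \<Longrightarrow> sum f F \<le> infsum f A"
  unfolding infsum_ennreal_Sup by (rule SUP_upper) simp

lemma infsum_cmult_ennreal: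
  fixes f :: "'i \<Rightarrow> ennreal"
  shows "infsum (\<lambda>x. c * f x) A = c * infsum f A"
  unfolding infsum_ennreal_Sup SUP_mult_left_ennreal by (simp add: sum_distrib_left)

lemma infsum_Sigma_finite_ennreal:
  fixes f :: "'i \<times> 'j \<Rightarrow> ennreal"
  assumes "finite G"
  shows "infsum f (Sigma G B) = (\<Sum>a\<in>G. infsum (\<lambda>b. f (a, b)) (B a))"
  using assms
proof induction
  case (insert a G)
  have eq: "Sigma (insert a G) B = Pair a ` B a \<union> Sigma G B" by auto
  have "infsum f (Sigma (insert a G) B) = infsum f (Pair a ` B a) + infsum f (Sigma G B)"
    unfolding eq
    by (rule infsum_Un_disjoint) (use insert.hyps in \<open>auto intro: nonneg_summable_on_complete\<close>)
  also have "infsum f (Pair a ` B a) = infsum (\<lambda>b. f (a, b)) (B a)"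
    by (subst infsum_reindex) (auto simp: inj_on_def comp_def)
  finally show ?case using insert by simp
qed simp

text \<open>Both sides are suprema of finite sums. A finite set of pairs lies over finitely many
  first components, and over finitely many of these the exchange is additivity on disjoint fibres.
  Nonnegativity makes each such partial sum a lower bound for the other side.\<close>

lemma infsum_Sigma_ennreal:
  fixes f :: "'i \<times> 'j \<Rightarrow> ennreal"
  shows "infsum f (Sigma A B) = infsum (\<lambda>a. infsum (\<lambda>b. f (a, b)) (B a)) A"
proof (rule antisym)
  show "infsum f (Sigma A B) \<le> infsum (\<lambda>a. infsum (\<lambda>b. f (a, b)) (B a)) A"
    unfolding infsum_ennreal_Sup[of f]
  proof (rule SUP_least)
    fix F assume "F \<in> {F. finite F \<and> F \<subseteq> Sigma A B}"
    then have F: "finite F" "F \<subseteq> Sigma A B" by auto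
    have "sum f F \<le> infsum f (Sigma (fst ` F) B)"
      by (rule sum_le_infsum_ennreal) (use F in \<open>force+\<close>)
    also have "\<dots> = (\<Sum>a\<in>fst ` F. infsum (\<lambda>b. f (a, b)) (B a))"
      by (rule infsum_Sigma_finite_ennreal) (use F in simp)
    also have "\<dots> \<le> infsum (\<lambda>a. infsum (\<lambda>b. f (a, b)) (B a)) A"
      by (rule sum_le_infsum_ennreal) (use F in auto)
    finally show "sum f F \<le> infsum (\<lambda>a. infsum (\<lambda>b. f (a, b)) (B a)) A" .
  qed
  show "infsum (\<lambda>a. infsum (\<lambda>b. f (a, b)) (B a)) A \<le> infsum f (Sigma A B)"
    unfolding infsum_ennreal_Sup[of "\<lambda>a. infsum (\<lambda>b. f (a, b)) (B a)" A]
  proof (rule SUP_least)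
    fix G assume "G \<in> {G. finite G \<and> G \<subseteq> A}"
    then have G: "finite G" "G \<subseteq> A" by auto
    have "(\<Sum>a\<in>G. infsum (\<lambda>b. f (a, b)) (B a)) = infsum f (Sigma G B)"
      by (rule infsum_Sigma_finite_ennreal[symmetric, OF G(1)])
    also have "\<dots> \<le> infsum f (Sigma A B)"
      unfolding infsum_ennreal_Sup by (rule SUP_subset_mono) (use G in auto)
    finally show "(\<Sum>a\<in>G. infsum (\<lambda>b. f (a, b)) (B a)) \<le> infsum f (Sigma A B)" .
  qed
qed

section \<open>Cancellation and counting of symmetries\<close>

definition inverse_symmetry ::
  "('e, 'a, 'y) configuration_scheme \<Rightarrow> ('f, 'a, 'z) configuration_scheme \<Rightarrow> ('e \<Rightarrow> 'f) \<Rightarrow> 'f \<Rightarrow> 'e" where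
  "inverse_symmetry x y \<kappa> = restrict (inv_into (events x) \<kappa>) (events y)"

lemma inverse_symmetry:
  assumes "\<kappa> \<in> symmetries x y"
  shows "inverse_symmetry x y \<kappa> \<in> symmetries y x"
    "m \<in> events x \<Longrightarrow> inverse_symmetry x y \<kappa> (\<kappa> m) = m"
    "n \<in> events y \<Longrightarrow> \<kappa> (inverse_symmetry x y \<kappa> n) = n"
  using symmetries_inverse[OF assms] inv_symmetry_left[OF assms, of m] inv_symmetry[OF assms, of n]
    symmetries_in[OF assms, of m]
  by (simp_all add: inverse_symmetry_def)

text \<open>Symmetries are extensional, so agreement on events is equality. This makes the
  reindexing maps literally inverse to each other.\<close>

lemma symmetries_eqI:
  assumes "\<phi> \<in> symmetries x y" "\<psi> \<in> symmetries x z" "\<And>m. m \<in> events x \<Longrightarrow> \<phi> m = \<psi> m"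
  shows "\<phi> = \<psi>"
  using extensionalityI[OF symmetries_extensional[OF assms(1)] symmetries_extensional[OF assms(2)] assms(3)] .

lemma symmetries_pre_cancel:
  assumes \<kappa>: "\<kappa> \<in> symmetries x y" and \<psi>: "\<psi> \<in> symmetries x z"
  shows "restrict (restrict (\<psi> \<circ> inverse_symmetry x y \<kappa>) (events y) \<circ> \<kappa>) (events x) = \<psi>"
  by (rule symmetries_eqI[OF symmetries_compose[OF \<kappa> symmetries_compose[OF inverse_symmetry(1)[OF \<kappa>] \<psi>]] \<psi>])
    (simp add: symmetries_in[OF \<kappa>] inverse_symmetry(2)[OF \<kappa>])

lemma symmetries_pre_cancel':
  assumes \<kappa>: "\<kappa> \<in> symmetries x y" and \<chi>: "\<chi> \<in> symmetries y z"
  shows "restrict (restrict (\<chi> \<circ> \<kappa>) (events x) \<circ> inverse_symmetry x y \<kappa>) (events y) = \<chi>"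
  by (rule symmetries_eqI[OF symmetries_compose[OF inverse_symmetry(1)[OF \<kappa>] symmetries_compose[OF \<kappa> \<chi>]] \<chi>])
    (simp add: symmetries_in[OF inverse_symmetry(1)[OF \<kappa>]] inverse_symmetry(3)[OF \<kappa>])

lemma symmetries_post_cancel:
  assumes \<kappa>: "\<kappa> \<in> symmetries y z" and \<phi>: "\<phi> \<in> symmetries x y"
  shows "restrict (inverse_symmetry y z \<kappa> \<circ> restrict (\<kappa> \<circ> \<phi>) (events x)) (events x) = \<phi>"
  by (rule symmetries_eqI[OF symmetries_compose[OF symmetries_compose[OF \<phi> \<kappa>] inverse_symmetry(1)[OF \<kappa>]] \<phi>])
    (simp add: symmetries_in[OF \<phi>] inverse_symmetry(2)[OF \<kappa>])

lemma symmetries_post_cancel':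
  assumes \<kappa>: "\<kappa> \<in> symmetries y z" and \<chi>: "\<chi> \<in> symmetries x z"
  shows "restrict (\<kappa> \<circ> restrict (inverse_symmetry y z \<kappa> \<circ> \<chi>) (events x)) (events x) = \<chi>"
  by (rule symmetries_eqI[OF symmetries_compose[OF symmetries_compose[OF \<chi> inverse_symmetry(1)[OF \<kappa>]] \<kappa>] \<chi>])
    (simp add: symmetries_in[OF \<chi>] inverse_symmetry(3)[OF \<kappa>])

text \<open>Precomposition with \<open>\<kappa>\<close> is undone by precomposition with its
  inverse, so the count depends on the source only up to symmetry.\<close>

lemma card_symmetries_pre:
  assumes \<kappa>: "\<kappa> \<in> symmetries x y"
  shows "card (symmetries y z) = card (symmetries x z)"
proof (rule bij_betw_same_card)
  show "bij_betw (\<lambda>\<chi>. restrict (\<chi> \<circ> \<kappa>) (events x)) (symmetries y z) (symmetries x z)"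
    by (rule bij_betw_byWitness[where f' = "\<lambda>\<psi>. restrict (\<psi> \<circ> inverse_symmetry x y \<kappa>) (events y)"])
      (use symmetries_pre_cancel[OF \<kappa>] symmetries_pre_cancel'[OF \<kappa>] symmetries_compose[OF \<kappa>]
        symmetries_compose[OF inverse_symmetry(1)[OF \<kappa>]] in auto)
qed

lemma card_symmetries_post:
  assumes \<kappa>: "\<kappa> \<in> symmetries y z"
  shows "card (symmetries x y) = card (symmetries x z)"
proof (rule bij_betw_same_card)
  show "bij_betw (\<lambda>\<phi>. restrict (\<kappa> \<circ> \<phi>) (events x)) (symmetries x y) (symmetries x z)"
    by (rule bij_betw_byWitness[where f' = "\<lambda>\<chi>. restrict (inverse_symmetry y z \<kappa> \<circ> \<chi>) (events x)"])
      (use symmetries_post_cancel[OF \<kappa>] symmetries_post_cancel'[OF \<kappa>] symmetries_compose[OF _ \<kappa>]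
        symmetries_compose[OF _ inverse_symmetry(1)[OF \<kappa>]] in auto)
qed

lemma finite_symmetries:
  assumes "finite (events x)" "finite (events y)"
  shows "finite (symmetries x y)"
proof (rule finite_subset)
  show "symmetries x y \<subseteq> events x \<rightarrow>\<^sub>E events y"
  proof
    fix \<phi> assume \<phi>: "\<phi> \<in> symmetries x y"
    show "\<phi> \<in> events x \<rightarrow>\<^sub>E events y"
      using symmetries_in[OF \<phi>] symmetries_extensional[OF \<phi>] by (simp add: PiE_iff)
  qed
  show "finite (events x \<rightarrow>\<^sub>E events y)" using assms by (intro finite_PiE) auto
qed

section \<open>Chosen isomorphisms and index sets of composite strategies\<close>

definition rep_iso :: "'a arena \<Rightarrow> ('e, 'a) augmentation \<Rightarrow> 'e \<Rightarrow> nat" where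
  "rep_iso A q = (SOME f. f \<in> isomorphisms q (representative (isog_of A q)))"

lemma rep_iso: "augmentation A q \<Longrightarrow> rep_iso A q \<in> isomorphisms q (representative (isog_of A q))"
  using representative_isog_of(2)[of A q] unfolding rep_iso_def isomorphic_def
  by (intro someI_ex[of "\<lambda>f. f \<in> _"]) blast

type_synonym ('a, 'b, 'c) factorization =
  "(nat, 'a + 'b) augmentation set \<times> (nat, 'b + 'c) augmentation set \<times> (nat \<Rightarrow> nat)"

definition factorizations ::
  "'a arena \<Rightarrow> 'b arena \<Rightarrow> 'c arena \<Rightarrow> (nat, 'a + 'c) augmentation set \<Rightarrow>
   ('a, 'b, 'c) factorization set" where
  "factorizations A B C R = {(Q, P, \<phi>). Q \<in> Isog (A \<turnstile> B) \<and> P \<in> Isog (B \<turnstile> C) \<and>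
     \<phi> \<in> symmetries (right_part (representative Q)) (left_part (representative P)) \<and>
     compose_isog A B C P \<phi> Q = R}"

lemma compose_strat_eq:
  "R \<in> Isog (A \<turnstile> C) \<Longrightarrow> compose_strat A B C \<tau> \<sigma> R =
    (\<Sum>\<^sub>\<infinity>t\<in>factorizations A B C R. \<sigma> (fst t) * \<tau> (fst (snd t)))"
  by (simp add: compose_strat_def factorizations_def case_prod_unfold)

lemma compose_strat_in: "compose_strat A B C \<tau> \<sigma> \<in> strategies (A \<turnstile> C)"
  by (simp add: compose_strat_def strategies_def)

lemma id_strat_in: "id_strat A \<in> strategies (A \<turnstile> A)"
  by (simp add: id_strat_def strategies_def)

lemma strategy_eqI:
  assumes "\<sigma> \<in> strategies A" "\<tau> \<in> strategies A" "\<And>R. R \<in> Isog A \<Longrightarrow> \<sigma> R = \<tau> R"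
  shows "\<sigma> = \<tau>"
  using assms unfolding strategies_def by (metis PiE_ext)

section \<open>Associativity of strategies\<close>

abbreviation composite ::
  "'a arena \<Rightarrow> 'b arena \<Rightarrow> 'c arena \<Rightarrow> (nat, 'a + 'b) augmentation set \<Rightarrow>
   (nat, 'b + 'c) augmentation set \<Rightarrow> (nat \<Rightarrow> nat) \<Rightarrow> (nat + nat, 'a + 'c) augmentation" where
  "composite A B C Q P \<phi> \<equiv> compose_aug A B C (representative P) \<phi> (representative Q)"

text \<open>The chosen isomorphism from a composite to the representative of its class, read on the
  events inherited from the second factor. Precomposition turns a symmetry out of the representative
  of the composite into one out of \<open>representative P\<close>.\<close>

definition right_transport ::
  "'a arena \<Rightarrow> 'b arena \<Rightarrow> 'c arena \<Rightarrow> (nat, 'a + 'b) augmentation set \<Rightarrow>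
   (nat, 'b + 'c) augmentation set \<Rightarrow> (nat \<Rightarrow> nat) \<Rightarrow> nat \<Rightarrow> nat" where
  "right_transport A B C Q P \<phi> = restrict (\<lambda>m. rep_iso (A \<turnstile> C) (composite A B C Q P \<phi>) (Inr m))
     (events (right_part (representative P)))"

text \<open>Dually, postcomposition turns a symmetry into \<open>representative Q\<close> into one
  that ends in the representative of the composite.\<close>

definition left_transport ::
  "'a arena \<Rightarrow> 'b arena \<Rightarrow> 'c arena \<Rightarrow> (nat, 'a + 'b) augmentation set \<Rightarrow>
   (nat, 'b + 'c) augmentation set \<Rightarrow> (nat \<Rightarrow> nat) \<Rightarrow> nat \<Rightarrow> nat" where
  "left_transport A B C Q P \<phi> = restrict (\<lambda>m. rep_iso (A \<turnstile> C) (composite A B C Q P \<phi>) (Inl m))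
     (events (left_part (representative Q)))"

context
  fixes A :: "'a arena" and B :: "'b arena" and C :: "'c arena"
  assumes arenas: "arena A" "arena B" "arena C" and neg: "negative B"
begin

context
  fixes Q P \<phi>
  assumes Q: "Q \<in> Isog (A \<turnstile> B)" and P: "P \<in> Isog (B \<turnstile> C)"
    and \<phi>: "\<phi> \<in> symmetries (right_part (representative Q)) (left_part (representative P))"
begin

lemmas augmentation_composite = augmentation_compose[OF arenas neg representative_Isog(1)[OF Q]
    representative_Isog(1)[OF P] \<phi>]

lemma compose_isog_in: "compose_isog A B C P \<phi> Q \<in> Isog (A \<turnstile> C)"
  unfolding compose_isog_def by (rule isog_of_Isog[OF augmentation_composite])

end

lemma transport:
  assumes Q: "Q \<in> Isog (A \<turnstile> B)" and P: "P \<in> Isog (B \<turnstile> C)"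
    and \<phi>: "\<phi> \<in> symmetries (right_part (representative Q)) (left_part (representative P))"
  shows right_transport: "right_transport A B C Q P \<phi> \<in>
      symmetries (right_part (representative P)) (right_part (representative (compose_isog A B C P \<phi> Q)))"
    and left_transport: "left_transport A B C Q P \<phi> \<in>
      symmetries (left_part (representative Q)) (left_part (representative (compose_isog A B C P \<phi> Q)))"
proof -
  let ?r = "composite A B C Q P \<phi>" and ?q = "representative Q" and ?p = "representative P"
  note iso = rep_iso[OF augmentation_composite[OF Q P \<phi>]]
  have inr: "restrict Inr (events (right_part ?p)) \<in> symmetries (right_part ?p) (right_part ?r)"
  proof (rule symmetriesI)
    show "bij_betw Inr (events (right_part ?p)) (events (right_part ?r))"
      unfolding compose_parts by (auto simp: bij_betw_def inj_on_def)
  qed auto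
  have inl: "restrict Inl (events (left_part ?q)) \<in> symmetries (left_part ?q) (left_part ?r)"
  proof (rule symmetriesI)
    show "bij_betw Inl (events (left_part ?q)) (events (left_part ?r))"
      unfolding compose_parts by (auto simp: bij_betw_def inj_on_def)
  qed auto
  have "right_transport A B C Q P \<phi> = restrict (restrict (rep_iso (A \<turnstile> C) ?r) (events (right_part ?r)) \<circ>
      restrict Inr (events (right_part ?p))) (events (right_part ?p))"
    unfolding right_transport_def by (rule restrict_ext) simp
  then show "right_transport A B C Q P \<phi> \<in>
      symmetries (right_part ?p) (right_part (representative (compose_isog A B C P \<phi> Q)))"
    using symmetries_compose[OF inr isomorphisms_right_part[OF iso]] by (simp add: compose_isog_def)
  have "left_transport A B C Q P \<phi> = restrict (restrict (rep_iso (A \<turnstile> C) ?r) (events (left_part ?r)) \<circ>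
      restrict Inl (events (left_part ?q))) (events (left_part ?q))"
    unfolding left_transport_def by (rule restrict_ext) simp
  then show "left_transport A B C Q P \<phi> \<in>
      symmetries (left_part ?q) (left_part (representative (compose_isog A B C P \<phi> Q)))"
    using symmetries_compose[OF inl isomorphisms_left_part[OF iso]] by (simp add: compose_isog_def)
qed

end

text \<open>The class of a composite of three representatives, formed without replacing the inner
  composite by a representative. Both nested compositions are compared with it.\<close>

definition triple_isog ::
  "'a arena \<Rightarrow> 'b arena \<Rightarrow> 'c arena \<Rightarrow> 'd arena \<Rightarrow> (nat, 'a + 'b) augmentation set \<Rightarrow>
   (nat, 'b + 'c) augmentation set \<Rightarrow> (nat, 'c + 'd) augmentation set \<Rightarrow> (nat \<Rightarrow> nat) \<Rightarrow> (nat \<Rightarrow> nat) \<Rightarrow>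
   (nat, 'a + 'd) augmentation set" where
  "triple_isog A B C D Q P S \<phi> \<psi> =
    (let r = composite A B C Q P \<phi>
     in isog_of (A \<turnstile> D) (compose_aug A C D (representative S) (lift_right r \<psi>) r))"

text \<open>By \<open>compose_isomorphic\<close>, the inner composite may be replaced by the
  representative of its class when the outer symmetry is adjusted along the chosen
  isomorphism.\<close>

lemma compose_isog_left:
  fixes A :: "'a arena" and B :: "'b arena" and C :: "'c arena" and D :: "'d arena"
  assumes arenas: "arena A" "arena B" "arena C" "arena D" and neg: "negative B" "negative C"
    and Q: "Q \<in> Isog (A \<turnstile> B)" and P: "P \<in> Isog (B \<turnstile> C)" and S: "S \<in> Isog (C \<turnstile> D)"
    and \<phi>: "\<phi> \<in> symmetries (right_part (representative Q)) (left_part (representative P))"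
    and \<chi>: "\<chi> \<in> symmetries (right_part (representative (compose_isog A B C P \<phi> Q)))
      (left_part (representative S))"
  shows "compose_isog A C D S \<chi> (compose_isog A B C P \<phi> Q) =
    triple_isog A B C D Q P S \<phi>
      (restrict (\<chi> \<circ> right_transport A B C Q P \<phi>) (events (right_part (representative P))))"
proof -
  let ?r = "compose_aug A B C (representative P) \<phi> (representative Q)"
  let ?X = "compose_isog A B C P \<phi> Q"
  let ?\<kappa> = "right_transport A B C Q P \<phi>"
  let ?\<psi> = "restrict (\<chi> \<circ> ?\<kappa>) (events (right_part (representative P)))"
  note r = augmentation_composite[OF arenas(1-3) neg(1) Q P \<phi>]
  have X: "?X \<in> Isog (A \<turnstile> C)" by (rule compose_isog_in[OF arenas(1-3) neg(1) Q P \<phi>])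
  note x = representative_Isog(1)[OF X] and s = representative_Isog(1)[OF S]
  note \<kappa> = right_transport[OF arenas(1-3) neg(1) Q P \<phi>]
  have \<psi>: "?\<psi> \<in> symmetries (right_part (representative P)) (left_part (representative S))"
    by (rule symmetries_compose[OF \<kappa> \<chi>])
  note l = lift_right_symmetry[OF \<psi>, of A B C \<phi> "representative Q"]
  have iso: "rep_iso (A \<turnstile> C) ?r \<in> isomorphisms ?r (representative ?X)"
    using rep_iso[OF r] by (simp add: compose_isog_def)
  have "compose_aug A C D (representative S) (lift_right ?r ?\<psi>) ?r \<simeq>
      compose_aug A C D (representative S) \<chi> (representative ?X)"
  proof (rule compose_isomorphic[OF r x s s iso isomorphisms_id l \<chi>])
    fix e assume e: "e \<in> events (right_part ?r)"
    then obtain m where m: "e = Inr m" "m \<in> events (right_part (representative P))"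
      unfolding compose_parts by blast
    have "lift_right ?r ?\<psi> e \<in> events (representative S)"
      using symmetries_in[OF l e] by simp
    moreover have "lift_right ?r ?\<psi> e = \<chi> (rep_iso (A \<turnstile> C) ?r e)"
      using e m by (simp add: lift_right_def right_transport_def)
    ultimately show "\<chi> (rep_iso (A \<turnstile> C) ?r e) = restrict id (events (representative S)) (lift_right ?r ?\<psi> e)"
      by simp
  qed
  then show ?thesis
    unfolding triple_isog_def Let_def compose_isog_def[of A C D]
    using isog_of_eq_iff[OF augmentation_compose[OF arenas(1,3,4) neg(2) r s l]
        augmentation_compose[OF arenas(1,3,4) neg(2) x s \<chi>]] by simp
qed

text \<open>Besides the replacement of the inner composite by a representative, this bracketing
  needs \<open>compose_associative\<close>, as \<open>triple_isog\<close> is defined through the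
  other one.\<close>

lemma compose_isog_right:
  fixes A :: "'a arena" and B :: "'b arena" and C :: "'c arena" and D :: "'d arena"
  assumes arenas: "arena A" "arena B" "arena C" "arena D" and neg: "negative B" "negative C"
    and Q: "Q \<in> Isog (A \<turnstile> B)" and P: "P \<in> Isog (B \<turnstile> C)" and S: "S \<in> Isog (C \<turnstile> D)"
    and \<psi>: "\<psi> \<in> symmetries (right_part (representative P)) (left_part (representative S))"
    and \<phi>: "\<phi> \<in> symmetries (right_part (representative Q)) (left_part (representative P))"
  shows "compose_isog A B D (compose_isog B C D S \<psi> P)
      (restrict (left_transport B C D P S \<psi> \<circ> \<phi>) (events (right_part (representative Q)))) Q =
    triple_isog A B C D Q P S \<phi> \<psi>"
proof -
  let ?r = "compose_aug B C D (representative S) \<psi> (representative P)"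
  let ?X = "compose_isog B C D S \<psi> P"
  let ?\<kappa> = "left_transport B C D P S \<psi>"
  let ?\<chi> = "restrict (?\<kappa> \<circ> \<phi>) (events (right_part (representative Q)))"
  note r = augmentation_composite[OF arenas(2-4) neg(2) P S \<psi>]
  have X: "?X \<in> Isog (B \<turnstile> D)" by (rule compose_isog_in[OF arenas(2-4) neg(2) P S \<psi>])
  note x = representative_Isog(1)[OF X] and q = representative_Isog(1)[OF Q]
    and p = representative_Isog(1)[OF P] and s = representative_Isog(1)[OF S]
  note \<kappa> = left_transport[OF arenas(2-4) neg(2) P S \<psi>]
  have \<chi>: "?\<chi> \<in> symmetries (right_part (representative Q)) (left_part (representative ?X))"
    by (rule symmetries_compose[OF \<phi> \<kappa>])
  note l = lift_left_symmetry[OF \<phi>, of B C D "representative S" \<psi>]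
  have iso: "rep_iso (B \<turnstile> D) ?r \<in> isomorphisms ?r (representative ?X)"
    using rep_iso[OF r] by (simp add: compose_isog_def)
  have 1: "compose_aug A B D ?r (lift_left (representative Q) \<phi>) (representative Q) \<simeq>
      compose_aug A B D (representative ?X) ?\<chi> (representative Q)"
  proof (rule compose_isomorphic[OF q q r x isomorphisms_id iso l \<chi>])
    fix m assume m: "m \<in> events (right_part (representative Q))"
    have "\<phi> m \<in> events (left_part (representative P))" by (rule symmetries_in[OF \<phi> m])
    then show "?\<chi> (restrict id (events (representative Q)) m) =
        rep_iso (B \<turnstile> D) ?r (lift_left (representative Q) \<phi> m)"
      using m by (simp add: lift_left_def left_transport_def)
  qed
  note r' = augmentation_composite[OF arenas(1-3) neg(1) Q P \<phi>]
  have 2: "compose_aug A C D (representative S)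
      (lift_right (compose_aug A B C (representative P) \<phi> (representative Q)) \<psi>)
      (compose_aug A B C (representative P) \<phi> (representative Q)) \<simeq>
    compose_aug A B D (representative ?X) ?\<chi> (representative Q)"
    by (rule isomorphic_trans[OF compose_associative[OF q p s \<phi> \<psi>] 1])
  show ?thesis
    unfolding triple_isog_def Let_def compose_isog_def[of A B D]
    using isog_of_eq_iff[OF augmentation_compose[OF arenas(1,3,4) neg(2) r' s
          lift_right_symmetry[OF \<psi>, of A B C \<phi> "representative Q"]]
        augmentation_compose[OF arenas(1,2,4) neg(1) q x \<chi>]] 2 by simp
qed

type_synonym ('a, 'b, 'c, 'd) triple =
  "(nat, 'a + 'b) augmentation set \<times> (nat, 'b + 'c) augmentation set \<times>
   (nat, 'c + 'd) augmentation set \<times> (nat \<Rightarrow> nat) \<times> (nat \<Rightarrow> nat)"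

definition triples ::
  "'a arena \<Rightarrow> 'b arena \<Rightarrow> 'c arena \<Rightarrow> 'd arena \<Rightarrow> (nat, 'a + 'd) augmentation set \<Rightarrow>
   ('a, 'b, 'c, 'd) triple set" where
  "triples A B C D R = {(Q, P, S, \<phi>, \<psi>). Q \<in> Isog (A \<turnstile> B) \<and> P \<in> Isog (B \<turnstile> C) \<and> S \<in> Isog (C \<turnstile> D) \<and>
     \<phi> \<in> symmetries (right_part (representative Q)) (left_part (representative P)) \<and>
     \<psi> \<in> symmetries (right_part (representative P)) (left_part (representative S)) \<and>
     triple_isog A B C D Q P S \<phi> \<psi> = R}"

text \<open>The inner class \<open>X\<close> is determined by the inner factorization, so a nested
  pair of factorizations carries the same data as a triple, up to the outer symmetry.
  \<open>j\<close> precomposes that symmetry with the transport and \<open>i\<close> with its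
  inverse.\<close>

lemma compose_strat_left:
  fixes A :: "'a arena" and B :: "'b arena" and C :: "'c arena" and D :: "'d arena"
  assumes arenas: "arena A" "arena B" "arena C" "arena D" and neg: "negative B" "negative C"
    and R: "R \<in> Isog (A \<turnstile> D)"
  shows "compose_strat A C D h (compose_strat A B C g f) R =
    (\<Sum>\<^sub>\<infinity>(Q, P, S, \<phi>, \<psi>)\<in>triples A B C D R. f Q * g P * h S)"
proof -
  let ?F = "factorizations A C D R" and ?G = "factorizations A B C"
  define \<kappa> where "\<kappa> = right_transport A B C"
  define w where "w = (\<lambda>(t :: ('a, 'c, 'd) factorization) (u :: ('a, 'b, 'c) factorization).
    f (fst u) * g (fst (snd u)) * h (fst (snd t)))"
  define j :: "('a, 'c, 'd) factorization \<times> ('a, 'b, 'c) factorization \<Rightarrow> ('a, 'b, 'c, 'd) triple" where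
    "j = (\<lambda>((X, S, \<chi>), (Q, P, \<phi>)).
    (Q, P, S, \<phi>, restrict (\<chi> \<circ> \<kappa> Q P \<phi>) (events (right_part (representative P)))))"
  define i :: "('a, 'b, 'c, 'd) triple \<Rightarrow> ('a, 'c, 'd) factorization \<times> ('a, 'b, 'c) factorization" where
    "i = (\<lambda>(Q, P, S, \<phi>, \<psi>). let X = compose_isog A B C P \<phi> Q in
    ((X, S, restrict (\<psi> \<circ> inverse_symmetry (right_part (representative P)) (right_part (representative X))
        (\<kappa> Q P \<phi>)) (events (right_part (representative X)))), (Q, P, \<phi>)))"
  note \<kappa> = right_transport[OF arenas(1-3) neg(1), folded \<kappa>_def]
  note cl = compose_isog_left[OF arenas neg, folded \<kappa>_def]
  have "compose_strat A C D h (compose_strat A B C g f) R =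
      (\<Sum>\<^sub>\<infinity>t\<in>?F. compose_strat A B C g f (fst t) * h (fst (snd t)))"
    by (rule compose_strat_eq[OF R])
  also have "\<dots> = (\<Sum>\<^sub>\<infinity>t\<in>?F. \<Sum>\<^sub>\<infinity>u\<in>?G (fst t). w t u)"
  proof (rule infsum_cong)
    fix t assume "t \<in> ?F"
    then have "fst t \<in> Isog (A \<turnstile> C)" by (auto simp: factorizations_def)
    then have "compose_strat A B C g f (fst t) * h (fst (snd t)) =
        h (fst (snd t)) * (\<Sum>\<^sub>\<infinity>u\<in>?G (fst t). f (fst u) * g (fst (snd u)))"
      by (simp add: compose_strat_eq mult.commute)
    then show "compose_strat A B C g f (fst t) * h (fst (snd t)) = (\<Sum>\<^sub>\<infinity>u\<in>?G (fst t). w t u)"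
      unfolding infsum_cmult_ennreal[symmetric] w_def by (simp add: mult.commute)
  qed
  also have "\<dots> = (\<Sum>\<^sub>\<infinity>x\<in>Sigma ?F (\<lambda>t. ?G (fst t)). w (fst x) (snd x))"
    by (simp add: infsum_Sigma_ennreal)
  also have "\<dots> = (\<Sum>\<^sub>\<infinity>(Q, P, S, \<phi>, \<psi>)\<in>triples A B C D R. f Q * g P * h S)"
  proof (rule infsum_reindex_bij_witness[where i = i and j = j])
    fix a assume a: "a \<in> Sigma ?F (\<lambda>t. ?G (fst t))"
    obtain X S \<chi> Q P \<phi> where a_eq: "a = ((X, S, \<chi>), (Q, P, \<phi>))" by (metis prod.exhaust)
    from a have F: "X \<in> Isog (A \<turnstile> C)" "S \<in> Isog (C \<turnstile> D)"
      "\<chi> \<in> symmetries (right_part (representative X)) (left_part (representative S))"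
      "compose_isog A C D S \<chi> X = R"
      and G: "Q \<in> Isog (A \<turnstile> B)" "P \<in> Isog (B \<turnstile> C)"
      "\<phi> \<in> symmetries (right_part (representative Q)) (left_part (representative P))"
      "X = compose_isog A B C P \<phi> Q"
      unfolding a_eq factorizations_def by auto
    note k = \<kappa>[OF G(1-3)]
    show "i (j a) = a"
      using symmetries_pre_cancel'[OF k F(3)[unfolded G(4)]] G(4)
      by (simp add: a_eq i_def j_def Let_def)
    show "j a \<in> triples A B C D R"
      using F G symmetries_compose[OF k F(3)[unfolded G(4)]] cl[OF G(1,2) F(2) G(3) F(3)[unfolded G(4)]]
      by (simp add: a_eq j_def triples_def)
    show "(case j a of (Q, P, S, \<phi>, \<psi>) \<Rightarrow> f Q * g P * h S) = w (fst a) (snd a)"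
      by (simp add: a_eq j_def w_def)
  next
    fix b assume b: "b \<in> triples A B C D R"
    obtain Q P S \<phi> \<psi> where b_eq: "b = (Q, P, S, \<phi>, \<psi>)" by (metis prod.exhaust)
    from b have Q: "Q \<in> Isog (A \<turnstile> B)" and P: "P \<in> Isog (B \<turnstile> C)" and S: "S \<in> Isog (C \<turnstile> D)"
      and \<phi>: "\<phi> \<in> symmetries (right_part (representative Q)) (left_part (representative P))"
      and \<psi>: "\<psi> \<in> symmetries (right_part (representative P)) (left_part (representative S))"
      and T: "triple_isog A B C D Q P S \<phi> \<psi> = R"
      unfolding b_eq triples_def by auto
    note k = \<kappa>[OF Q P \<phi>]
    note c = symmetries_pre_cancel[OF k \<psi>]
    note \<chi> = symmetries_compose[OF inverse_symmetry(1)[OF k] \<psi>]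
    note X = compose_isog_in[OF arenas(1-3) neg(1) Q P \<phi>]
    show "j (i b) = b" using c by (simp add: b_eq i_def j_def Let_def)
    show "i b \<in> Sigma ?F (\<lambda>t. ?G (fst t))"
      using Q P S \<phi> X \<chi> cl[OF Q P S \<phi> \<chi>, unfolded c] T
      by (simp add: b_eq i_def Let_def factorizations_def)
  qed
  finally show ?thesis .
qed

text \<open>Here the outer symmetry ends in the representative of the inner composite, so it is
  adjusted by postcomposition: \<open>i\<close> applies the transport and \<open>j\<close> undoes
  it.\<close>

lemma compose_strat_right:
  fixes A :: "'a arena" and B :: "'b arena" and C :: "'c arena" and D :: "'d arena"
  assumes arenas: "arena A" "arena B" "arena C" "arena D" and neg: "negative B" "negative C"
    and R: "R \<in> Isog (A \<turnstile> D)"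
  shows "compose_strat A B D (compose_strat B C D h g) f R =
    (\<Sum>\<^sub>\<infinity>(Q, P, S, \<phi>, \<psi>)\<in>triples A B C D R. f Q * g P * h S)"
proof -
  let ?F = "factorizations A B D R" and ?G = "factorizations B C D"
  define \<kappa> where "\<kappa> = left_transport B C D"
  define w where "w = (\<lambda>(t :: ('a, 'b, 'd) factorization) (u :: ('b, 'c, 'd) factorization).
    f (fst t) * g (fst u) * h (fst (snd u)))"
  define j :: "('a, 'b, 'd) factorization \<times> ('b, 'c, 'd) factorization \<Rightarrow> ('a, 'b, 'c, 'd) triple" where
    "j = (\<lambda>((Q, Y, \<chi>), (P, S, \<psi>)).
    (Q, P, S, restrict (inverse_symmetry (left_part (representative P)) (left_part (representative Y))
      (\<kappa> P S \<psi>) \<circ> \<chi>) (events (right_part (representative Q))), \<psi>))"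
  define i :: "('a, 'b, 'c, 'd) triple \<Rightarrow> ('a, 'b, 'd) factorization \<times> ('b, 'c, 'd) factorization" where
    "i = (\<lambda>(Q, P, S, \<phi>, \<psi>).
    ((Q, compose_isog B C D S \<psi> P, restrict (\<kappa> P S \<psi> \<circ> \<phi>) (events (right_part (representative Q)))),
     (P, S, \<psi>)))"
  note \<kappa> = left_transport[OF arenas(2-4) neg(2), folded \<kappa>_def]
  note cr = compose_isog_right[OF arenas neg, folded \<kappa>_def]
  have "compose_strat A B D (compose_strat B C D h g) f R =
      (\<Sum>\<^sub>\<infinity>t\<in>?F. f (fst t) * compose_strat B C D h g (fst (snd t)))"
    by (rule compose_strat_eq[OF R])
  also have "\<dots> = (\<Sum>\<^sub>\<infinity>t\<in>?F. \<Sum>\<^sub>\<infinity>u\<in>?G (fst (snd t)). w t u)"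
  proof (rule infsum_cong)
    fix t assume "t \<in> ?F"
    then have "fst (snd t) \<in> Isog (B \<turnstile> D)" by (auto simp: factorizations_def)
    then show "f (fst t) * compose_strat B C D h g (fst (snd t)) = (\<Sum>\<^sub>\<infinity>u\<in>?G (fst (snd t)). w t u)"
      unfolding w_def by (simp add: compose_strat_eq infsum_cmult_ennreal mult.assoc)
  qed
  also have "\<dots> = (\<Sum>\<^sub>\<infinity>x\<in>Sigma ?F (\<lambda>t. ?G (fst (snd t))). w (fst x) (snd x))"
    by (simp add: infsum_Sigma_ennreal)
  also have "\<dots> = (\<Sum>\<^sub>\<infinity>(Q, P, S, \<phi>, \<psi>)\<in>triples A B C D R. f Q * g P * h S)"
  proof (rule infsum_reindex_bij_witness[where i = i and j = j])
    fix a assume a: "a \<in> Sigma ?F (\<lambda>t. ?G (fst (snd t)))"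
    obtain Q Y \<chi> P S \<psi> where a_eq: "a = ((Q, Y, \<chi>), (P, S, \<psi>))" by (metis prod.exhaust)
    from a have F: "Q \<in> Isog (A \<turnstile> B)"
      "\<chi> \<in> symmetries (right_part (representative Q)) (left_part (representative Y))"
      "compose_isog A B D Y \<chi> Q = R"
      and G: "P \<in> Isog (B \<turnstile> C)" "S \<in> Isog (C \<turnstile> D)"
      "\<psi> \<in> symmetries (right_part (representative P)) (left_part (representative S))"
      "Y = compose_isog B C D S \<psi> P"
      unfolding a_eq factorizations_def by auto
    note k = \<kappa>[OF G(1-3)]
    note c = symmetries_post_cancel'[OF k F(2)[unfolded G(4)]]
    note \<phi> = symmetries_compose[OF F(2)[unfolded G(4)] inverse_symmetry(1)[OF k]]
    show "i (j a) = a" using c G(4) by (simp add: a_eq i_def j_def)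
    show "j a \<in> triples A B C D R"
      using F G \<phi> cr[OF F(1) G(1-3) \<phi>, unfolded c] by (simp add: a_eq j_def triples_def)
    show "(case j a of (Q, P, S, \<phi>, \<psi>) \<Rightarrow> f Q * g P * h S) = w (fst a) (snd a)"
      by (simp add: a_eq j_def w_def)
  next
    fix b assume b: "b \<in> triples A B C D R"
    obtain Q P S \<phi> \<psi> where b_eq: "b = (Q, P, S, \<phi>, \<psi>)" by (metis prod.exhaust)
    from b have Q: "Q \<in> Isog (A \<turnstile> B)" and P: "P \<in> Isog (B \<turnstile> C)" and S: "S \<in> Isog (C \<turnstile> D)"
      and \<phi>: "\<phi> \<in> symmetries (right_part (representative Q)) (left_part (representative P))"
      and \<psi>: "\<psi> \<in> symmetries (right_part (representative P)) (left_part (representative S))"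
      and T: "triple_isog A B C D Q P S \<phi> \<psi> = R"
      unfolding b_eq triples_def by auto
    note k = \<kappa>[OF P S \<psi>]
    note c = symmetries_post_cancel[OF k \<phi>]
    note \<chi> = symmetries_compose[OF \<phi> k]
    note X = compose_isog_in[OF arenas(2-4) neg(2) P S \<psi>]
    show "j (i b) = b" using c by (simp add: b_eq i_def j_def)
    show "i b \<in> Sigma ?F (\<lambda>t. ?G (fst (snd t)))"
      using Q P S \<psi> X \<chi> cr[OF Q P S \<psi> \<phi>] T
      by (simp add: b_eq i_def factorizations_def)
  qed
  finally show ?thesis .
qed

section \<open>Identity strategies\<close>

lemma position_of_eq:
  assumes \<kappa>: "\<kappa> \<in> symmetries x y"
  shows "position_of A x = position_of A y"
  unfolding position_of_def
  using symmetries_compose[OF \<kappa>] symmetries_compose[OF inverse_symmetry(1)[OF \<kappa>]] by blast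

lemma representative_position_of:
  fixes x :: "(nat, 'a) configuration"
  assumes "configuration A x"
  shows "configuration A (representative (position_of A x))"
    "symmetries x (representative (position_of A x)) \<noteq> {}"
proof -
  have "x \<in> position_of A x" using assms symmetries_id[of x] by (auto simp: position_of_def)
  then have "representative (position_of A x) \<in> position_of A x"
    unfolding representative_def by (rule someI)
  then show "configuration A (representative (position_of A x))"
    "symmetries x (representative (position_of A x)) \<noteq> {}" by (auto simp: position_of_def)
qed

lemma representative_position:
  assumes "X \<in> Positions A"
  shows "configuration A (representative X)" "position_of A (representative X) = X"
proof -
  obtain x :: "(nat, 'a) configuration" where x: "configuration A x" "X = position_of A x"
    using assms by (auto simp: Positions_def)
  show "configuration A (representative X)" using representative_position_of(1)[OF x(1)] x(2) by simp
  obtain \<kappa> where "\<kappa> \<in> symmetries x (representative X)"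
    using representative_position_of(2)[OF x(1)] x(2) by blast
  from position_of_eq[OF this, of A] show "position_of A (representative X) = X" using x(2) by simp
qed

lemma copycat_part_symmetries:
  "restrict Inr (events x) \<in> symmetries x (right_part (copycat A x))"
  "restrict Inl (events x) \<in> symmetries x (left_part (copycat A x))"
proof -
  show "restrict Inr (events x) \<in> symmetries x (right_part (copycat A x))"
  proof (rule symmetriesI)
    show "bij_betw Inr (events x) (events (right_part (copycat A x)))"
      unfolding copycat_parts by (auto simp: bij_betw_def inj_on_def)
  qed auto
  show "restrict Inl (events x) \<in> symmetries x (left_part (copycat A x))"
  proof (rule symmetriesI)
    show "bij_betw Inl (events x) (events (left_part (copycat A x)))"
      unfolding copycat_parts by (auto simp: bij_betw_def inj_on_def)
  qed auto
qed

lemma copycat_isog_in: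
  assumes "arena A" "X \<in> Positions A"
  shows "copycat_isog A X \<in> Isog (A \<turnstile> A)"
  unfolding copycat_isog_def
  by (rule isog_of_Isog[OF augmentation_copycat[OF assms(1) representative_position(1)[OF assms(2)]]])

text \<open>Both components of a copycat are copies of the underlying configuration, and the chosen
  isomorphism carries them to the components of the representative of the class.\<close>

lemma copycat_isog_parts:
  assumes A: "arena A" and X: "X \<in> Positions A"
  obtains \<kappa> \<mu> where
    "\<kappa> \<in> symmetries (representative X) (right_part (representative (copycat_isog A X)))"
    "\<mu> \<in> symmetries (representative X) (left_part (representative (copycat_isog A X)))"
proof -
  note iso = rep_iso[OF augmentation_copycat[OF A representative_position(1)[OF X]]]
  note r = symmetries_compose[OF copycat_part_symmetries(1) isomorphisms_right_part[OF iso],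
      folded copycat_isog_def]
  note l = symmetries_compose[OF copycat_part_symmetries(2) isomorphisms_left_part[OF iso],
      folded copycat_isog_def]
  show ?thesis by (rule that[OF r l])
qed

text \<open>The position is recovered as that of the right component of a representative.\<close>

lemma copycat_isog_inject:
  assumes A: "arena A" and X: "X \<in> Positions A" and Y: "Y \<in> Positions A"
    and eq: "copycat_isog A X = copycat_isog A Y"
  shows "X = Y"
proof -
  obtain \<kappa> where "\<kappa> \<in> symmetries (representative X) (right_part (representative (copycat_isog A X)))"
    using copycat_isog_parts[OF A X] by blast
  moreover obtain \<mu> where
    "\<mu> \<in> symmetries (representative Y) (right_part (representative (copycat_isog A X)))"
    using copycat_isog_parts[OF A Y] eq by metis
  ultimately have "position_of A (representative X) = position_of A (representative Y)"
    using position_of_eq by metis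
  then show ?thesis using representative_position(2) X Y by metis
qed

text \<open>Injectivity of \<open>copycat_isog\<close> on positions evaluates the definite
  description in \<open>id_strat\<close>.\<close>

lemma id_strat_copycat:
  assumes A: "arena A" and X: "X \<in> Positions A"
  shows "id_strat A (copycat_isog A X) = 1 / of_nat (card (Sym X))"
proof -
  have "(THE Y. Y \<in> Positions A \<and> copycat_isog A X = copycat_isog A Y) = X"
  proof (rule the_equality)
    show "X \<in> Positions A \<and> copycat_isog A X = copycat_isog A X" using X by simp
    show "Y = X" if "Y \<in> Positions A \<and> copycat_isog A X = copycat_isog A Y" for Y
      using copycat_isog_inject[OF A X conjunct1[OF that] conjunct2[OF that]] by (rule sym)
  qed
  moreover have "\<exists>Y\<in>Positions A. copycat_isog A X = copycat_isog A Y" using X by blast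
  ultimately show ?thesis
    unfolding id_strat_def restrict_apply'[OF copycat_isog_in[OF A X]] by (simp only: if_True)
qed

lemma id_strat_nonzero:
  "Q \<in> Isog (A \<turnstile> A) \<Longrightarrow> id_strat A Q \<noteq> 0 \<Longrightarrow> \<exists>X\<in>Positions A. Q = copycat_isog A X"
  by (rule ccontr) (simp add: id_strat_def)

text \<open>The representative of the class is merely isomorphic to a copycat; precomposing
  \<open>\<phi>\<close> with the chosen isomorphism reduces the claim to the literal copycat. As the
  result is the same for every \<open>\<phi>\<close>, all symmetries contribute to the same
  coefficient.\<close>

lemma compose_isog_copycat_right:
  fixes A :: "'a arena" and B :: "'b arena"
  assumes A: "arena A" and X: "X \<in> Positions A" and P: "P \<in> Isog (A \<turnstile> B)"
    and \<phi>: "\<phi> \<in> symmetries (right_part (representative (copycat_isog A X))) (left_part (representative P))"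
  shows "compose_isog A A B P \<phi> (copycat_isog A X) = P"
proof -
  let ?c = "copycat A (representative X)" and ?q = "representative (copycat_isog A X)"
  note x = representative_position(1)[OF X]
  note c = augmentation_copycat[OF A x] and p = representative_Isog(1)[OF P]
  note q = representative_Isog(1)[OF copycat_isog_in[OF A X]]
  have iso: "rep_iso (A \<turnstile> A) ?c \<in> isomorphisms ?c ?q"
    using rep_iso[OF c] by (simp add: copycat_isog_def)
  note \<phi>' = symmetries_compose[OF isomorphisms_right_part[OF iso] \<phi>]
  let ?\<phi>' = "restrict (\<phi> \<circ> restrict (rep_iso (A \<turnstile> A) ?c) (events (right_part ?c))) (events (right_part ?c))"
  have "compose_aug A A B (representative P) ?\<phi>' ?c \<simeq> compose_aug A A B (representative P) \<phi> ?q"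
  proof (rule compose_isomorphic[OF c q p p iso isomorphisms_id \<phi>' \<phi>])
    fix m assume m: "m \<in> events (right_part ?c)"
    have "?\<phi>' m \<in> events (representative P)" using symmetries_in[OF \<phi>' m] by simp
    moreover have "?\<phi>' m = \<phi> (rep_iso (A \<turnstile> A) ?c m)" using m by simp
    ultimately show "\<phi> (rep_iso (A \<turnstile> A) ?c m) = restrict id (events (representative P)) (?\<phi>' m)"
      by simp
  qed
  then have "compose_aug A A B (representative P) \<phi> ?q \<simeq> representative P"
    by (rule isomorphic_trans[OF isomorphic_sym compose_copycat_right[OF A x p \<phi>']])
  then have "isog_of (A \<turnstile> B) (compose_aug A A B (representative P) \<phi> ?q) =
      isog_of (A \<turnstile> B) (representative P)" by (rule isog_of_cong)
  then show ?thesis using representative_Isog(2)[OF P] by (simp add: compose_isog_def)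
qed

text \<open>Now the copycat is the target of \<open>\<phi>\<close>, so the reduction postcomposes
  with the inverse of the chosen isomorphism.\<close>

lemma compose_isog_copycat_left:
  fixes A :: "'a arena" and B :: "'b arena"
  assumes B: "arena B" and Y: "Y \<in> Positions B" and Q: "Q \<in> Isog (A \<turnstile> B)"
    and \<phi>: "\<phi> \<in> symmetries (right_part (representative Q)) (left_part (representative (copycat_isog B Y)))"
  shows "compose_isog A B B (copycat_isog B Y) \<phi> Q = Q"
proof -
  let ?c = "copycat B (representative Y)" and ?p = "representative (copycat_isog B Y)"
  note y = representative_position(1)[OF Y]
  note c = augmentation_copycat[OF B y] and q = representative_Isog(1)[OF Q]
  note p = representative_Isog(1)[OF copycat_isog_in[OF B Y]]
  have iso: "rep_iso (B \<turnstile> B) ?c \<in> isomorphisms ?c ?p"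
    using rep_iso[OF c] by (simp add: copycat_isog_def)
  note \<iota> = isomorphisms_left_part[OF iso]
  let ?\<phi>' = "restrict (inverse_symmetry (left_part ?c) (left_part ?p)
    (restrict (rep_iso (B \<turnstile> B) ?c) (events (left_part ?c))) \<circ> \<phi>) (events (right_part (representative Q)))"
  note \<phi>' = symmetries_compose[OF \<phi> inverse_symmetry(1)[OF \<iota>]]
  have "compose_aug A B B ?c ?\<phi>' (representative Q) \<simeq> compose_aug A B B ?p \<phi> (representative Q)"
  proof (rule compose_isomorphic[OF q q c p isomorphisms_id iso \<phi>' \<phi>])
    fix m assume m: "m \<in> events (right_part (representative Q))"
    have "?\<phi>' m \<in> events (left_part ?c)" by (rule symmetries_in[OF \<phi>' m])
    moreover have "restrict (rep_iso (B \<turnstile> B) ?c) (events (left_part ?c)) (?\<phi>' m) = \<phi> m"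
      using m inverse_symmetry(3)[OF \<iota> symmetries_in[OF \<phi> m]] by simp
    ultimately have "rep_iso (B \<turnstile> B) ?c (?\<phi>' m) = \<phi> m" by (simp only: restrict_apply')
    then show "\<phi> (restrict id (events (representative Q)) m) = rep_iso (B \<turnstile> B) ?c (?\<phi>' m)"
      using m by simp
  qed
  then have "compose_aug A B B ?p \<phi> (representative Q) \<simeq> representative Q"
    by (rule isomorphic_trans[OF isomorphic_sym compose_copycat_left[OF B y q \<phi>']])
  then have "isog_of (A \<turnstile> B) (compose_aug A B B ?p \<phi> (representative Q)) =
      isog_of (A \<turnstile> B) (representative Q)" by (rule isog_of_cong)
  then show ?thesis using representative_Isog(2)[OF Q] by (simp add: compose_isog_def)
qed

text \<open>Both \<open>x\<close> and \<open>y\<close> are symmetric to the representative of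
  \<open>X\<close>, so there are as many symmetries between them as that representative has with
  itself. This number is finite and nonzero, and multiplying by it cancels the weight, also for
  infinite \<open>a\<close>.\<close>

lemma infsum_symmetries:
  fixes a :: ennreal and x :: "(nat, 'a) configuration"
  assumes X: "X \<in> Positions A" and x: "configuration A x"
    and \<kappa>: "\<kappa> \<in> symmetries (representative X) x" and \<mu>: "\<mu> \<in> symmetries (representative X) y"
  shows "(\<Sum>\<^sub>\<infinity>\<phi>\<in>symmetries x y. 1 / of_nat (card (Sym X)) * a) = a"
    "(\<Sum>\<^sub>\<infinity>\<phi>\<in>symmetries y x. 1 / of_nat (card (Sym X)) * a) = a"
proof -
  let ?n = "card (Sym X)"
  have fx: "finite (events x)" using configuration_finite[OF x] .
  have fX: "finite (events (representative X))"
    using configuration_finite[OF representative_position(1)[OF X]] .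
  have fy: "finite (events y)" using bij_betw_finite[OF symmetries_bij[OF \<mu>]] fX by simp
  have n: "card (symmetries x y) = ?n" "card (symmetries y x) = ?n"
    using card_symmetries_pre[OF \<kappa>] card_symmetries_post[OF \<mu>] card_symmetries_pre[OF \<mu>]
      card_symmetries_post[OF \<kappa>] unfolding Sym_def by metis+
  have "?n \<noteq> 0"
    using finite_symmetries[OF fX fX] symmetries_id[of "representative X"] by (auto simp: Sym_def)
  then have "(of_nat ?n :: ennreal) / of_nat ?n = 1"
    by (intro ennreal_divide_self) (simp_all add: of_nat_less_top)
  then have "of_nat ?n * (1 / of_nat ?n * a) = a"
    by (simp add: mult.assoc[symmetric] ennreal_times_divide)
  then show "(\<Sum>\<^sub>\<infinity>\<phi>\<in>symmetries x y. 1 / of_nat (card (Sym X)) * a) = a"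
    "(\<Sum>\<^sub>\<infinity>\<phi>\<in>symmetries y x. 1 / of_nat (card (Sym X)) * a) = a"
    using finite_symmetries[OF fx fy] finite_symmetries[OF fy fx] by (simp_all add: n)
qed

text \<open>Only copycats have nonzero weight, and composing one with \<open>P\<close> returns
  \<open>P\<close>, so \<open>P = R\<close>. The mediating symmetry then forces the copycat to
  belong to the position of the left part of \<open>R\<close>. What remains is a constant summed
  over one set of symmetries.\<close>

lemma compose_id_right:
  fixes A :: "'a arena" and B :: "'b arena"
  assumes A: "arena A" and R: "R \<in> Isog (A \<turnstile> B)"
  shows "compose_strat A A B f (id_strat A) R = f R"
proof -
  let ?x = "left_part (representative R)"
  note x = configuration_left_part[OF augmentation_configuration[OF representative_Isog(1)[OF R]]]
  define X where "X = position_of A ?x"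
  define Q where "Q = copycat_isog A X"
  have X: "X \<in> Positions A" using x by (auto simp: X_def Positions_def)
  let ?T = "symmetries (right_part (representative Q)) ?x"
  obtain \<kappa> where \<kappa>: "\<kappa> \<in> symmetries ?x (representative X)"
    using representative_position_of(2)[OF x] unfolding X_def by blast
  obtain \<mu> where \<mu>: "\<mu> \<in> symmetries (representative X) (right_part (representative Q))"
    using copycat_isog_parts[OF A X] unfolding Q_def by blast
  have "compose_strat A A B f (id_strat A) R =
      (\<Sum>\<^sub>\<infinity>t\<in>factorizations A A B R. id_strat A (fst t) * f (fst (snd t)))"
    by (rule compose_strat_eq[OF R])
  also have "\<dots> = (\<Sum>\<^sub>\<infinity>t\<in>(\<lambda>\<phi>. (Q, R, \<phi>)) ` ?T. id_strat A (fst t) * f (fst (snd t)))"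
  proof (rule infsum_cong_neutral)
    \<comment> \<open>A vacuous case: every symmetry in \<open>?T\<close> gives a factorization of
      \<open>R\<close>, because the composite with the copycat does not depend on it.\<close>
    fix t assume t: "t \<in> (\<lambda>\<phi>. (Q, R, \<phi>)) ` ?T - factorizations A A B R"
    then show "id_strat A (fst t) * f (fst (snd t)) = 0"
      using copycat_isog_in[OF A X] R compose_isog_copycat_right[OF A X R]
      by (auto simp: factorizations_def Q_def)
  next
    fix t assume t: "t \<in> factorizations A A B R - (\<lambda>\<phi>. (Q, R, \<phi>)) ` ?T"
    obtain Q' P \<phi> where t_eq: "t = (Q', P, \<phi>)" by (metis prod.exhaust)
    have Q': "Q' \<in> Isog (A \<turnstile> A)" and P: "P \<in> Isog (A \<turnstile> B)"
      and \<phi>: "\<phi> \<in> symmetries (right_part (representative Q')) (left_part (representative P))"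
      and c: "compose_isog A A B P \<phi> Q' = R"
      using t unfolding t_eq factorizations_def by auto
    have "id_strat A Q' = 0"
    proof (rule ccontr)
      assume "id_strat A Q' \<noteq> 0"
      then obtain X' where X': "X' \<in> Positions A" "Q' = copycat_isog A X'"
        using id_strat_nonzero[OF Q'] by blast
      then have PR: "P = R" using compose_isog_copycat_right[OF A X'(1) P] \<phi> c by simp
      obtain \<nu> where "\<nu> \<in> symmetries (representative X') (right_part (representative Q'))"
        using copycat_isog_parts[OF A X'(1)] X'(2) by metis
      from position_of_eq[OF symmetries_compose[OF this \<phi>], of A] have "X' = X"
        using representative_position(2)[OF X'(1)] PR by (simp add: X_def)
      then show False using t \<phi> X'(2) PR by (auto simp: t_eq Q_def)
    qed
    then show "id_strat A (fst t) * f (fst (snd t)) = 0" by (simp add: t_eq)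
  qed simp
  also have "\<dots> = (\<Sum>\<^sub>\<infinity>\<phi>\<in>?T. id_strat A Q * f R)"
    by (subst infsum_reindex) (auto simp: inj_on_def comp_def)
  also have "\<dots> = f R"
    unfolding Q_def id_strat_copycat[OF A X]
    using infsum_symmetries(2)[OF X x inverse_symmetry(1)[OF \<kappa>] \<mu>] unfolding Q_def .
  finally show ?thesis .
qed

text \<open>The same argument on the right part of \<open>R\<close>. The mediating symmetry now
  leads into the copycat, so its inverse is what identifies the position.\<close>

lemma compose_id_left:
  fixes A :: "'a arena" and B :: "'b arena"
  assumes B: "arena B" and R: "R \<in> Isog (A \<turnstile> B)"
  shows "compose_strat A B B (id_strat B) f R = f R"
proof -
  let ?x = "right_part (representative R)"
  note x = configuration_right_part[OF augmentation_configuration[OF representative_Isog(1)[OF R]]]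
  define X where "X = position_of B ?x"
  define P where "P = copycat_isog B X"
  have X: "X \<in> Positions B" using x by (auto simp: X_def Positions_def)
  let ?T = "symmetries ?x (left_part (representative P))"
  obtain \<kappa> where \<kappa>: "\<kappa> \<in> symmetries ?x (representative X)"
    using representative_position_of(2)[OF x] unfolding X_def by blast
  obtain \<mu> where \<mu>: "\<mu> \<in> symmetries (representative X) (left_part (representative P))"
    using copycat_isog_parts[OF B X] unfolding P_def by blast
  have "compose_strat A B B (id_strat B) f R =
      (\<Sum>\<^sub>\<infinity>t\<in>factorizations A B B R. f (fst t) * id_strat B (fst (snd t)))"
    by (rule compose_strat_eq[OF R])
  also have "\<dots> = (\<Sum>\<^sub>\<infinity>t\<in>(\<lambda>\<phi>. (R, P, \<phi>)) ` ?T. f (fst t) * id_strat B (fst (snd t)))"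
  proof (rule infsum_cong_neutral)
    fix t assume t: "t \<in> (\<lambda>\<phi>. (R, P, \<phi>)) ` ?T - factorizations A B B R"
    then show "f (fst t) * id_strat B (fst (snd t)) = 0"
      using copycat_isog_in[OF B X] R compose_isog_copycat_left[OF B X R]
      by (auto simp: factorizations_def P_def)
  next
    fix t assume t: "t \<in> factorizations A B B R - (\<lambda>\<phi>. (R, P, \<phi>)) ` ?T"
    obtain Q P' \<phi> where t_eq: "t = (Q, P', \<phi>)" by (metis prod.exhaust)
    have Q: "Q \<in> Isog (A \<turnstile> B)" and P': "P' \<in> Isog (B \<turnstile> B)"
      and \<phi>: "\<phi> \<in> symmetries (right_part (representative Q)) (left_part (representative P'))"
      and c: "compose_isog A B B P' \<phi> Q = R"
      using t unfolding t_eq factorizations_def by auto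
    have "id_strat B P' = 0"
    proof (rule ccontr)
      assume "id_strat B P' \<noteq> 0"
      then obtain X' where X': "X' \<in> Positions B" "P' = copycat_isog B X'"
        using id_strat_nonzero[OF P'] by blast
      then have QR: "Q = R" using compose_isog_copycat_left[OF B X'(1) Q] \<phi> c by simp
      obtain \<nu> where "\<nu> \<in> symmetries (representative X') (left_part (representative P'))"
        using copycat_isog_parts[OF B X'(1)] X'(2) by metis
      from position_of_eq[OF symmetries_compose[OF this inverse_symmetry(1)[OF \<phi>]], of B] have "X' = X"
        using representative_position(2)[OF X'(1)] QR by (simp add: X_def)
      then show False using t \<phi> X'(2) QR by (auto simp: t_eq P_def)
    qed
    then show "f (fst t) * id_strat B (fst (snd t)) = 0" by (simp add: t_eq)
  qed simp
  also have "\<dots> = (\<Sum>\<^sub>\<infinity>\<phi>\<in>?T. id_strat B P * f R)"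
    by (subst infsum_reindex) (auto simp: inj_on_def comp_def mult.commute)
  also have "\<dots> = f R"
    unfolding P_def id_strat_copycat[OF B X]
    using infsum_symmetries(1)[OF X x inverse_symmetry(1)[OF \<kappa>] \<mu>] unfolding P_def .
  finally show ?thesis .
qed

theorem theorem5p7:
  shows "category {A :: 'a arena. arena A \<and> negative A}
           (\<lambda>A B. strategies (A \<turnstile> B)) id_strat compose_strat"
proof
  fix A B C D :: "'a arena" and f g h
  assume "A \<in> {A. arena A \<and> negative A}"
  then have A: "arena A" "negative A" by auto
  show "id_strat A \<in> strategies (A \<turnstile> A)" by (rule id_strat_in)
  assume "B \<in> {A. arena A \<and> negative A}"
  then have B: "arena B" "negative B" by auto
  show "compose_strat A B C g f \<in> strategies (A \<turnstile> C)" by (rule compose_strat_in)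
  assume f: "f \<in> strategies (A \<turnstile> B)"
  show "compose_strat A A B f (id_strat A) = f"
    by (rule strategy_eqI[OF compose_strat_in f compose_id_right[OF A(1)]])
  show "compose_strat A B B (id_strat B) f = f"
    by (rule strategy_eqI[OF compose_strat_in f compose_id_left[OF B(1)]])
  assume "C \<in> {A. arena A \<and> negative A}" "D \<in> {A. arena A \<and> negative A}"
  then have C: "arena C" "negative C" and D: "arena D" by auto
  show "compose_strat A C D h (compose_strat A B C g f) = compose_strat A B D (compose_strat B C D h g) f"
    by (rule strategy_eqI[OF compose_strat_in compose_strat_in])
      (simp add: compose_strat_left compose_strat_right A B C D)
qed

end
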